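(* Let $\lambda$ be an essentially regular point, let $\{H_s=H_0+sV:s\in\mathbb R\}$, $V=F^*JF$, be a line regular at $\lambda$, let $r_\lambda$ be a real resonance point of this line at $\lambda$ and let $k$ be a positive integer. For either choice of the sign $\pm$, if $u_{\lambda\pm i0}(r_\lambda)\in\Upsilon_{\lambda\pm i0}(r_\lambda)$ is a resonance vector of order $k\ge1$ at $\lambda\pm i0$, then for all non-resonant values of $s$ $$\bigl\langle Ju_{\lambda\pm i0}(r_\lambda),\operatorname{Im}T_{\lambda\pm i0}(H_s)Ju_{\lambda\pm i0}(r_\lambda)\bigr\rangle=\frac{c_{\pm2}}{(s-r_\lambda)^2}+\frac{c_{\pm3}}{(s-r_\lambda)^3}+\ldots+\frac{c_{\pm k}}{(s-r_\lambda)^k},$$ where, in case $k\ge2$, for $j=2,\ldots,k$ $$c_{\pm j}=\operatorname{Im}\bigl\langle u_{\lambda\pm i0}(r_\lambda),J\mathbf A^{j-1}_{\lambda\pm i0}(r_\lambda)u_{\lambda\pm i0}(r_\lambda)\bigr\rangle=-\operatorname{Im}\bigl\langle u_{\lambda\pm i0}(r_\lambda),J\mathbf A^{j-1}_{\lambda\mp i0}(r_\lambda)u_{\lambda\pm i0}(r_\lambda)\bigr\rangle .$$ In particular, if $u_{\lambda\pm i0}(r_\lambda)$ is a resonance vector of order $1$, then $$\bigl\langle Ju_{\lambda\pm i0}(r_\lambda),\operatorname{Im}T_{\lambda\pm i0}(H_s)Ju_{\lambda\pm i0}(r_\lambda)\bigr\rangle=0 .$$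
   Context: Setting. Scalar products are linear in the second argument. $\mathcal H,\mathcal K$ are complex separable Hilbert spaces. $F:\mathcal H\to\mathcal K$ is a closed densely defined operator with trivial kernel and co-kernel (the rigging operator). $\mathcal A_0(F)$ is a real vector space of self-adjoint operators $V=F^*JF$ on $\mathcal H$, with $J$ running over a real subspace of the bounded self-adjoint operators on $\mathcal K$, and $\mathcal A=H+\mathcal A_0(F)$ is an affine space of self-adjoint operators; $H_0\in\mathcal A$, $V\in\mathcal A_0(F)$. Standing assumptions: all $H\in\mathcal A$ have a common dense domain $\mathcal D$; $\mathcal D\subset\operatorname{dom}(F)$ and $\mathcal D\subset\operatorname{dom}(V)$ for all $V\in\mathcal A_0(F)$; every $V\in\mathcal A_0(F)$ is relatively compact with respect to every $H\in\mathcal A$; and for non-real $z$ the operator $T_z(H):=F(H-z)^{-1}F^*$ (densely defined on $\operatorname{dom}F^*$) extends to a compact operator on $\mathcal K$, also denoted $T_z(H)$. $\Lambda(H,F)$ is the set of real $\lambda$ for which the norm limits $T_{\lambda\pm i0}(H):=\lim_{y\to0^+}T_{\lambda\pm iy}(H)$ exist; it is assumed to have full Lebesgue measure for every $H\in\mathcal A$. Elements of $\bigcup_{H\in\mathcal A}\Lambda(H,F)$ are called essentially regular. $H$ is regular at $\lambda$ if $\lambda\in\Lambda(H,F)$ and resonant at $\lambda$ otherwise. A line $\{H_0+sV\}$ is regular at $\lambda$ if some $H_s$ is regular at $\lambda$; a real $s$ is non-resonant if $H_s$ is regular at $\lambda$, otherwise it is a real resonance point. $\operatorname{Im}T=(T-T^*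 )/(2i)$. For $z=\lambda\pm i0$ and non-resonant $s$ put $A_z(s)=T_z(H_s)J$; as a function of $s$ it extends meromorphically to $\mathbb C$, its real poles being the real resonance points. For such a pole $r_\lambda$, $\Upsilon^k_z(r_\lambda)=\{u\in\mathcal K:(1+(r_\lambda-s)A_z(s))^ku=0\}$ (independent of the non-resonant real $s$), $\Upsilon_z(r_\lambda)=\bigcup_k\Upsilon_z^k(r_\lambda)$; a resonance vector has order $k$ if it is in $\Upsilon^k_z(r_\lambda)$ but not in $\Upsilon^{k-1}_z(r_\lambda)$. $\mathbf A_z(r_\lambda)=\frac1{2\pi i}\oint_{C(r_\lambda)}(s-r_\lambda)A_z(s)\,ds$, where $C(r_\lambda)$ is a small counter-clockwise circle around $r_\lambda$ enclosing no other poles; $\mathbf A^j_z(r_\lambda)$ is its $j$-th power. *)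

theory Defs
  imports "HOL-Analysis.Analysis" "HOL-Complex_Analysis.Contour_Integration"
begin

section \<open>Complex Hilbert spaces\<close>

class scaleC =
  fixes scaleC :: "complex \<Rightarrow> 'a \<Rightarrow> 'a" (infixr "*\<^sub>C" 75)

text \<open>The scalar product is linear in the second argument. Positivity and definiteness follow
  from the last axiom and the axioms of a normed space. Separability is not part of the class;
  it is the additional sort \<open>second_countable_topology\<close>.\<close>

class chilbert_space = banach + scaleC +
  fixes cinner :: "'a \<Rightarrow> 'a \<Rightarrow> complex"
  assumes scaleC_add_right: "a *\<^sub>C (x + y) = a *\<^sub>C x + a *\<^sub>C y"
    and scaleC_add_left: "(a + b) *\<^sub>C x = a *\<^sub>C x + b *\<^sub>C x"
    and scaleC_scaleC: "a *\<^sub>C (b *\<^sub>C x) = (a * b) *\<^sub>C x"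
    and scaleR_scaleC: "r *\<^sub>R x = complex_of_real r *\<^sub>C x"
    and cinner_commute: "cinner x y = cnj (cinner y x)"
    and cinner_add_right: "cinner x (y + z) = cinner x y + cinner x z"
    and cinner_scaleC_right: "cinner x (a *\<^sub>C y) = a * cinner x y"
    and norm_eq_sqrt_cinner: "norm x = sqrt (Re (cinner x x))"

lemma norm_scaleC: "norm (a *\<^sub>C x) = cmod a * norm (x :: 'a :: chilbert_space)"
proof -
  have "cinner (a *\<^sub>C x) (a *\<^sub>C x) = a * cnj a * cinner x x"
    using cinner_commute[of "a *\<^sub>C x" x] cinner_commute[of x x]
    by (simp add: cinner_scaleC_right)
  then have "Re (cinner (a *\<^sub>C x) (a *\<^sub>C x)) = (cmod a)\<^sup>2 * Re (cinner x x)"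
    by (simp add: complex_mult_cnj cmod_power2 flip: of_real_power of_real_add)
  then show ?thesis
    by (simp add: norm_eq_sqrt_cinner real_sqrt_mult)
qed

lemma bounded_linear_scaleC: "bounded_linear (\<lambda>x :: 'a :: chilbert_space. a *\<^sub>C x)"
proof (rule bounded_linear_intro)
  show "a *\<^sub>C (x + y) = a *\<^sub>C x + a *\<^sub>C y" for x y :: 'a
    by (rule scaleC_add_right)
  show "a *\<^sub>C (r *\<^sub>R x) = r *\<^sub>R (a *\<^sub>C x)" for r and x :: 'a
    by (simp add: scaleR_scaleC scaleC_scaleC mult.commute)
  show "norm (a *\<^sub>C x) \<le> norm x * cmod a" for x :: 'a
    by (simp add: norm_scaleC)
qed

text \<open>Bounded operators are elements of the type \<open>'a \<Rightarrow>\<^sub>L 'b\<close> (whose elements are only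
  real-linear a priori) with the operator norm topology. All bounded operators below are
  complex-linear, being self-adjoint or derived from complex-linear operators.\<close>

instantiation blinfun :: (real_normed_vector, chilbert_space) scaleC
begin

lift_definition scaleC_blinfun :: "complex \<Rightarrow> 'a \<Rightarrow>\<^sub>L 'b \<Rightarrow> 'a \<Rightarrow>\<^sub>L 'b" is "\<lambda>a T x. a *\<^sub>C T x"
  by (rule bounded_linear_compose[OF bounded_linear_scaleC])

instance ..

end

definition compact_op :: "('a :: real_normed_vector \<Rightarrow>\<^sub>L 'b :: real_normed_vector) \<Rightarrow> bool" where
  "compact_op T \<longleftrightarrow> compact (closure (blinfun_apply T ` cball 0 1))"

definition bounded_selfadjoint :: "('a :: chilbert_space \<Rightarrow>\<^sub>L 'a) \<Rightarrow> bool" where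
  "bounded_selfadjoint T \<longleftrightarrow> (\<forall>x y. cinner (blinfun_apply T x) y = cinner x (blinfun_apply T y))"

definition bounded_adj :: "('a :: chilbert_space \<Rightarrow>\<^sub>L 'a) \<Rightarrow> ('a \<Rightarrow>\<^sub>L 'a)" where
  "bounded_adj T =
     (THE S. \<forall>x y. cinner (blinfun_apply S x) y = cinner x (blinfun_apply T y))"

definition Im_op :: "('a :: chilbert_space \<Rightarrow>\<^sub>L 'a) \<Rightarrow> ('a \<Rightarrow>\<^sub>L 'a)" where
  "Im_op T = (1 / (2 * \<i>)) *\<^sub>C (T - bounded_adj T)"

section \<open>Unbounded operators, represented by their graphs\<close>

text \<open>The domain of an operator is the library's \<open>Domain\<close> of its graph, and the product
  of two operators is relational composition: \<open>G O G'\<close> means ``first \<open>G\<close>, then \<open>G'\<close>''.\<close>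

definition linear_operator :: "('a :: chilbert_space \<times> 'b :: chilbert_space) set \<Rightarrow> bool" where
  "linear_operator G \<longleftrightarrow> single_valued G \<and> (0, 0) \<in> G \<and>
     (\<forall>x y x' y'. (x, y) \<in> G \<longrightarrow> (x', y') \<in> G \<longrightarrow> (x + x', y + y') \<in> G) \<and>
     (\<forall>a x y. (x, y) \<in> G \<longrightarrow> (a *\<^sub>C x, a *\<^sub>C y) \<in> G)"

definition densely_defined :: "('a :: topological_space \<times> 'b) set \<Rightarrow> bool" where
  "densely_defined G \<longleftrightarrow> closure (Domain G) = UNIV"

definition adj :: "('a :: chilbert_space \<times> 'b :: chilbert_space) set \<Rightarrow> ('b \<times> 'a) set" where
  "adj G = {(y, x). \<forall>(u, v) \<in> G. cinner y v = cinner x u}"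

definition self_adjoint :: "('a :: chilbert_space \<times> 'a) set \<Rightarrow> bool" where
  "self_adjoint G \<longleftrightarrow> linear_operator G \<and> densely_defined G \<and> adj G = G"

definition op_add :: "('a \<times> 'b :: plus) set \<Rightarrow> ('a \<times> 'b) set \<Rightarrow> ('a \<times> 'b) set" where
  "op_add G G' = {(x, y + y') | x y y'. (x, y) \<in> G \<and> (x, y') \<in> G'}"

definition op_scaleR :: "real \<Rightarrow> ('a \<times> 'b :: real_vector) set \<Rightarrow> ('a \<times> 'b) set" where
  "op_scaleR s G = {(x, s *\<^sub>R y) | x y. (x, y) \<in> G}"

definition bounded_graph ::
    "('a :: real_normed_vector \<Rightarrow>\<^sub>L 'b :: real_normed_vector) \<Rightarrow> ('a \<times> 'b) set" where
  "bounded_graph T = {(x, blinfun_apply T x) | x. True}"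

definition resolvent :: "('a :: chilbert_space \<times> 'a) set \<Rightarrow> complex \<Rightarrow> ('a \<times> 'a) set" where
  "resolvent G z = {(y - z *\<^sub>C x, x) | x y. (x, y) \<in> G}"

definition relatively_compact ::
    "('a :: chilbert_space \<times> 'a) set \<Rightarrow> ('a \<times> 'a) set \<Rightarrow> bool" where
  "relatively_compact V G \<longleftrightarrow> Domain G \<subseteq> Domain V \<and>
     (\<forall>z. Im z \<noteq> 0 \<longrightarrow> (\<exists>K. compact_op K \<and> resolvent G z O V = bounded_graph K))"

section \<open>The rigging and the affine space of operators\<close>

text \<open>The product $F^*JF$ on its natural domain, and the self-adjoint operator $V = F^*JF$.
  The closure is taken because the product itself need not be closed: for \<open>J = 0\<close> it is
  the zero operator on \<open>Domain F\<close>, which is self-adjoint only if \<open>F\<close> is bounded. Where the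
  product is already self-adjoint, the closure changes nothing.\<close>

definition rigged_product :: "('h :: chilbert_space \<times> 'k :: chilbert_space) set \<Rightarrow>
    ('k \<Rightarrow>\<^sub>L 'k) \<Rightarrow> ('h \<times> 'h) set" where
  "rigged_product F J = F O bounded_graph J O adj F"

definition rigged_op :: "('h :: chilbert_space \<times> 'k :: chilbert_space) set \<Rightarrow>
    ('k \<Rightarrow>\<^sub>L 'k) \<Rightarrow> ('h \<times> 'h) set" where
  "rigged_op F J = closure (rigged_product F J)"

definition affine_ops :: "('h :: chilbert_space \<times> 'k :: chilbert_space) set \<Rightarrow>
    ('h \<times> 'h) set \<Rightarrow> ('k \<Rightarrow>\<^sub>L 'k) set \<Rightarrow> ('h \<times> 'h) set set" where
  "affine_ops F H \<J> = (\<lambda>J. op_add H (rigged_op F J)) ` \<J>"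

definition sandwiched_resolvent_graph :: "('h :: chilbert_space \<times> 'k :: chilbert_space) set \<Rightarrow>
    ('h \<times> 'h) set \<Rightarrow> complex \<Rightarrow> ('k \<times> 'k) set" where
  "sandwiched_resolvent_graph F H z = adj F O resolvent H z O F"

text \<open>$T_z(H)$: the (unique) bounded extension of $F(H-z)^{-1}F^*$.\<close>

definition T_op :: "('h :: chilbert_space \<times> 'k :: chilbert_space) set \<Rightarrow>
    ('h \<times> 'h) set \<Rightarrow> complex \<Rightarrow> ('k \<Rightarrow>\<^sub>L 'k)" where
  "T_op F H z = (THE T. sandwiched_resolvent_graph F H z \<subseteq> bounded_graph T)"

text \<open>The sign in $\mu \pm i0$ is given by \<open>\<sigma> \<in> {1, -1}\<close>.\<close>

definition T_lim :: "('h :: chilbert_space \<times> 'k :: chilbert_space) set \<Rightarrow>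
    ('h \<times> 'h) set \<Rightarrow> real \<Rightarrow> real \<Rightarrow> ('k \<Rightarrow>\<^sub>L 'k)" where
  "T_lim F H \<mu> \<sigma> = Lim (at_right 0) (\<lambda>y. T_op F H (Complex \<mu> (\<sigma> * y)))"

definition regular_points :: "('h :: chilbert_space \<times> 'k :: chilbert_space) set \<Rightarrow>
    ('h \<times> 'h) set \<Rightarrow> real set" where
  "regular_points F H =
     {\<mu>. \<forall>\<sigma>\<in>{1, -1}. \<exists>L. ((\<lambda>y. T_op F H (Complex \<mu> (\<sigma> * y))) \<longlongrightarrow> L) (at_right 0)}"

definition essentially_regular_points :: "('h :: chilbert_space \<times> 'k :: chilbert_space) set \<Rightarrow>
    ('h \<times> 'h) set \<Rightarrow> ('k \<Rightarrow>\<^sub>L 'k) set \<Rightarrow> real set" where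
  "essentially_regular_points F H \<J> = (\<Union>H'\<in>affine_ops F H \<J>. regular_points F H')"

text \<open>The affine space is \<open>H + {V. V = rigged_op F J, J \<in> \<J>}\<close>. The assumption
  \<open>D \<subseteq> Domain (rigged_product F J)\<close> is the requirement that the common domain \<open>D\<close> be
  contained in the domain of $V = F^*JF$, understood as an operator product.\<close>

locale rigged_affine_space =
  fixes F :: "('h :: {chilbert_space, second_countable_topology} \<times>
               'k :: {chilbert_space, second_countable_topology}) set"
    and H :: "('h \<times> 'h) set" and \<J> :: "('k \<Rightarrow>\<^sub>L 'k) set" and D :: "'h set"
  assumes F_linear: "linear_operator F"
    and F_dense: "densely_defined F"
    and F_closed: "closed F"
    and F_kernel: "{x. (x, 0) \<in> F} = {0}"
    and F_cokernel: "{y. (y, 0) \<in> adj F} = {0}"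
    and J_subspace: "subspace \<J>"
    and J_selfadjoint: "J \<in> \<J> \<Longrightarrow> bounded_selfadjoint J"
    and V_selfadjoint: "J \<in> \<J> \<Longrightarrow> self_adjoint (rigged_op F J)"
    and A_selfadjoint: "H' \<in> affine_ops F H \<J> \<Longrightarrow> self_adjoint H'"
    and A_domain: "H' \<in> affine_ops F H \<J> \<Longrightarrow> Domain H' = D"
    and D_dense: "closure D = UNIV"
    and D_F: "D \<subseteq> Domain F"
    and D_V: "J \<in> \<J> \<Longrightarrow> D \<subseteq> Domain (rigged_product F J)"
    and V_relatively_compact:
      "J \<in> \<J> \<Longrightarrow> H' \<in> affine_ops F H \<J> \<Longrightarrow> relatively_compact (rigged_op F J) H'"
    and T_compact: "H' \<in> affine_ops F H \<J> \<Longrightarrow> Im z \<noteq> 0 \<Longrightarrow>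
      \<exists>T. compact_op T \<and> sandwiched_resolvent_graph F H' z \<subseteq> bounded_graph T"
    and regular_full_measure:
      "H' \<in> affine_ops F H \<J> \<Longrightarrow> - regular_points F H' \<in> null_sets lebesgue"

section \<open>Meromorphic operator-valued functions\<close>

definition op_holomorphic_on ::
    "(complex \<Rightarrow> ('a :: chilbert_space \<Rightarrow>\<^sub>L 'a)) \<Rightarrow> complex set \<Rightarrow> bool" where
  "op_holomorphic_on f S \<longleftrightarrow>
     (\<forall>z\<in>S. \<exists>f'. ((\<lambda>w. (1 / (w - z)) *\<^sub>C (f w - f z)) \<longlongrightarrow> f') (at z within S))"

text \<open>As for the library's scalar notion, the values at the (isolated) singularities are
  irrelevant.\<close>

definition op_meromorphic ::
    "(complex \<Rightarrow> ('a :: chilbert_space \<Rightarrow>\<^sub>L 'a)) \<Rightarrow> bool" where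
  "op_meromorphic f \<longleftrightarrow>
     (\<forall>p. \<exists>n :: nat. \<exists>g. \<exists>\<epsilon>>0. op_holomorphic_on g (ball p \<epsilon>) \<and>
        (\<forall>z\<in>ball p \<epsilon> - {p}. f z = (1 / (z - p) ^ n) *\<^sub>C g z))"

text \<open>The operator-valued counterpart of \<open>has_contour_integral\<close>.\<close>

definition has_op_contour_integral ::
    "(complex \<Rightarrow> ('a :: chilbert_space \<Rightarrow>\<^sub>L 'a)) \<Rightarrow> ('a \<Rightarrow>\<^sub>L 'a) \<Rightarrow> (real \<Rightarrow> complex) \<Rightarrow> bool" where
  "has_op_contour_integral f I \<gamma> \<longleftrightarrow>
     ((\<lambda>t. vector_derivative \<gamma> (at t within {0..1}) *\<^sub>C f (\<gamma> t)) has_integral I) {0..1}"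

section \<open>Resonance points\<close>

definition line_op :: "('h :: chilbert_space \<times> 'k :: chilbert_space) set \<Rightarrow>
    ('h \<times> 'h) set \<Rightarrow> ('k \<Rightarrow>\<^sub>L 'k) \<Rightarrow> real \<Rightarrow> ('h \<times> 'h) set" where
  "line_op F H0 J s = op_add H0 (op_scaleR s (rigged_op F J))"

definition nonresonant :: "('h :: chilbert_space \<times> 'k :: chilbert_space) set \<Rightarrow>
    ('h \<times> 'h) set \<Rightarrow> ('k \<Rightarrow>\<^sub>L 'k) \<Rightarrow> real \<Rightarrow> real \<Rightarrow> bool" where
  "nonresonant F H0 J \<mu> s \<longleftrightarrow> \<mu> \<in> regular_points F (line_op F H0 J s)"

definition regular_line :: "('h :: chilbert_space \<times> 'k :: chilbert_space) set \<Rightarrow>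
    ('h \<times> 'h) set \<Rightarrow> ('k \<Rightarrow>\<^sub>L 'k) \<Rightarrow> real \<Rightarrow> bool" where
  "regular_line F H0 J \<mu> \<longleftrightarrow> (\<exists>s. nonresonant F H0 J \<mu> s)"

definition real_resonance_point :: "('h :: chilbert_space \<times> 'k :: chilbert_space) set \<Rightarrow>
    ('h \<times> 'h) set \<Rightarrow> ('k \<Rightarrow>\<^sub>L 'k) \<Rightarrow> real \<Rightarrow> real \<Rightarrow> bool" where
  "real_resonance_point F H0 J \<mu> r \<longleftrightarrow> \<not> nonresonant F H0 J \<mu> r"

definition A_op :: "('h :: chilbert_space \<times> 'k :: chilbert_space) set \<Rightarrow>
    ('h \<times> 'h) set \<Rightarrow> ('k \<Rightarrow>\<^sub>L 'k) \<Rightarrow> real \<Rightarrow> real \<Rightarrow> real \<Rightarrow> ('k \<Rightarrow>\<^sub>L 'k)" where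
  "A_op F H0 J \<mu> \<sigma> s = T_lim F (line_op F H0 J s) \<mu> \<sigma> o\<^sub>L J"

text \<open>The meromorphic extension is unique up to its values at isolated points.\<close>

definition A_mero :: "('h :: chilbert_space \<times> 'k :: chilbert_space) set \<Rightarrow>
    ('h \<times> 'h) set \<Rightarrow> ('k \<Rightarrow>\<^sub>L 'k) \<Rightarrow> real \<Rightarrow> real \<Rightarrow> complex \<Rightarrow> ('k \<Rightarrow>\<^sub>L 'k)" where
  "A_mero F H0 J \<mu> \<sigma> = (SOME f. op_meromorphic f \<and>
     (\<forall>s :: real. nonresonant F H0 J \<mu> s \<longrightarrow> f (complex_of_real s) = A_op F H0 J \<mu> \<sigma> s))"

text \<open>The ``small circle'' is treated as in the library's definition of \<open>residue\<close>.\<close>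

definition A_nilpotent :: "('h :: chilbert_space \<times> 'k :: chilbert_space) set \<Rightarrow>
    ('h \<times> 'h) set \<Rightarrow> ('k \<Rightarrow>\<^sub>L 'k) \<Rightarrow> real \<Rightarrow> real \<Rightarrow> real \<Rightarrow> ('k \<Rightarrow>\<^sub>L 'k)" where
  "A_nilpotent F H0 J \<mu> \<sigma> r = (SOME B. \<exists>e>0. \<forall>\<epsilon>>0. \<epsilon> < e \<longrightarrow>
     has_op_contour_integral
       (\<lambda>s. (s - complex_of_real r) *\<^sub>C A_mero F H0 J \<mu> \<sigma> s)
       ((2 * complex_of_real pi * \<i>) *\<^sub>C B) (circlepath (complex_of_real r) \<epsilon>))"

text \<open>The spaces $\Upsilon^k_z(r)$ and $\Upsilon_z(r)$, computed from a non-resonant \<open>s\<close>, on whose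
  choice they do not depend.\<close>

definition resonance_space_order :: "('h :: chilbert_space \<times> 'k :: chilbert_space) set \<Rightarrow>
    ('h \<times> 'h) set \<Rightarrow> ('k \<Rightarrow>\<^sub>L 'k) \<Rightarrow> real \<Rightarrow> real \<Rightarrow> real \<Rightarrow> real \<Rightarrow> nat \<Rightarrow> 'k set" where
  "resonance_space_order F H0 J \<mu> \<sigma> r s k =
     {u. (blinfun_apply (id_blinfun + (r - s) *\<^sub>R A_op F H0 J \<mu> \<sigma> s) ^^ k) u = 0}"

definition resonance_space :: "('h :: chilbert_space \<times> 'k :: chilbert_space) set \<Rightarrow>
    ('h \<times> 'h) set \<Rightarrow> ('k \<Rightarrow>\<^sub>L 'k) \<Rightarrow> real \<Rightarrow> real \<Rightarrow> real \<Rightarrow> real \<Rightarrow> 'k set" where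
  "resonance_space F H0 J \<mu> \<sigma> r s = (\<Union>k. resonance_space_order F H0 J \<mu> \<sigma> r s k)"

definition resonance_vector_order :: "('h :: chilbert_space \<times> 'k :: chilbert_space) set \<Rightarrow>
    ('h \<times> 'h) set \<Rightarrow> ('k \<Rightarrow>\<^sub>L 'k) \<Rightarrow> real \<Rightarrow> real \<Rightarrow> real \<Rightarrow> real \<Rightarrow> 'k \<Rightarrow> nat \<Rightarrow> bool" where
  "resonance_vector_order F H0 J \<mu> \<sigma> r s u k \<longleftrightarrow>
     u \<in> resonance_space_order F H0 J \<mu> \<sigma> r s k \<and>
     u \<notin> resonance_space_order F H0 J \<mu> \<sigma> r s (k - 1)"

end

theory Submission
  imports Defs "HOL-Complex_Analysis.Complex_Analysis"
begin

text \<open>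
  The resolvent identity \<open>T(s) = T(s') + (s' - s) T(s') J T(s)\<close> passes to the boundary values at
  \<open>\<mu> \<plusminus> i0\<close>, so \<open>A(s) = a (1 + (s - s0) a)\<inverse>\<close> with \<open>a = A(s0)\<close> a norm limit of compact operators.
  Approximating \<open>a\<close> by finite-rank operators and inverting one rank-one perturbation at a time shows that
  the right-hand side is meromorphic in \<open>s\<close>; by the identity theorem it is the meromorphic extension
  of \<open>A\<close>. Put \<open>d = r - s0\<close> and \<open>B = 1 + d a\<close>. On the kernel of \<open>B^k\<close> a geometric sum gives
  \<open>A(s) u = \<Sum>j. Q^j u / (s - r)^(j + 1)\<close> with \<open>Q = d B (1 - B)\<inverse>\<close>, hence \<open>Q\<close> is there the residue of
  \<open>(s - r) A(s)\<close>. Since the adjoint of \<open>T\<close> at \<open>\<mu> + i0\<close> is \<open>T\<close> at \<open>\<mu> - i0\<close>, the quadratic form of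
  the imaginary part of \<open>T\<close> on \<open>J u\<close> is the imaginary part of \<open>\<langle>u, J A(s) u\<rangle>\<close>, whose term of order one is
  \<open>Im \<langle>u, J u\<rangle> = 0\<close>. The two expressions for the coefficients agree because the residues at
  \<open>\<mu> + i0\<close> and \<open>\<mu> - i0\<close> are adjoint to each other with respect to the form \<open>\<langle>\<cdot>, J \<cdot>\<rangle>\<close>.
\<close>

section \<open>Complex Hilbert spaces\<close>

text \<open>The geometric sum comes from inverting \<open>A(s)\<close> itself. On the kernel of
  \<open>B^k\<close> the operator \<open>a = (B - 1) / d\<close> is invertible, because
  \<open>B\<close> is nilpotent there. With \<open>w = s - r\<close> one has
  \<open>1 + (s - s0) a = B + w a\<close>, so the inverse of \<open>A(s)\<close> on that space is
  \<open>w + B a^-1 = w - Q\<close>, and \<open>1 / (w - Q)\<close> is a finite sum because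
  \<open>Q\<close> is nilpotent as well. The obstacle is that \<open>A_mero\<close> and
  \<open>A_nilpotent\<close> are arbitrary choices. Nothing can be computed from them until some
  meromorphic extension is known to exist, which is why a Fredholm theorem is proved although the
  expansion at nonresonant real \<open>s\<close> is plain algebra. The identity theorem asks for
  coincidence at accumulating points; they are available because small perturbations of a
  nonresonant \<open>s0\<close> stay nonresonant. The second formula for the coefficients has an
  asymmetry: \<open>u\<close> is a root vector at the sign \<open>\<sigma>\<close> only. The residue
  at \<open>- \<sigma>\<close> is therefore not expanded on \<open>u\<close>; it is moved to the
  other argument of the form and expanded there at \<open>\<sigma>\<close>, with the conjugate
  parameter.\<close>

class complex_normed_space = real_normed_vector + scaleC +
  assumes cscale_add_right: "a *\<^sub>C (x + y) = a *\<^sub>C x + a *\<^sub>C y"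
    and cscale_add_left: "(a + b) *\<^sub>C x = a *\<^sub>C x + b *\<^sub>C x"
    and cscale_cscale: "a *\<^sub>C (b *\<^sub>C x) = (a * b) *\<^sub>C x"
    and scaleR_cscale: "t *\<^sub>R x = complex_of_real t *\<^sub>C x"
    and norm_cscale: "norm (a *\<^sub>C x) = cmod a * norm x"

instance chilbert_space \<subseteq> complex_normed_space
  by standard (fact Defs.scaleC_add_right scaleC_add_left scaleC_scaleC scaleR_scaleC norm_scaleC)+

text \<open>Spaces of operators carry a complex scaling but no scalar product; the class exists so
  that the calculus of \<open>*\<^sub>C\<close> and its continuity serve vectors and operators
  alike.\<close>

instance blinfun :: (real_normed_vector, chilbert_space) complex_normed_space
proof
  fix a b :: complex and t :: real and S T :: "'a \<Rightarrow>\<^sub>L 'b"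
  show "a *\<^sub>C (S + T) = a *\<^sub>C S + a *\<^sub>C T" "(a + b) *\<^sub>C T = a *\<^sub>C T + b *\<^sub>C T"
    "a *\<^sub>C b *\<^sub>C T = (a * b) *\<^sub>C T"
    by (rule blinfun_eqI, simp add: scaleC_blinfun.rep_eq blinfun.add_left cscale_add_right
        cscale_add_left cscale_cscale)+
  show "t *\<^sub>R T = complex_of_real t *\<^sub>C T"
    by (rule blinfun_eqI) (simp add: scaleC_blinfun.rep_eq blinfun.scaleR_left scaleR_cscale)
  \<comment> \<open>The reverse inequality follows from this one, applied to
    \<open>inverse a\<close> and \<open>a *\<^sub>C T\<close>.\<close>
  have le: "norm (c *\<^sub>C X) \<le> cmod c * norm X" for c and X :: "'a \<Rightarrow>\<^sub>L 'b"
  proof (rule norm_blinfun_bound)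
    show "norm (blinfun_apply (c *\<^sub>C X) x) \<le> cmod c * norm X * norm x" for x
      using norm_blinfun[of X x]
      by (simp add: scaleC_blinfun.rep_eq norm_cscale mult.assoc mult_left_mono)
  qed simp
  show "norm (a *\<^sub>C T) = cmod a * norm T"
  proof (cases "a = 0")
    case True
    then show ?thesis using le[of 0 T] by simp
  next
    case False
    have "T = inverse a *\<^sub>C a *\<^sub>C T"
      using False
      by (intro blinfun_eqI)
        (simp add: scaleC_blinfun.rep_eq cscale_cscale scaleR_cscale[of 1, simplified, symmetric])
    then have "norm T \<le> cmod (inverse a) * norm (a *\<^sub>C T)"
      using le[of "inverse a" "a *\<^sub>C T"] by simp
    then have "cmod a * norm T \<le> norm (a *\<^sub>C T)"
      using False by (simp add: norm_inverse norm_divide field_simps)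
    then show ?thesis using le[of a T] by simp
  qed
qed

interpretation cscale: vector_space "scaleC :: complex \<Rightarrow> 'a :: complex_normed_space \<Rightarrow> 'a"
  by standard (simp_all add: cscale_add_right cscale_add_left cscale_cscale
      scaleR_cscale[of 1, simplified, symmetric])

lemma bounded_bilinear_cscale:
  "bounded_bilinear (scaleC :: complex \<Rightarrow> 'a :: complex_normed_space \<Rightarrow> 'a)"
proof
  show "(t *\<^sub>R a) *\<^sub>C x = t *\<^sub>R (a *\<^sub>C x)" "a *\<^sub>C (t *\<^sub>R x) = t *\<^sub>R (a *\<^sub>C x)"
    for t a and x :: 'a
    by (simp_all add: scaleR_cscale cscale_cscale scaleR_conv_of_real mult.commute)
  show "\<exists>K. \<forall>a (x :: 'a). norm (a *\<^sub>C x) \<le> norm a * norm x * K"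
    by (rule exI[of _ 1]) (simp add: norm_cscale)
qed (simp_all add: cscale_add_right cscale_add_left)

lemmas tendsto_cscale [tendsto_intros] = bounded_bilinear.tendsto[OF bounded_bilinear_cscale]
lemmas continuous_on_cscale [continuous_intros] =
  bounded_bilinear.continuous_on[OF bounded_bilinear_cscale]

section \<open>Elementary calculus of the scalar product\<close>

lemma cinner_add_left: "cinner (x + y) z = cinner x z + cinner (y :: 'a :: chilbert_space) z"
  by (metis cinner_add_right cinner_commute complex_cnj_add)

lemma cinner_scaleC_left: "cinner (a *\<^sub>C x) y = cnj a * cinner x (y :: 'a :: chilbert_space)"
  by (metis cinner_scaleC_right cinner_commute complex_cnj_mult)

lemma cinner_zero_right [simp]: "cinner x (0 :: 'a :: chilbert_space) = 0"
  using cinner_scaleC_right[of x 0 0] by simp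

lemma cinner_zero_left [simp]: "cinner (0 :: 'a :: chilbert_space) x = 0"
  using cinner_scaleC_left[of 0 0 x] by simp

lemma cinner_minus_right [simp]: "cinner x (- y) = - cinner x (y :: 'a :: chilbert_space)"
  using cinner_add_right[of x y "- y"] by (simp add: add_eq_0_iff)

lemma cinner_minus_left [simp]: "cinner (- x) y = - cinner x (y :: 'a :: chilbert_space)"
  using cinner_add_left[of x "- x" y] by (simp add: add_eq_0_iff)

lemma cinner_diff_right: "cinner x (y - z) = cinner x y - cinner x (z :: 'a :: chilbert_space)"
  using cinner_add_right[of x y "- z"] by simp

lemma cinner_diff_left: "cinner (x - y) z = cinner x z - cinner (y :: 'a :: chilbert_space) z"
  using cinner_add_left[of x "- y" z] by simp

lemma cinner_sum_right: "cinner x (sum f A) = (\<Sum>i\<in>A. cinner x (f i :: 'a :: chilbert_space))"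
  by (induction A rule: infinite_finite_induct) (auto simp: cinner_add_right)

lemma cinner_self: "cinner x x = complex_of_real ((norm (x :: 'a :: chilbert_space))\<^sup>2)"
proof -
  have "Im (cinner x x) = 0"
    using cinner_commute[of x x] by (metis Reals_cnj_iff complex_is_Real_iff)
  moreover have "0 \<le> Re (cinner x x)"
    using norm_ge_zero[of x] unfolding norm_eq_sqrt_cinner by simp
  ultimately show ?thesis
    by (simp add: norm_eq_sqrt_cinner complex_eq_iff)
qed

lemma cinner_eq_zero_iff [simp]: "cinner x x = 0 \<longleftrightarrow> x = (0 :: 'a :: chilbert_space)"
  by (simp add: cinner_self)

lemma norm_add_sq:
  "(norm (x + y))\<^sup>2 = (norm x)\<^sup>2 + (norm y)\<^sup>2 + 2 * Re (cinner x (y :: 'a :: chilbert_space))"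
proof -
  have "cinner (x + y) (x + y) = cinner x x + cinner y y + (cinner x y + cnj (cinner x y))"
    by (simp add: cinner_add_left cinner_add_right cinner_commute[of y x])
  then have "Re (cinner (x + y) (x + y)) = Re (cinner x x + cinner y y + (cinner x y + cnj (cinner x y)))"
    by simp
  then show ?thesis by (simp add: cinner_self)
qed

lemma norm_diff_sq:
  "(norm (x - y))\<^sup>2 = (norm x)\<^sup>2 + (norm y)\<^sup>2 - 2 * Re (cinner x (y :: 'a :: chilbert_space))"
  using norm_add_sq[of x "- y"] by simp

text \<open>Cauchy--Schwarz: \<open>c\<close> makes \<open>y - c *\<^sub>C x\<close> the component
  of \<open>y\<close> orthogonal to \<open>x\<close>, and the squared norm of this component is
  nonnegative.\<close>

lemma cmod_cinner_le: "cmod (cinner x y) \<le> norm x * norm (y :: 'a :: chilbert_space)"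
proof (cases "x = 0")
  case False
  define c where "c = cinner x y / complex_of_real ((norm x)\<^sup>2)"
  have "0 \<le> (norm (y - c *\<^sub>C x))\<^sup>2" by simp
  also have "\<dots> = (norm y)\<^sup>2 + (cmod c)\<^sup>2 * (norm x)\<^sup>2 - 2 * Re (c * cnj (cinner x y))"
    by (simp add: norm_diff_sq norm_cscale power_mult_distrib cinner_scaleC_right cinner_commute[of y x])
  also have "c * cnj (cinner x y) = complex_of_real ((cmod (cinner x y))\<^sup>2 / (norm x)\<^sup>2)"
    unfolding c_def by (simp add: complex_norm_square del: of_real_power)
  also have "(cmod c)\<^sup>2 * (norm x)\<^sup>2 = (cmod (cinner x y))\<^sup>2 / (norm x)\<^sup>2"
    using False by (simp add: c_def norm_divide norm_mult power_divide power2_eq_square)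
  finally have "(cmod (cinner x y))\<^sup>2 / (norm x)\<^sup>2 \<le> (norm y)\<^sup>2" by simp
  then have "(cmod (cinner x y))\<^sup>2 \<le> (norm x * norm y)\<^sup>2"
    using False by (simp add: field_simps power_mult_distrib)
  then show ?thesis by (rule power2_le_imp_le) simp
qed simp

lemma bounded_linear_cinner_right: "bounded_linear (cinner (x :: 'a :: chilbert_space))"
proof (rule bounded_linear_intro[where K = "norm x"])
  show "cinner x (t *\<^sub>R y) = t *\<^sub>R cinner x y" for t y
    by (simp add: scaleR_cscale cinner_scaleC_right scaleR_conv_of_real)
  show "norm (cinner x y) \<le> norm y * norm x" for y
    using cmod_cinner_le[of x y] by (simp add: mult.commute)
qed (rule cinner_add_right)

lemma bounded_linear_cinner_left: "bounded_linear (\<lambda>x. cinner x (y :: 'a :: chilbert_space))"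
proof (rule bounded_linear_intro[where K = "norm y"])
  show "cinner (t *\<^sub>R x) y = t *\<^sub>R cinner x y" for t x
    by (simp add: scaleR_cscale cinner_scaleC_left scaleR_conv_of_real)
  show "norm (cinner x y) \<le> norm x * norm y" for x
    by (rule cmod_cinner_le)
qed (rule cinner_add_left)

lemmas tendsto_cinner_right = bounded_linear.tendsto[OF bounded_linear_cinner_right]
lemmas tendsto_cinner_left = bounded_linear.tendsto[OF bounded_linear_cinner_left]

lemma cinner_eqI:
  assumes "\<And>w. cinner w x = cinner w (y :: 'a :: chilbert_space)"
  shows "x = y"
proof -
  have "cinner (x - y) (x - y) = 0" using assms[of "x - y"] by (simp add: cinner_diff_right)
  then show ?thesis by simp
qed

subsection \<open>Separation from a closed subspace\<close>

text \<open>The parallelogram law solved for the distance of \<open>a\<close> and \<open>b\<close>.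
  Two points of a subspace that are both nearly nearest to \<open>x\<close> are close to each other,
  since their midpoint is not nearer than the infimum.\<close>

lemma parallelogram_midpoint:
  fixes x a b :: "'a :: chilbert_space"
  shows "(norm (a - b))\<^sup>2 = 2 * (norm (x - a))\<^sup>2 + 2 * (norm (x - b))\<^sup>2
    - 4 * (norm (x - (1/2) *\<^sub>R (a + b)))\<^sup>2"
proof -
  have "2 *\<^sub>R (x - (1/2) *\<^sub>R (a + b)) = (x - a) + (x - b)"
    by (simp add: algebra_simps scaleR_2)
  then have "norm ((x - a) + (x - b)) = 2 * norm (x - (1/2) *\<^sub>R (a + b))"
    by (metis norm_scaleR abs_numeral)
  then have "4 * (norm (x - (1/2) *\<^sub>R (a + b)))\<^sup>2 = (norm ((x - a) + (x - b)))\<^sup>2"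
    by (simp add: power_mult_distrib)
  moreover have "a - b = (x - b) - (x - a)" by simp
  moreover have "(norm (u + v))\<^sup>2 + (norm (v - u))\<^sup>2 = 2 * (norm u)\<^sup>2 + 2 * (norm v)\<^sup>2"
    for u v :: 'a
    by (simp add: norm_add_sq norm_diff_sq cinner_commute[of v u])
  ultimately show ?thesis by (smt (verit, best))
qed

definition csubspace :: "'a :: complex_normed_space set \<Rightarrow> bool" where
  "csubspace S \<longleftrightarrow> 0 \<in> S \<and> (\<forall>x\<in>S. \<forall>y\<in>S. x + y \<in> S) \<and> (\<forall>a. \<forall>x\<in>S. a *\<^sub>C x \<in> S)"

lemma closed_csubspace_nearest:
  fixes S :: "'a :: chilbert_space set"
  assumes S: "csubspace S" and cl: "closed S"
  shows "\<exists>p\<in>S. \<forall>q\<in>S. norm (x - p) \<le> norm (x - q)"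
proof -
  define d where "d = infdist x S"
  have ne: "S \<noteq> {}" using S by (auto simp: csubspace_def)
  have d_le: "d \<le> norm (x - q)" if "q \<in> S" for q
    using infdist_le[OF that, of x] by (simp add: d_def dist_norm)
  have d0: "0 \<le> d" by (simp add: d_def infdist_nonneg)
  have "\<exists>q\<in>S. norm (x - q) < d + 1 / real (Suc n)" for n
  proof (rule ccontr)
    assume "\<not> ?thesis"
    then have "\<And>q. q \<in> S \<Longrightarrow> d + 1 / real (Suc n) \<le> dist x q"
      by (auto simp: dist_norm not_less)
    then have "d + 1 / real (Suc n) \<le> infdist x S"
      using ne by (auto simp: infdist_def intro!: cINF_greatest)
    then show False unfolding d_def by (smt (verit) divide_pos_pos of_nat_0_less_iff zero_less_Suc)
  qed
  then obtain q where qS: "\<And>n. q n \<in> S" and q: "\<And>n. norm (x - q n) < d + 1 / real (Suc n)"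
    by metis
  have "Cauchy q"
  proof (rule metric_CauchyI)
    fix e :: real assume e: "0 < e"
    \<comment> \<open>This is the bound that the parallelogram law gives for two points of
      \<open>S\<close> within \<open>d + t\<close> of \<open>x\<close>; it tends to 0 with
      \<open>t\<close>.\<close>
    have "((\<lambda>t. 4 * (d + t)\<^sup>2 - 4 * d\<^sup>2) \<longlongrightarrow> 4 * (d + 0)\<^sup>2 - 4 * d\<^sup>2) (at_right 0)"
      by (intro tendsto_intros)
    then have "\<forall>\<^sub>F t in at_right 0. 4 * (d + t)\<^sup>2 - 4 * d\<^sup>2 < e\<^sup>2"
      using e by (intro order_tendstoD(2)) auto
    then obtain b where b: "0 < b" "\<And>t. 0 < t \<Longrightarrow> t < b \<Longrightarrow> 4 * (d + t)\<^sup>2 - 4 * d\<^sup>2 < e\<^sup>2"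
      by (auto simp: eventually_at_right_field)
    obtain N where N: "1 / real (Suc N) < b"
      using nat_approx_posE[OF b(1)] by auto
    show "\<exists>M. \<forall>m\<ge>M. \<forall>n\<ge>M. dist (q m) (q n) < e"
    proof (intro exI allI impI)
      fix m n assume mn: "N \<le> m" "N \<le> n"
      let ?t = "1 / real (Suc N)"
      have le: "(norm (x - q i))\<^sup>2 \<le> (d + ?t)\<^sup>2" if "N \<le> i" for i
      proof (rule power_mono)
        have "1 / real (Suc i) \<le> ?t" using that by (intro divide_left_mono) auto
        then show "norm (x - q i) \<le> d + ?t" using q[of i] by linarith
      qed simp
      have "(1/2) *\<^sub>R (q m + q n) \<in> S"
        using S qS unfolding csubspace_def scaleR_cscale by blast
      then have "d\<^sup>2 \<le> (norm (x - (1/2) *\<^sub>R (q m + q n)))\<^sup>2"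
        by (intro power_mono d_le d0)
      then have "(norm (q m - q n))\<^sup>2 \<le> 4 * (d + ?t)\<^sup>2 - 4 * d\<^sup>2"
        using parallelogram_midpoint[of "q m" "q n" x] le[OF mn(1)] le[OF mn(2)] by linarith
      also have "\<dots> < e\<^sup>2" using N by (intro b(2)) auto
      finally show "dist (q m) (q n) < e"
        using e by (simp add: dist_norm power2_less_imp_less)
    qed
  qed
  then obtain p where p: "q \<longlonglongrightarrow> p" using Cauchy_convergent convergent_def by blast
  have "p \<in> S" using closed_sequentially[OF cl] qS p by blast
  moreover have "norm (x - p) \<le> d"
  proof (rule LIMSEQ_le)
    show "(\<lambda>n. norm (x - q n)) \<longlonglongrightarrow> norm (x - p)" by (intro tendsto_intros p)
    have "(\<lambda>n. d + 1 / real (Suc n)) \<longlonglongrightarrow> d + 0"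
      by (intro tendsto_intros LIMSEQ_Suc lim_1_over_n)
    then show "(\<lambda>n. d + 1 / real (Suc n)) \<longlonglongrightarrow> d" by simp
    show "\<exists>N. \<forall>n\<ge>N. norm (x - q n) \<le> d + 1 / real (Suc n)"
      using q less_imp_le by blast
  qed
  ultimately show ?thesis using d_le order_trans by blast
qed

text \<open>The separating vector is \<open>x\<close> minus its nearest point \<open>p\<close> in
  \<open>S\<close>. Moving \<open>p\<close> inside \<open>S\<close> along \<open>q\<close> cannot
  shorten it, and testing this with the optimal multiple \<open>c\<close> of \<open>q\<close> forces
  orthogonality.\<close>

lemma closed_csubspace_separation:
  fixes S :: "'a :: chilbert_space set"
  assumes S: "csubspace S" and cl: "closed S" and x: "x \<notin> S"
  obtains w where "\<And>q. q \<in> S \<Longrightarrow> cinner w q = 0" and "cinner w x \<noteq> 0"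
proof -
  obtain p where p: "p \<in> S" and min: "\<And>q. q \<in> S \<Longrightarrow> norm (x - p) \<le> norm (x - q)"
    using closed_csubspace_nearest[OF S cl] by blast
  define w where "w = x - p"
  have orth: "cinner w q = 0" if q: "q \<in> S" for q
  proof (cases "q = 0")
    case False
    define c where "c = cinner q w / complex_of_real ((norm q)\<^sup>2)"
    have "p + c *\<^sub>C q \<in> S" using S p q by (auto simp: csubspace_def)
    then have "norm w \<le> norm (w - c *\<^sub>C q)"
      using min unfolding w_def by (metis diff_diff_add)
    then have "(norm w)\<^sup>2 \<le> (norm (w - c *\<^sub>C q))\<^sup>2" by (intro power_mono) auto
    also have "\<dots> = (norm w)\<^sup>2 + (cmod c)\<^sup>2 * (norm q)\<^sup>2 - 2 * Re (c * cnj (cinner q w))"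
      by (simp add: norm_diff_sq norm_cscale power_mult_distrib cinner_scaleC_right
          cinner_commute[of w q])
    also have "c * cnj (cinner q w) = complex_of_real ((cmod (cinner q w))\<^sup>2 / (norm q)\<^sup>2)"
      unfolding c_def by (simp add: complex_norm_square del: of_real_power)
    also have "(cmod c)\<^sup>2 * (norm q)\<^sup>2 = (cmod (cinner q w))\<^sup>2 / (norm q)\<^sup>2"
      using False by (simp add: c_def norm_divide norm_mult power_divide power2_eq_square)
    finally have "(cmod (cinner q w))\<^sup>2 / (norm q)\<^sup>2 \<le> 0" by simp
    then have "cinner q w = 0" using False
      by (smt (verit, ccfv_SIG) divide_pos_pos norm_eq_zero zero_less_norm_iff zero_less_power)
    then show ?thesis using cinner_commute[of w q] by simp
  qed simp
  have "cinner w x = cinner w w" using orth[OF p] by (simp add: w_def cinner_diff_right)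
  moreover have "w \<noteq> 0" using p x by (auto simp: w_def)
  ultimately have "cinner w x \<noteq> 0" by simp
  with orth show thesis by (rule that)
qed

lemma closed_csubspace_eq_UNIV:
  fixes S :: "'a :: chilbert_space set"
  assumes "csubspace S" "closed S" "\<And>w. (\<And>q. q \<in> S \<Longrightarrow> cinner w q = 0) \<Longrightarrow> w = 0"
  shows "S = UNIV"
  using closed_csubspace_separation[OF assms(1,2)] assms(3)
  by (metis UNIV_eq_I cinner_zero_left)

lemma csubspace_closure:
  assumes "csubspace (S :: 'a :: complex_normed_space set)"
  shows "csubspace (closure S)"
  unfolding csubspace_def
proof (intro conjI ballI allI)
  show "0 \<in> closure S" using assms closure_subset by (auto simp: csubspace_def)
next
  fix x y assume "x \<in> closure S" "y \<in> closure S"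
  then obtain f g where f: "\<And>n. f n \<in> S" "f \<longlonglongrightarrow> x" and g: "\<And>n. g n \<in> S" "g \<longlonglongrightarrow> y"
    unfolding closure_sequential by blast
  have "(\<lambda>n. f n + g n) \<longlonglongrightarrow> x + y" by (intro tendsto_intros f g)
  moreover have "\<And>n. f n + g n \<in> S" using assms f g by (auto simp: csubspace_def)
  ultimately show "x + y \<in> closure S"
    unfolding closure_sequential by (intro exI[of _ "\<lambda>n. f n + g n"]) auto
next
  fix a x assume "x \<in> closure S"
  then obtain f where f: "\<And>n. f n \<in> S" "f \<longlonglongrightarrow> x"
    unfolding closure_sequential by blast
  have "(\<lambda>n. a *\<^sub>C f n) \<longlonglongrightarrow> a *\<^sub>C x" by (intro tendsto_intros f)
  moreover have "\<And>n. a *\<^sub>C f n \<in> S" using assms f by (auto simp: csubspace_def)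
  ultimately show "a *\<^sub>C x \<in> closure S"
    unfolding closure_sequential by (intro exI[of _ "\<lambda>n. a *\<^sub>C f n"]) auto
qed

subsection \<open>Products of Hilbert spaces and density of the domain of the adjoint\<close>

text \<open>Graphs become subspaces of a Hilbert space, so that the separation theorem applies to a
  closed graph.\<close>

instantiation prod :: (chilbert_space, chilbert_space) chilbert_space
begin

definition scaleC_prod :: "complex \<Rightarrow> 'a \<times> 'b \<Rightarrow> 'a \<times> 'b" where
  "scaleC_prod a p = (a *\<^sub>C fst p, a *\<^sub>C snd p)"

definition cinner_prod :: "'a \<times> 'b \<Rightarrow> 'a \<times> 'b \<Rightarrow> complex" where
  "cinner_prod p q = cinner (fst p) (fst q) + cinner (snd p) (snd q)"

instance
proof
  fix a b :: complex and t :: real and p q s :: "'a \<times> 'b"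
  show "t *\<^sub>R p = complex_of_real t *\<^sub>C p"
    by (simp add: scaleC_prod_def prod_eq_iff scaleR_cscale)
  show "cinner p q = cnj (cinner q p)"
    by (simp add: cinner_prod_def cinner_commute[of "fst p"] cinner_commute[of "snd p"])
  show "norm p = sqrt (Re (cinner p p))"
    by (simp add: cinner_prod_def cinner_self norm_prod_def)
qed (simp_all add: scaleC_prod_def cinner_prod_def prod_eq_iff cscale_add_right cscale_add_left
      cscale_cscale cinner_add_right cinner_scaleC_right algebra_simps)

end

lemma linear_operator_imp_csubspace: "linear_operator G \<Longrightarrow> csubspace G"
  by (auto simp: linear_operator_def csubspace_def scaleC_prod_def zero_prod_def)

lemma adj_zero: "(0, 0) \<in> adj G"
  by (auto simp: adj_def)

lemma adj_add: "(y, x) \<in> adj G \<Longrightarrow> (y', x') \<in> adj G \<Longrightarrow> (y + y', x + x') \<in> adj G"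
  by (fastforce simp: adj_def cinner_add_left)

lemma adj_scaleC: "(y, x) \<in> adj G \<Longrightarrow> (a *\<^sub>C y, a *\<^sub>C x) \<in> adj G"
  by (fastforce simp: adj_def cinner_scaleC_left)

lemma adj_scaleR: "(y, x) \<in> adj G \<Longrightarrow> (a *\<^sub>R y, a *\<^sub>R x) \<in> adj G"
  by (simp add: scaleR_cscale adj_scaleC)

lemma adjD: "(y, x) \<in> adj G \<Longrightarrow> (u, v) \<in> G \<Longrightarrow> cinner y v = cinner x u"
  by (auto simp: adj_def)

lemma csubspace_Domain_adj: "csubspace (Domain (adj G))"
  unfolding csubspace_def using adj_zero adj_add adj_scaleC by blast

text \<open>A vector \<open>y\<close> orthogonal to the domain of the adjoint satisfies \<open>(0, y) \<in> G\<close>, because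
  the orthogonal complement of \<open>G\<close> consists of the pairs \<open>(x, - y')\<close> with \<open>(y', x)\<close> in the
  graph of the adjoint.\<close>

lemma densely_defined_adj:
  fixes G :: "('a :: chilbert_space \<times> 'b :: chilbert_space) set"
  assumes lin: "linear_operator G" and cl: "closed G"
  shows "densely_defined (adj G)"
  unfolding densely_defined_def
proof (rule closed_csubspace_eq_UNIV)
  fix y assume y: "\<And>q. q \<in> closure (Domain (adj G)) \<Longrightarrow> cinner y q = 0"
  have "(0, y) \<in> G"
  proof (rule ccontr)
    assume "(0, y) \<notin> G"
    then obtain w where w: "\<And>q. q \<in> G \<Longrightarrow> cinner w q = 0" and wy: "cinner w (0, y) \<noteq> 0"
      using closed_csubspace_separation[OF linear_operator_imp_csubspace[OF lin] cl] by blast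
    have "(snd w, - fst w) \<in> adj G"
      using w by (fastforce simp: adj_def cinner_prod_def eq_neg_iff_add_eq_0 add.commute)
    then have "cinner y (snd w) = 0" using y closure_subset by blast
    then have "cinner (snd w) y = 0" using cinner_commute[of "snd w" y] by simp
    then show False using wy by (simp add: cinner_prod_def)
  qed
  then show "y = 0" using lin by (auto simp: linear_operator_def single_valued_def)
qed (auto intro: csubspace_closure csubspace_Domain_adj)

section \<open>Complex-linear bounded operators\<close>

text \<open>The type of bounded operators guarantees real linearity only, whereas complex scalars
  have to pass through operators in difference quotients and pole factors. Complex linearity is
  therefore carried along as a predicate.\<close>

definition clinear_op :: "('a :: complex_normed_space \<Rightarrow>\<^sub>L 'b :: complex_normed_space) \<Rightarrow> bool" where
  "clinear_op T \<longleftrightarrow> (\<forall>a x. blinfun_apply T (a *\<^sub>C x) = a *\<^sub>C blinfun_apply T x)"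

lemma clinear_opD: "clinear_op T \<Longrightarrow> blinfun_apply T (a *\<^sub>C x) = a *\<^sub>C blinfun_apply T x"
  by (simp add: clinear_op_def)

lemma clinear_op_add: "clinear_op S \<Longrightarrow> clinear_op T \<Longrightarrow> clinear_op (S + T)"
  by (simp add: clinear_op_def blinfun.add_left cscale_add_right)

lemma clinear_op_diff: "clinear_op S \<Longrightarrow> clinear_op T \<Longrightarrow> clinear_op (S - T)"
  by (simp add: clinear_op_def blinfun.diff_left cscale.scale_right_diff_distrib)

lemma clinear_op_scaleC:
  "clinear_op T \<Longrightarrow> clinear_op (a *\<^sub>C (T :: 'a :: complex_normed_space \<Rightarrow>\<^sub>L 'b :: chilbert_space))"
  by (simp add: clinear_op_def scaleC_blinfun.rep_eq cscale_cscale mult.commute)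

lemma clinear_op_zero: "clinear_op 0"
  by (simp add: clinear_op_def)

lemma clinear_op_id: "clinear_op id_blinfun"
  by (simp add: clinear_op_def)

lemma clinear_op_compose: "clinear_op S \<Longrightarrow> clinear_op T \<Longrightarrow> clinear_op (S o\<^sub>L T)"
  by (simp add: clinear_op_def)

lemmas clinear_op_intros =
  clinear_op_add clinear_op_diff clinear_op_scaleC clinear_op_zero clinear_op_id clinear_op_compose

lemma clinear_op_limit:
  assumes "(T \<longlongrightarrow> L) F" "F \<noteq> bot" "\<forall>\<^sub>F x in F. clinear_op (T x)"
  shows "clinear_op L"
  unfolding clinear_op_def
proof (intro allI)
  fix a x
  have "((\<lambda>y. blinfun_apply (T y) (a *\<^sub>C x)) \<longlongrightarrow> blinfun_apply L (a *\<^sub>C x)) F"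
    by (intro tendsto_intros assms)
  moreover have "((\<lambda>y. a *\<^sub>C blinfun_apply (T y) x) \<longlongrightarrow> a *\<^sub>C blinfun_apply L x) F"
    by (intro tendsto_intros assms)
  then have "((\<lambda>y. blinfun_apply (T y) (a *\<^sub>C x)) \<longlongrightarrow> a *\<^sub>C blinfun_apply L x) F"
    by (rule Lim_transform_eventually)
      (use assms(3) in \<open>eventually_elim, simp add: clinear_op_def\<close>)
  ultimately show "blinfun_apply L (a *\<^sub>C x) = a *\<^sub>C blinfun_apply L x"
    using tendsto_unique assms(2) by blast
qed

lemma scaleC_compose_left: "(a *\<^sub>C S) o\<^sub>L T = a *\<^sub>C (S o\<^sub>L T)"
  by (rule blinfun_eqI) (simp add: scaleC_blinfun.rep_eq)

lemma scaleC_compose_right: "clinear_op S \<Longrightarrow> S o\<^sub>L (a *\<^sub>C T) = a *\<^sub>C (S o\<^sub>L T)"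
  by (rule blinfun_eqI) (simp add: scaleC_blinfun.rep_eq clinear_op_def)

interpretation blinfun_compose: bounded_bilinear
  "(o\<^sub>L) :: 'b :: real_normed_vector \<Rightarrow>\<^sub>L 'c :: real_normed_vector \<Rightarrow> 'a :: real_normed_vector \<Rightarrow>\<^sub>L 'b \<Rightarrow> 'a \<Rightarrow>\<^sub>L 'c"
  by (rule bounded_bilinear_blinfun_compose)

lemma norm_id_blinfun_le: "norm (id_blinfun :: 'a :: real_normed_vector \<Rightarrow>\<^sub>L 'a) \<le> 1"
  by (rule norm_blinfun_bound) auto

subsection \<open>Two-sided inverses\<close>

text \<open>A relation rather than a function, because the pencil is invertible only away from
  isolated points; uniqueness turns it into an equation wherever it holds.\<close>

definition inverse_ops :: "('a :: real_normed_vector \<Rightarrow>\<^sub>L 'a) \<Rightarrow> ('a \<Rightarrow>\<^sub>L 'a) \<Rightarrow> bool" where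
  "inverse_ops X M \<longleftrightarrow> X o\<^sub>L M = id_blinfun \<and> M o\<^sub>L X = id_blinfun"

lemma inverse_ops_iff:
  "inverse_ops X M \<longleftrightarrow>
     (\<forall>x. blinfun_apply X (blinfun_apply M x) = x \<and> blinfun_apply M (blinfun_apply X x) = x)"
  unfolding inverse_ops_def
  by (metis blinfun_apply_blinfun_compose blinfun_apply_id_blinfun blinfun_eqI)

lemma inverse_ops_unique: "inverse_ops X M \<Longrightarrow> inverse_ops Y M \<Longrightarrow> X = Y"
  by (metis blinfun_eqI inverse_ops_iff)

lemma clinear_op_inverse_ops: "inverse_ops X M \<Longrightarrow> clinear_op M \<Longrightarrow> clinear_op X"
  unfolding inverse_ops_iff clinear_op_def by metis

text \<open>The equation \<open>X = 1 - E X\<close> gives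
  \<open>norm X \<le> 1 + norm E * norm X\<close>, which is solved for
  \<open>norm X\<close>.\<close>

lemma inverse_ops_norm_le:
  fixes X E :: "'a :: real_normed_vector \<Rightarrow>\<^sub>L 'a"
  assumes "inverse_ops X (id_blinfun + E)" "norm E < 1"
  shows "norm X \<le> 1 / (1 - norm E)"
proof -
  have "X = id_blinfun - (E o\<^sub>L X)"
    using assms(1) unfolding inverse_ops_iff
    by (intro blinfun_eqI) (simp add: blinfun.add_left blinfun.diff_left eq_diff_eq)
  then have "norm X \<le> norm (id_blinfun :: 'a \<Rightarrow>\<^sub>L 'a) + norm (E o\<^sub>L X)"
    by (metis norm_triangle_ineq4)
  also have "\<dots> \<le> 1 + norm E * norm X"
    by (intro add_mono norm_id_blinfun_le norm_blinfun_compose)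
  finally have "norm X \<le> 1 + norm E * norm X" .
  then show ?thesis using assms(2) by (simp add: field_simps)
qed

text \<open>In place of a Neumann series, a right inverse is the fixed point of the contraction
  \<open>1 - E X\<close> and a left inverse that of \<open>1 - Y E\<close>; a left and a right
  inverse always coincide.\<close>

lemma inverse_ops_exists:
  fixes E :: "'a :: banach \<Rightarrow>\<^sub>L 'a"
  assumes E: "norm E < 1"
  shows "\<exists>X. inverse_ops X (id_blinfun + E)"
proof -
  have "\<exists>!X. id_blinfun - (E o\<^sub>L X) = X"
  proof (rule banach_fix_type[where c = "norm E"])
    show "\<forall>X Y. dist (id_blinfun - (E o\<^sub>L X)) (id_blinfun - (E o\<^sub>L Y)) \<le> norm E * dist X Y"
    proof (intro allI)
      fix X Y :: "'a \<Rightarrow>\<^sub>L 'a"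
      have "(id_blinfun - (E o\<^sub>L X)) - (id_blinfun - (E o\<^sub>L Y)) = E o\<^sub>L (Y - X)"
        by (simp add: blinfun_compose.diff_right)
      then show "dist (id_blinfun - (E o\<^sub>L X)) (id_blinfun - (E o\<^sub>L Y)) \<le> norm E * dist X Y"
        using norm_blinfun_compose[of E "Y - X"] by (simp add: dist_norm norm_minus_commute)
    qed
  qed (use E in auto)
  then obtain X where X: "id_blinfun - (E o\<^sub>L X) = X" by blast
  have "\<exists>!Y. id_blinfun - (Y o\<^sub>L E) = Y"
  proof (rule banach_fix_type[where c = "norm E"])
    show "\<forall>X Y. dist (id_blinfun - (X o\<^sub>L E)) (id_blinfun - (Y o\<^sub>L E)) \<le> norm E * dist X Y"
    proof (intro allI)
      fix X Y :: "'a \<Rightarrow>\<^sub>L 'a"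
      have "(id_blinfun - (X o\<^sub>L E)) - (id_blinfun - (Y o\<^sub>L E)) = (Y - X) o\<^sub>L E"
        by (simp add: blinfun_compose.diff_left)
      then show "dist (id_blinfun - (X o\<^sub>L E)) (id_blinfun - (Y o\<^sub>L E)) \<le> norm E * dist X Y"
        using norm_blinfun_compose[of "Y - X" E] by (simp add: dist_norm norm_minus_commute mult.commute)
    qed
  qed (use E in auto)
  then obtain Y where Y: "id_blinfun - (Y o\<^sub>L E) = Y" by blast
  have X': "X x + E (X x) = x" for x
    using arg_cong[OF X, of "\<lambda>T. blinfun_apply T x"] by (simp add: blinfun.diff_left algebra_simps)
  have Y': "Y x + Y (E x) = x" for x
    using arg_cong[OF Y, of "\<lambda>T. blinfun_apply T x"] by (simp add: blinfun.diff_left algebra_simps)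
  have "X x = Y x" for x
    using Y'[of "X x"] arg_cong[OF X'[of x], of Y] by (simp add: blinfun.add_right)
  then have "inverse_ops X (id_blinfun + E)"
    unfolding inverse_ops_iff using X' Y' by (simp add: blinfun.add_left blinfun.add_right)
  then show ?thesis ..
qed

section \<open>Holomorphic and meromorphic operator-valued functions\<close>

lemma op_holomorphic_onD:
  assumes "op_holomorphic_on f S" "z \<in> S"
  obtains f' where "((\<lambda>w. (1 / (w - z)) *\<^sub>C (f w - f z)) \<longlongrightarrow> f') (at z within S)"
  using assms by (auto simp: op_holomorphic_on_def)

lemma op_holomorphic_on_subset: "op_holomorphic_on f S \<Longrightarrow> T \<subseteq> S \<Longrightarrow> op_holomorphic_on f T"
  unfolding op_holomorphic_on_def by (blast intro: tendsto_within_subset)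

lemma op_holomorphic_on_imp_tendsto:
  assumes f: "op_holomorphic_on f S" and z: "z \<in> S"
  shows "(f \<longlongrightarrow> f z) (at z within S)"
proof -
  obtain f' where "((\<lambda>w. (1 / (w - z)) *\<^sub>C (f w - f z)) \<longlongrightarrow> f') (at z within S)"
    using op_holomorphic_onD[OF f z] .
  then have "((\<lambda>w. (w - z) *\<^sub>C ((1 / (w - z)) *\<^sub>C (f w - f z)) + f z) \<longlongrightarrow> (z - z) *\<^sub>C f' + f z)
      (at z within S)"
    by (intro tendsto_intros)
  moreover have "\<forall>\<^sub>F w in at z within S. (w - z) *\<^sub>C ((1 / (w - z)) *\<^sub>C (f w - f z)) + f z = f w"
    by (auto simp: eventually_at_filter cscale_cscale)
  ultimately show ?thesis
    by (auto elim: Lim_transform_eventually)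
qed

lemma op_holomorphic_on_imp_continuous_on: "op_holomorphic_on f S \<Longrightarrow> continuous_on S f"
  using op_holomorphic_on_imp_tendsto by (auto simp: continuous_on_def)

lemma op_holomorphic_on_const: "op_holomorphic_on (\<lambda>_. T) S"
  unfolding op_holomorphic_on_def by (rule ballI, rule exI[of _ 0]) simp

lemma op_holomorphic_on_add:
  assumes "op_holomorphic_on f S" "op_holomorphic_on g S"
  shows "op_holomorphic_on (\<lambda>z. f z + g z) S"
  unfolding op_holomorphic_on_def
proof
  fix z assume z: "z \<in> S"
  obtain f' where f': "((\<lambda>w. (1 / (w - z)) *\<^sub>C (f w - f z)) \<longlongrightarrow> f') (at z within S)"
    using op_holomorphic_onD[OF assms(1) z] .
  obtain g' where g': "((\<lambda>w. (1 / (w - z)) *\<^sub>C (g w - g z)) \<longlongrightarrow> g') (at z within S)"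
    using op_holomorphic_onD[OF assms(2) z] .
  from f' g' have "((\<lambda>w. (1 / (w - z)) *\<^sub>C (f w - f z) + (1 / (w - z)) *\<^sub>C (g w - g z)) \<longlongrightarrow> f' + g') (at z within S)"
    by (rule tendsto_add)
  then show "\<exists>d. ((\<lambda>w. (1 / (w - z)) *\<^sub>C (f w + g w - (f z + g z))) \<longlongrightarrow> d) (at z within S)"
    unfolding cscale_add_right[symmetric] add_diff_add[symmetric] by (rule exI)
qed

lemma op_holomorphic_on_scaleC:
  assumes c: "c holomorphic_on S" and f: "op_holomorphic_on f S"
  shows "op_holomorphic_on (\<lambda>z. c z *\<^sub>C f z) S"
  unfolding op_holomorphic_on_def
proof
  fix z assume z: "z \<in> S"
  obtain f' where f': "((\<lambda>w. (1 / (w - z)) *\<^sub>C (f w - f z)) \<longlongrightarrow> f') (at z within S)"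
    using op_holomorphic_onD[OF f z] .
  obtain c' where "(c has_field_derivative c') (at z within S)"
    using c z by (auto simp: holomorphic_on_def field_differentiable_def)
  then have c': "((\<lambda>w. (c w - c z) / (w - z)) \<longlongrightarrow> c') (at z within S)"
    by (simp add: has_field_derivative_iff)
  have "((\<lambda>w. ((c w - c z) / (w - z)) *\<^sub>C f w + c z *\<^sub>C ((1 / (w - z)) *\<^sub>C (f w - f z)))
      \<longlongrightarrow> c' *\<^sub>C f z + c z *\<^sub>C f') (at z within S)"
    by (intro tendsto_intros f' c' op_holomorphic_on_imp_tendsto[OF f z])
  moreover have "((c w - c z) / (w - z)) *\<^sub>C f w + c z *\<^sub>C ((1 / (w - z)) *\<^sub>C (f w - f z))
      = (1 / (w - z)) *\<^sub>C (c w *\<^sub>C f w - c z *\<^sub>C f z)" for w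
    by (simp add: cscale.scale_right_diff_distrib cscale_cscale diff_divide_distrib
        cscale.scale_left_diff_distrib)
  ultimately show "\<exists>d. ((\<lambda>w. (1 / (w - z)) *\<^sub>C (c w *\<^sub>C f w - c z *\<^sub>C f z)) \<longlongrightarrow> d) (at z within S)"
    by auto
qed

text \<open>The product rule. The scalar \<open>1 / (w - z)\<close> has to pass through the left
  factor \<open>f z\<close>, hence the assumption of complex linearity.\<close>

lemma op_holomorphic_on_compose:
  assumes f: "op_holomorphic_on f S" and g: "op_holomorphic_on g S"
    and lin: "\<And>z. z \<in> S \<Longrightarrow> clinear_op (f z)"
  shows "op_holomorphic_on (\<lambda>z. f z o\<^sub>L g z) S"
  unfolding op_holomorphic_on_def
proof
  fix z assume z: "z \<in> S"
  obtain f' where f': "((\<lambda>w. (1 / (w - z)) *\<^sub>C (f w - f z)) \<longlongrightarrow> f') (at z within S)"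
    using op_holomorphic_onD[OF f z] .
  obtain g' where g': "((\<lambda>w. (1 / (w - z)) *\<^sub>C (g w - g z)) \<longlongrightarrow> g') (at z within S)"
    using op_holomorphic_onD[OF g z] .
  have "((\<lambda>w. (((1 / (w - z)) *\<^sub>C (f w - f z)) o\<^sub>L g w) + (f z o\<^sub>L ((1 / (w - z)) *\<^sub>C (g w - g z))))
      \<longlongrightarrow> (f' o\<^sub>L g z) + (f z o\<^sub>L g')) (at z within S)"
    by (intro tendsto_intros blinfun_compose.tendsto f' g' op_holomorphic_on_imp_tendsto[OF g z])
  moreover have "(((1 / (w - z)) *\<^sub>C (f w - f z)) o\<^sub>L g w) + (f z o\<^sub>L ((1 / (w - z)) *\<^sub>C (g w - g z)))
      = (1 / (w - z)) *\<^sub>C ((f w o\<^sub>L g w) - (f z o\<^sub>L g z))" for w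
    by (simp add: scaleC_compose_left scaleC_compose_right[OF lin[OF z]] blinfun_compose.diff_left
        blinfun_compose.diff_right cscale_add_right[symmetric])
  ultimately show "\<exists>d. ((\<lambda>w. (1 / (w - z)) *\<^sub>C ((f w o\<^sub>L g w) - (f z o\<^sub>L g z))) \<longlongrightarrow> d) (at z within S)"
    by auto
qed

lemma op_holomorphic_on_functional:
  assumes f: "op_holomorphic_on f S" and \<phi>: "bounded_linear \<phi>" "\<And>a x. \<phi> (a *\<^sub>C x) = a * \<phi> x"
  shows "(\<lambda>z. \<phi> (blinfun_apply (f z) x)) holomorphic_on S"
  unfolding holomorphic_on_def field_differentiable_def has_field_derivative_iff
proof
  fix z assume z: "z \<in> S"
  obtain f' where "((\<lambda>w. (1 / (w - z)) *\<^sub>C (f w - f z)) \<longlongrightarrow> f') (at z within S)"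
    using op_holomorphic_onD[OF f z] .
  then have "((\<lambda>w. \<phi> (blinfun_apply ((1 / (w - z)) *\<^sub>C (f w - f z)) x)) \<longlongrightarrow> \<phi> (blinfun_apply f' x))
      (at z within S)"
    by (intro bounded_linear.tendsto[OF \<phi>(1)] tendsto_intros)
  then show "\<exists>d. ((\<lambda>w. (\<phi> (blinfun_apply (f w) x) - \<phi> (blinfun_apply (f z) x)) / (w - z)) \<longlongrightarrow> d)
      (at z within S)"
    by (auto simp: scaleC_blinfun.rep_eq \<phi>(2) blinfun.diff_left linear_diff[OF bounded_linear.linear[OF \<phi>(1)]])
qed

text \<open>The local form of \<open>op_meromorphic\<close>, strengthened by complex linearity of
  the numerator \<open>g\<close> so that compositions can be formed.\<close>

definition meromorphic_op_at ::
    "(complex \<Rightarrow> ('a :: chilbert_space \<Rightarrow>\<^sub>L 'a)) \<Rightarrow> complex \<Rightarrow> bool" where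
  "meromorphic_op_at f p \<longleftrightarrow> (\<exists>(n :: nat) g. \<exists>\<epsilon>>0. op_holomorphic_on g (ball p \<epsilon>) \<and>
     (\<forall>z\<in>ball p \<epsilon>. clinear_op (g z)) \<and> (\<forall>z\<in>ball p \<epsilon> - {p}. f z = (1 / (z - p) ^ n) *\<^sub>C g z))"

lemma meromorphic_op_atI:
  fixes n :: nat
  assumes "0 < \<epsilon>" "op_holomorphic_on g (ball p \<epsilon>)" "\<And>z. z \<in> ball p \<epsilon> \<Longrightarrow> clinear_op (g z)"
    and "\<forall>\<^sub>F z in at p. f z = (1 / (z - p) ^ n) *\<^sub>C g z"
  shows "meromorphic_op_at f p"
proof -
  obtain d where d: "d > 0" "\<And>z. z \<noteq> p \<Longrightarrow> dist z p < d \<Longrightarrow> f z = (1 / (z - p) ^ n) *\<^sub>C g z"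
    using assms(4) by (auto simp: eventually_at)
  show ?thesis
    unfolding meromorphic_op_at_def
    using assms d by (intro exI[of _ n] exI[of _ g] exI[of _ "min \<epsilon> d"])
      (auto simp: dist_commute intro: op_holomorphic_on_subset)
qed

lemma meromorphic_op_atE:
  assumes "meromorphic_op_at f p" "meromorphic_op_at h p"
  obtains n m :: nat and g k \<epsilon> where "0 < \<epsilon>"
    "op_holomorphic_on g (ball p \<epsilon>)" "\<And>z. z \<in> ball p \<epsilon> \<Longrightarrow> clinear_op (g z)"
    "\<And>z. z \<in> ball p \<epsilon> - {p} \<Longrightarrow> f z = (1 / (z - p) ^ n) *\<^sub>C g z"
    "op_holomorphic_on k (ball p \<epsilon>)" "\<And>z. z \<in> ball p \<epsilon> \<Longrightarrow> clinear_op (k z)"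
    "\<And>z. z \<in> ball p \<epsilon> - {p} \<Longrightarrow> h z = (1 / (z - p) ^ m) *\<^sub>C k z"
proof -
  obtain n g \<epsilon>1 where 1: "0 < \<epsilon>1" "op_holomorphic_on g (ball p \<epsilon>1)" "\<forall>z\<in>ball p \<epsilon>1. clinear_op (g z)"
    "\<forall>z\<in>ball p \<epsilon>1 - {p}. f z = (1 / (z - p) ^ n) *\<^sub>C g z"
    using assms(1) unfolding meromorphic_op_at_def by blast
  obtain m k \<epsilon>2 where 2: "0 < \<epsilon>2" "op_holomorphic_on k (ball p \<epsilon>2)" "\<forall>z\<in>ball p \<epsilon>2. clinear_op (k z)"
    "\<forall>z\<in>ball p \<epsilon>2 - {p}. h z = (1 / (z - p) ^ m) *\<^sub>C k z"
    using assms(2) unfolding meromorphic_op_at_def by blast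
  show thesis
    by (rule that[of "min \<epsilon>1 \<epsilon>2" g n k m]) (use 1 2 in \<open>auto intro: op_holomorphic_on_subset\<close>)
qed

lemma meromorphic_op_at_cong:
  assumes f: "meromorphic_op_at f p" and eq: "\<forall>\<^sub>F z in at p. h z = f z"
  shows "meromorphic_op_at h p"
proof -
  obtain n g \<epsilon> where g: "0 < \<epsilon>" "op_holomorphic_on g (ball p \<epsilon>)" "\<forall>z\<in>ball p \<epsilon>. clinear_op (g z)"
    "\<forall>z\<in>ball p \<epsilon> - {p}. f z = (1 / (z - p) ^ n) *\<^sub>C g z"
    using f unfolding meromorphic_op_at_def by blast
  have "\<forall>\<^sub>F z in at p. z \<in> ball p \<epsilon> - {p}"
    using g(1) by (intro eventually_at_in_open) auto
  then have "\<forall>\<^sub>F z in at p. h z = (1 / (z - p) ^ n) *\<^sub>C g z"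
    using eq by eventually_elim (use g in auto)
  then show ?thesis using g by (intro meromorphic_op_atI[of \<epsilon> g]) auto
qed

lemma meromorphic_op_at_const: "clinear_op T \<Longrightarrow> meromorphic_op_at (\<lambda>_. T) p"
  by (rule meromorphic_op_atI[of 1 "\<lambda>_. T" _ _ 0]) (auto intro: op_holomorphic_on_const)

lemma meromorphic_op_at_add:
  assumes "meromorphic_op_at f p" "meromorphic_op_at h p"
  shows "meromorphic_op_at (\<lambda>z. f z + h z) p"
proof -
  obtain n m :: nat and g k \<epsilon> where *: "0 < \<epsilon>"
    "op_holomorphic_on g (ball p \<epsilon>)" "\<And>z. z \<in> ball p \<epsilon> \<Longrightarrow> clinear_op (g z)"
    "\<And>z. z \<in> ball p \<epsilon> - {p} \<Longrightarrow> f z = (1 / (z - p) ^ n) *\<^sub>C g z"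
    "op_holomorphic_on k (ball p \<epsilon>)" "\<And>z. z \<in> ball p \<epsilon> \<Longrightarrow> clinear_op (k z)"
    "\<And>z. z \<in> ball p \<epsilon> - {p} \<Longrightarrow> h z = (1 / (z - p) ^ m) *\<^sub>C k z"
    by (rule meromorphic_op_atE[OF assms], rule that)
  have "\<forall>\<^sub>F z in at p. z \<in> ball p \<epsilon> - {p}"
    using *(1) by (intro eventually_at_in_open) auto
  then have "\<forall>\<^sub>F z in at p. f z + h z
      = (1 / (z - p) ^ (n + m)) *\<^sub>C ((z - p) ^ m *\<^sub>C g z + (z - p) ^ n *\<^sub>C k z)"
    by eventually_elim (simp add: * cscale_add_right cscale_cscale power_add)
  then show ?thesis
    using * by (intro meromorphic_op_atI[where \<epsilon> = \<epsilon>])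
      (auto intro!: op_holomorphic_on_add op_holomorphic_on_scaleC clinear_op_intros holomorphic_intros)
qed

lemma meromorphic_op_at_compose:
  assumes "meromorphic_op_at f p" "meromorphic_op_at h p"
  shows "meromorphic_op_at (\<lambda>z. f z o\<^sub>L h z) p"
proof -
  obtain n m :: nat and g k \<epsilon> where *: "0 < \<epsilon>"
    "op_holomorphic_on g (ball p \<epsilon>)" "\<And>z. z \<in> ball p \<epsilon> \<Longrightarrow> clinear_op (g z)"
    "\<And>z. z \<in> ball p \<epsilon> - {p} \<Longrightarrow> f z = (1 / (z - p) ^ n) *\<^sub>C g z"
    "op_holomorphic_on k (ball p \<epsilon>)" "\<And>z. z \<in> ball p \<epsilon> \<Longrightarrow> clinear_op (k z)"
    "\<And>z. z \<in> ball p \<epsilon> - {p} \<Longrightarrow> h z = (1 / (z - p) ^ m) *\<^sub>C k z"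
    by (rule meromorphic_op_atE[OF assms], rule that)
  have "\<forall>\<^sub>F z in at p. z \<in> ball p \<epsilon> - {p}"
    using *(1) by (intro eventually_at_in_open) auto
  then have "\<forall>\<^sub>F z in at p. f z o\<^sub>L h z = (1 / (z - p) ^ (n + m)) *\<^sub>C (g z o\<^sub>L k z)"
    by eventually_elim
      (simp add: * scaleC_compose_left scaleC_compose_right cscale_cscale power_add)
  then show ?thesis
    using * by (intro meromorphic_op_atI[where \<epsilon> = \<epsilon>])
      (auto intro!: op_holomorphic_on_compose clinear_op_intros)
qed

text \<open>Brings the scalar notion into the shape of \<open>meromorphic_op_at\<close>. The
  factorization theorem applies to functions that do not vanish identically near \<open>p\<close>;
  in the remaining case the numerator is 0. A nonnegative order is absorbed into the
  numerator.\<close>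

lemma meromorphic_on_pole_factor:
  assumes "c meromorphic_on {p}"
  obtains n :: nat and k \<epsilon> where "0 < \<epsilon>" "k holomorphic_on ball p \<epsilon>"
    "\<And>z. z \<in> ball p \<epsilon> - {p} \<Longrightarrow> c z = k z / (z - p) ^ n"
proof (cases "\<exists>\<^sub>F w in at p. c w \<noteq> 0")
  case True
  have "\<exists>n :: int. \<exists>g r. 0 < r \<and> g holomorphic_on cball p r \<and> g p \<noteq> 0 \<and>
      (\<forall>w\<in>cball p r - {p}. c w = g w * (w - p) powi n \<and> g w \<noteq> 0)"
    by (rule ex1_implies_ex[OF holomorphic_factor_puncture])
      (use assms True in \<open>auto simp: meromorphic_at_iff\<close>)
  then obtain n :: int and g \<epsilon> where g: "0 < \<epsilon>" "g holomorphic_on cball p \<epsilon>"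
      "\<forall>w\<in>cball p \<epsilon> - {p}. c w = g w * (w - p) powi n"
    by (elim exE conjE) (rule that, auto)
  have hol: "g holomorphic_on ball p \<epsilon>" using g(2) by (rule holomorphic_on_subset) auto
  show thesis
  proof (cases "0 \<le> n")
    case True
    then show thesis using g
      by (intro that[of \<epsilon> "\<lambda>w. g w * (w - p) ^ nat n" 0])
        (auto simp: power_int_def intro!: holomorphic_intros hol)
  next
    case False
    then show thesis using g
      by (intro that[of \<epsilon> g "nat (- n)"]) (auto simp: power_int_def field_simps intro: hol)
  qed
next
  case False
  then have "\<forall>\<^sub>F w in at p. c w = 0" by (simp add: not_frequently)
  then obtain d where "d > 0" "\<And>z. z \<noteq> p \<Longrightarrow> dist z p < d \<Longrightarrow> c z = 0"
    by (auto simp: eventually_at)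
  then show thesis by (intro that[of d "\<lambda>_. 0" 0]) (auto simp: dist_commute)
qed

lemma meromorphic_op_at_scaleC:
  assumes c: "c meromorphic_on {p}" and f: "meromorphic_op_at f p"
  shows "meromorphic_op_at (\<lambda>z. c z *\<^sub>C f z) p"
proof -
  obtain n g \<epsilon> where g: "0 < \<epsilon>" "op_holomorphic_on g (ball p \<epsilon>)" "\<forall>z\<in>ball p \<epsilon>. clinear_op (g z)"
    "\<forall>z\<in>ball p \<epsilon> - {p}. f z = (1 / (z - p) ^ n) *\<^sub>C g z"
    using f unfolding meromorphic_op_at_def by blast
  obtain m k \<epsilon>' where k: "0 < \<epsilon>'" "k holomorphic_on ball p \<epsilon>'"
    "\<And>z. z \<in> ball p \<epsilon>' - {p} \<Longrightarrow> c z = k z / (z - p) ^ m"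
    by (rule meromorphic_on_pole_factor[OF c], rule that)
  let ?e = "min \<epsilon> \<epsilon>'"
  have "\<forall>\<^sub>F z in at p. z \<in> ball p ?e - {p}"
    using g(1) k(1) by (intro eventually_at_in_open) auto
  then have "\<forall>\<^sub>F z in at p. c z *\<^sub>C f z = (1 / (z - p) ^ (n + m)) *\<^sub>C (k z *\<^sub>C g z)"
    by eventually_elim (simp add: g k cscale_cscale power_add)
  then show ?thesis
    using g k by (intro meromorphic_op_atI[where \<epsilon> = ?e and n = "n + m" and g = "\<lambda>z. k z *\<^sub>C g z"])
      (auto intro!: op_holomorphic_on_scaleC clinear_op_intros
        intro: op_holomorphic_on_subset holomorphic_on_subset)
qed

text \<open>Stated for the bare pole form, which \<open>op_meromorphic\<close> and
  \<open>meromorphic_op_at\<close> have in common.\<close>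

lemma op_pole_functional:
  fixes n :: nat
  assumes g: "0 < \<epsilon>" "op_holomorphic_on g (ball p \<epsilon>)"
    "\<forall>z\<in>ball p \<epsilon> - {p}. f z = (1 / (z - p) ^ n) *\<^sub>C g z"
    and \<phi>: "bounded_linear \<phi>" "\<And>a x. \<phi> (a *\<^sub>C x) = a * \<phi> x"
  shows "(\<lambda>z. \<phi> (blinfun_apply (f z) x)) meromorphic_on {p}"
proof -
  have "\<forall>\<^sub>F z in at p. z \<in> ball p \<epsilon> - {p}"
    using g(1) by (intro eventually_at_in_open) auto
  then have ev: "\<forall>\<^sub>F z in at p. \<phi> (blinfun_apply (f z) x) = \<phi> (blinfun_apply (g z) x) / (z - p) ^ n"
    by eventually_elim (simp add: g scaleC_blinfun.rep_eq \<phi>(2))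
  have "(\<lambda>z. \<phi> (blinfun_apply (g z) x)) analytic_on {p}"
    using op_holomorphic_on_functional[OF g(2) \<phi>] g(1)
    by (auto simp: analytic_on_def)
  then have "(\<lambda>z. \<phi> (blinfun_apply (g z) x) / (z - p) ^ n) meromorphic_on {p}"
    by (intro meromorphic_intros analytic_on_imp_meromorphic_on)
  then show ?thesis
    using meromorphic_on_cong[of "{p}" "\<lambda>z. \<phi> (blinfun_apply (f z) x)"
        "\<lambda>z. \<phi> (blinfun_apply (g z) x) / (z - p) ^ n" "{p}"] ev by simp
qed

lemma op_meromorphic_functional:
  assumes f: "op_meromorphic f" and \<phi>: "bounded_linear \<phi>" "\<And>a x. \<phi> (a *\<^sub>C x) = a * \<phi> x"
  shows "(\<lambda>z. \<phi> (blinfun_apply (f z) x)) meromorphic_on A"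
proof (subst meromorphic_on_meromorphic_at, rule ballI)
  fix p
  obtain n g \<epsilon> where "0 < \<epsilon>" "op_holomorphic_on g (ball p \<epsilon>)"
    "\<forall>z\<in>ball p \<epsilon> - {p}. f z = (1 / (z - p) ^ n) *\<^sub>C g z"
    using f unfolding op_meromorphic_def by blast
  then show "(\<lambda>z. \<phi> (blinfun_apply (f z) x)) meromorphic_on {p}"
    using \<phi> by (rule op_pole_functional)
qed

lemma meromorphic_op_at_functional:
  assumes f: "meromorphic_op_at f p" and \<phi>: "bounded_linear \<phi>" "\<And>a x. \<phi> (a *\<^sub>C x) = a * \<phi> x"
  shows "(\<lambda>z. \<phi> (blinfun_apply (f z) x)) meromorphic_on {p}"
proof -
  obtain n g \<epsilon> where "0 < \<epsilon>" "op_holomorphic_on g (ball p \<epsilon>)"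
    "\<forall>z\<in>ball p \<epsilon> - {p}. f z = (1 / (z - p) ^ n) *\<^sub>C g z"
    using f unfolding meromorphic_op_at_def by blast
  then show ?thesis using \<phi> by (rule op_pole_functional)
qed

lemma op_meromorphicI: "(\<And>p. meromorphic_op_at f p) \<Longrightarrow> op_meromorphic f"
  unfolding op_meromorphic_def meromorphic_op_at_def by blast

section \<open>Finite-rank approximation of compact operators\<close>

text \<open>Generated by adding single rank-one operators, so that rule induction matches the
  rank-one perturbation step of the Fredholm argument.\<close>

inductive finite_rank :: "('a :: chilbert_space \<Rightarrow>\<^sub>L 'a) \<Rightarrow> bool" where
  zero: "finite_rank 0"
| add: "finite_rank (G + W)"
  if "finite_rank G" "bounded_linear \<phi>" "\<And>a x. \<phi> (a *\<^sub>C x) = a * \<phi> x"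
    "\<And>x. blinfun_apply W x = \<phi> x *\<^sub>C u"

lemma finite_rank_imp_clinear_op: "finite_rank G \<Longrightarrow> clinear_op G"
proof (induction rule: finite_rank.induct)
  case (add G \<phi> W u)
  have "clinear_op W" by (simp add: clinear_op_def add.hyps cscale_cscale)
  with add.IH show ?case by (rule clinear_op_add)
qed (rule clinear_op_zero)

lemma finite_rank_compose:
  assumes "finite_rank G" "clinear_op T"
  shows "finite_rank (G o\<^sub>L T)"
  using assms(1)
proof (induction rule: finite_rank.induct)
  case zero
  then show ?case by (simp add: finite_rank.zero)
next
  case (add G \<phi> W u)
  have "finite_rank ((G o\<^sub>L T) + (W o\<^sub>L T))"
  proof (rule finite_rank.add[OF add.IH])
    show "bounded_linear (\<lambda>x. \<phi> (blinfun_apply T x))"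
      using add.hyps(2) blinfun.bounded_linear_right by (rule bounded_linear_compose)
    show "\<phi> (blinfun_apply T (a *\<^sub>C x)) = a * \<phi> (blinfun_apply T x)" for a x
      by (simp add: clinear_opD[OF assms(2)] add.hyps)
    show "blinfun_apply (W o\<^sub>L T) x = \<phi> (blinfun_apply T x) *\<^sub>C u" for x
      by (simp add: add.hyps)
  qed
  then show ?case by (simp add: blinfun_compose.add_left)
qed

text \<open>One Gram--Schmidt step for each vector of \<open>Y\<close>.\<close>

lemma finite_rank_projection:
  fixes Y :: "'a :: chilbert_space set"
  assumes "finite Y"
  shows "\<exists>P. finite_rank P \<and> (\<forall>y\<in>Y. blinfun_apply P y = y) \<and>
    (\<forall>x. blinfun_apply P (blinfun_apply P x) = blinfun_apply P x) \<and>
    (\<forall>x y. cinner (blinfun_apply P x) y = cinner x (blinfun_apply P y))"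
  using assms
proof (induction Y rule: finite_induct)
  case empty
  show ?case by (rule exI[of _ 0]) (simp add: finite_rank.zero)
next
  case (insert y Y)
  then obtain P where P: "finite_rank P" "\<And>y. y \<in> Y \<Longrightarrow> P y = y" "\<And>x. P (P x) = P x"
    "\<And>x y. cinner (P x) y = cinner x (P y)"
    by blast
  define v where "v = y - P y"
  show ?case
  proof (cases "v = 0")
    case True
    then show ?thesis using P by (intro exI[of _ P]) (auto simp: v_def)
  next
    case False
    define e where "e = (1 / norm v) *\<^sub>R v"
    have ee: "cinner e e = 1" using False by (simp add: cinner_self e_def)
    have Pe: "P e = 0" by (simp add: e_def v_def blinfun.scaleR_right blinfun.diff_right P)
    have orth: "cinner e (P x) = 0" for x using P(4)[of e x] Pe by simp
    have "cinner e v = complex_of_real (norm v)"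
      using False by (simp add: e_def scaleR_cscale cinner_scaleC_left cinner_self power2_eq_square)
    then have "cinner e y = complex_of_real (norm v)"
      using orth[of y] by (simp add: v_def cinner_diff_right)
    then have ey: "cinner e y *\<^sub>C e = v"
      using False by (simp add: e_def scaleR_cscale cscale_cscale)
    define W where "W = Blinfun (\<lambda>x. cinner e x *\<^sub>C e)"
    have "bounded_linear (\<lambda>x. cinner e x *\<^sub>C e)"
      using bounded_linear_compose[OF bounded_bilinear.bounded_linear_left[OF bounded_bilinear_cscale]
          bounded_linear_cinner_right] .
    then have W: "W x = cinner e x *\<^sub>C e" for x
      by (simp add: W_def bounded_linear_Blinfun_apply)
    have "finite_rank (P + W)"
      by (rule finite_rank.add[OF P(1) bounded_linear_cinner_right _ W]) (rule cinner_scaleC_right)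
    moreover have "(P + W) x = x" if "x \<in> insert y Y" for x
      using that P(2) orth[of x] ey by (auto simp: blinfun.add_left W v_def)
    moreover have "(P + W) ((P + W) x) = (P + W) x" for x
      by (simp add: blinfun.add_left blinfun.add_right W P cinner_add_right orth
          cinner_scaleC_right ee clinear_opD[OF finite_rank_imp_clinear_op[OF P(1)]] Pe)
    moreover have "cinner ((P + W) x) z = cinner x ((P + W) z)" for x z
      by (simp add: blinfun.add_left W P cinner_add_left cinner_add_right cinner_scaleC_left
          cinner_scaleC_right cinner_commute[of e x])
    ultimately show ?thesis by blast
  qed
qed

definition finite_rank_approximable :: "('a :: chilbert_space \<Rightarrow>\<^sub>L 'a) \<Rightarrow> bool" where
  "finite_rank_approximable T \<longleftrightarrow> (\<forall>\<epsilon>>0. \<exists>G. finite_rank G \<and> norm (T - G) < \<epsilon>)"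

text \<open>\<open>P\<close> projects onto the span of a finite net of the image of the unit ball.
  The complementary projection is a contraction that kills every net point, so it sends each value
  of \<open>T\<close> on the unit ball to a vector of norm at most
  \<open>\<epsilon>/2\<close>.\<close>

lemma compact_op_approximable:
  assumes "compact_op T" "clinear_op T"
  shows "finite_rank_approximable T"
  unfolding finite_rank_approximable_def
proof (intro allI impI)
  fix \<epsilon> :: real assume \<epsilon>: "0 < \<epsilon>"
  have "seq_compact (closure (blinfun_apply T ` cball 0 1))"
    using assms(1) compact_imp_seq_compact unfolding compact_op_def by blast
  from seq_compact_imp_totally_bounded[OF this, rule_format, of "\<epsilon>/2"] \<epsilon>
  obtain Y where Y: "finite Y" "closure (blinfun_apply T ` cball 0 1) \<subseteq> (\<Union>y\<in>Y. ball y (\<epsilon>/2))"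
    by auto
  obtain P where P: "finite_rank P" "\<And>y. y \<in> Y \<Longrightarrow> P y = y" "\<And>x. P (P x) = P x"
    "\<And>x y. cinner (P x) y = cinner x (P y)"
    using finite_rank_projection[OF Y(1)] by blast
  have contr: "norm (x - P x) \<le> norm x" for x
  proof -
    have "cinner (x - P x) (P x) = 0" by (simp add: cinner_diff_left P)
    then have "(norm x)\<^sup>2 = (norm (x - P x))\<^sup>2 + (norm (P x))\<^sup>2"
      using norm_add_sq[of "x - P x" "P x"] by simp
    then have "(norm (x - P x))\<^sup>2 \<le> (norm x)\<^sup>2" by simp
    then show ?thesis by (rule power2_le_imp_le) simp
  qed
  have unit: "norm (T x - P (T x)) \<le> \<epsilon>/2" if "norm x \<le> 1" for x
  proof -
    have "T x \<in> closure (blinfun_apply T ` cball 0 1)"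
      using that closure_subset by (force simp: dist_norm)
    then obtain y where y: "y \<in> Y" "dist y (T x) < \<epsilon>/2" using Y(2) by (auto simp: subset_iff)
    have "T x - P (T x) = (T x - y) - P (T x - y)"
      by (simp add: blinfun.diff_right P(2)[OF y(1)])
    then have "norm (T x - P (T x)) \<le> norm (T x - y)" using contr[of "T x - y"] by metis
    then show ?thesis using y(2) by (simp add: dist_norm norm_minus_commute)
  qed
  have "norm (T - (P o\<^sub>L T)) \<le> \<epsilon>/2"
  proof (rule norm_blinfun_bound)
    fix x :: 'a
    show "norm (blinfun_apply (T - (P o\<^sub>L T)) x) \<le> \<epsilon>/2 * norm x"
    proof (cases "x = 0")
      case False
      have "norm (T (sgn x) - P (T (sgn x))) \<le> \<epsilon>/2" by (rule unit) (simp add: norm_sgn)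
      moreover have "T (sgn x) - P (T (sgn x)) = inverse (norm x) *\<^sub>R (T x - P (T x))"
        by (simp add: sgn_div_norm blinfun.scaleR_right scaleR_diff_right)
      ultimately have "inverse (norm x) * norm (T x - P (T x)) \<le> \<epsilon>/2" by simp
      then show ?thesis using False
        by (simp add: blinfun.diff_left field_simps)
    qed simp
  qed (use \<epsilon> in simp)
  then show "\<exists>G. finite_rank G \<and> norm (T - G) < \<epsilon>"
    using \<epsilon> finite_rank_compose[OF P(1) assms(2)] by (intro exI[of _ "P o\<^sub>L T"]) auto
qed

lemma finite_rank_approximable_limit:
  assumes lim: "(T \<longlongrightarrow> L) F" "F \<noteq> bot" and ev: "\<forall>\<^sub>F x in F. finite_rank_approximable (T x)"
  shows "finite_rank_approximable L"
  unfolding finite_rank_approximable_def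
proof (intro allI impI)
  fix \<epsilon> :: real assume \<epsilon>: "0 < \<epsilon>"
  have "\<forall>\<^sub>F x in F. dist (T x) L < \<epsilon>/2" using lim \<epsilon> by (intro tendstoD) auto
  then have "\<forall>\<^sub>F x in F. dist (T x) L < \<epsilon>/2 \<and> finite_rank_approximable (T x)"
    using ev by eventually_elim auto
  then obtain x where x: "dist (T x) L < \<epsilon>/2" "finite_rank_approximable (T x)"
    using lim(2) eventually_happens' by fast
  then obtain G where G: "finite_rank G" "norm (T x - G) < \<epsilon>/2"
    unfolding finite_rank_approximable_def using \<epsilon> by (meson half_gt_zero)
  have "norm (L - G) \<le> norm (L - T x) + norm (T x - G)"
    by (rule order_trans[OF _ norm_triangle_ineq]) simp
  then have "norm (L - G) < \<epsilon>" using x(1) G(2) by (simp add: dist_norm norm_minus_commute)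
  then show "\<exists>G. finite_rank G \<and> norm (L - G) < \<epsilon>" using G by blast
qed

lemma finite_rank_approximable_compose:
  assumes T: "finite_rank_approximable T" and J: "clinear_op J"
  shows "finite_rank_approximable (T o\<^sub>L J)"
  unfolding finite_rank_approximable_def
proof (intro allI impI)
  fix \<epsilon> :: real assume \<epsilon>: "0 < \<epsilon>"
  \<comment> \<open>The summand 1 keeps the divisor positive when \<open>J = 0\<close>.\<close>
  have pos: "0 < norm J + 1" by (simp add: add_nonneg_pos)
  then obtain G where G: "finite_rank G" "norm (T - G) < \<epsilon> / (norm J + 1)"
    using T \<epsilon> unfolding finite_rank_approximable_def by (meson divide_pos_pos)
  have "norm ((T o\<^sub>L J) - (G o\<^sub>L J)) \<le> norm (T - G) * norm J"
    unfolding blinfun_compose.diff_left[symmetric] by (rule norm_blinfun_compose)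
  also have "\<dots> \<le> norm (T - G) * (norm J + 1)" by (intro mult_left_mono) auto
  also have "\<dots> < \<epsilon>" using G(2) pos by (simp add: field_simps)
  finally show "\<exists>G. finite_rank G \<and> norm ((T o\<^sub>L J) - G) < \<epsilon>"
    using finite_rank_compose[OF G(1) J] by blast
qed

section \<open>The analytic Fredholm theorem\<close>

text \<open>The radius is a parameter because the splitting of an operator into a small part and a
  finite-rank part depends on the disc on which the small part is to be inverted.\<close>

definition meromorphic_inverse_on :: "real \<Rightarrow> ('a :: chilbert_space \<Rightarrow>\<^sub>L 'a) \<Rightarrow> bool" where
  "meromorphic_inverse_on R A \<longleftrightarrow> clinear_op A \<and> (\<exists>X. \<forall>p\<in>ball 0 R. meromorphic_op_at X p \<and>
     (\<forall>\<^sub>F s in at p. inverse_ops (X s) (id_blinfun + s *\<^sub>C A)))"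

text \<open>The resolvent formula \<open>res\<close> is used twice: with the uniform bound
  \<open>M\<close> it gives continuity of \<open>X\<close>, and then it shows that the difference
  quotients converge to \<open>- X z E X z\<close>.\<close>

lemma meromorphic_inverse_on_small:
  assumes lin: "clinear_op E" and R: "0 < R" "R * norm E < 1"
  shows "meromorphic_inverse_on R E"
proof -
  define B where "B = ball (0 :: complex) R"
  have "\<exists>X. inverse_ops X (id_blinfun + s *\<^sub>C E)" if "s \<in> B" for s
  proof (rule inverse_ops_exists)
    have "cmod s * norm E \<le> R * norm E" using that by (intro mult_right_mono) (auto simp: B_def)
    then show "norm (s *\<^sub>C E) < 1" using R by (simp add: norm_cscale)
  qed
  then obtain X where X: "\<And>s. s \<in> B \<Longrightarrow> inverse_ops (X s) (id_blinfun + s *\<^sub>C E)" by metis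
  \<comment> \<open>The bound of \<open>inverse_ops_norm_le\<close> at its worst value on the
    disc.\<close>
  define M where "M = 1 / (1 - R * norm E)"
  have M: "norm (X s) \<le> M" if "s \<in> B" for s
  proof -
    have le: "norm (s *\<^sub>C E) \<le> R * norm E"
      using that by (auto simp: B_def norm_cscale intro!: mult_right_mono)
    then have "norm (X s) \<le> 1 / (1 - norm (s *\<^sub>C E))"
      using R by (intro inverse_ops_norm_le X that) auto
    also have "\<dots> \<le> M" unfolding M_def using le R by (intro divide_left_mono mult_pos_pos) auto
    finally show ?thesis .
  qed
  have linX: "clinear_op (X s)" if "s \<in> B" for s
    using X[OF that] by (rule clinear_op_inverse_ops) (intro clinear_op_intros lin)
  have res: "X w - X z = - (w - z) *\<^sub>C (X w o\<^sub>L (E o\<^sub>L X z))" if "w \<in> B" "z \<in> B" for w z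
  proof (rule blinfun_eqI)
    fix x
    have 1: "X z x + z *\<^sub>C E (X z x) = x"
      using X[OF that(2)] by (simp add: inverse_ops_iff blinfun.add_left scaleC_blinfun.rep_eq)
    have 2: "X w (y + w *\<^sub>C E y) = y" for y
      using X[OF that(1)] by (simp add: inverse_ops_iff blinfun.add_left scaleC_blinfun.rep_eq)
    have "X w x = X w (X z x + w *\<^sub>C E (X z x) - (w - z) *\<^sub>C E (X z x))"
      using 1 by (simp add: algebra_simps cscale.scale_left_diff_distrib)
    also have "\<dots> = X z x - (w - z) *\<^sub>C X w (E (X z x))"
      using 2 by (simp add: blinfun.diff_right clinear_opD[OF linX[OF that(1)]])
    finally show "(X w - X z) x = (- (w - z) *\<^sub>C (X w o\<^sub>L (E o\<^sub>L X z))) x"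
      by (simp add: blinfun.diff_left scaleC_blinfun.rep_eq cscale.scale_left_diff_distrib)
  qed
  have hol: "op_holomorphic_on X B"
    unfolding op_holomorphic_on_def
  proof
    fix z assume z: "z \<in> B"
    have ev: "\<forall>\<^sub>F w in at z within B. w \<in> B \<and> w \<noteq> z"
      by (auto simp: eventually_at_filter)
    have cont: "(X \<longlongrightarrow> X z) (at z within B)"
    proof (rule Lim_null_comparison[THEN LIM_zero_cancel])
      show "\<forall>\<^sub>F w in at z within B. norm (X w - X z) \<le> cmod (w - z) * (M * (norm E * norm (X z)))"
        using ev
      proof eventually_elim
        case (elim w)
        have "norm (X w - X z) = cmod (w - z) * norm (X w o\<^sub>L (E o\<^sub>L X z))"
          using res[of w z] elim z by (simp add: norm_cscale norm_minus_commute)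
        also have "norm (X w o\<^sub>L (E o\<^sub>L X z)) \<le> norm (X w) * norm (E o\<^sub>L X z)"
          by (rule norm_blinfun_compose)
        also have "\<dots> \<le> M * (norm E * norm (X z))"
          using M[of w] M[OF z] elim
          by (intro mult_mono norm_blinfun_compose) (auto intro: order_trans[OF norm_ge_zero])
        finally show ?case by (simp add: mult_left_mono)
      qed
      have "((\<lambda>w. cmod (w - z) * (M * (norm E * norm (X z)))) \<longlongrightarrow> cmod (z - z) * (M * (norm E * norm (X z))))
          (at z within B)"
        by (intro tendsto_intros)
      then show "((\<lambda>w. cmod (w - z) * (M * (norm E * norm (X z)))) \<longlongrightarrow> 0) (at z within B)" by simp
    qed
    have "((\<lambda>w. (- 1) *\<^sub>C (X w o\<^sub>L (E o\<^sub>L X z))) \<longlongrightarrow> (- 1) *\<^sub>C (X z o\<^sub>L (E o\<^sub>L X z))) (at z within B)"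
      by (intro tendsto_intros blinfun_compose.tendsto cont)
    moreover have "\<forall>\<^sub>F w in at z within B.
        (- 1) *\<^sub>C (X w o\<^sub>L (E o\<^sub>L X z)) = (1 / (w - z)) *\<^sub>C (X w - X z)"
      using ev
    proof eventually_elim
      case (elim w)
      then have "(z - w) / (w - z) = - 1" by (simp add: field_simps)
      then show ?case using res[of w z] elim z by (simp add: cscale_cscale)
    qed
    ultimately show "\<exists>d. ((\<lambda>w. (1 / (w - z)) *\<^sub>C (X w - X z)) \<longlongrightarrow> d) (at z within B)"
      by (intro exI) (rule Lim_transform_eventually)
  qed
  have "meromorphic_op_at X p \<and> (\<forall>\<^sub>F s in at p. inverse_ops (X s) (id_blinfun + s *\<^sub>C E))"
    if p: "p \<in> B" for p
  proof
    obtain \<epsilon> where \<epsilon>: "0 < \<epsilon>" "ball p \<epsilon> \<subseteq> B"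
      using p open_contains_ball_eq[of B] by (auto simp: B_def)
    show "meromorphic_op_at X p"
      using \<epsilon> hol linX
      by (intro meromorphic_op_atI[where \<epsilon> = \<epsilon> and g = X and n = 0])
        (auto intro: op_holomorphic_on_subset)
    have "\<forall>\<^sub>F s in at p. s \<in> B - {p}"
      using p by (intro eventually_at_in_open) (auto simp: B_def)
    then show "\<forall>\<^sub>F s in at p. inverse_ops (X s) (id_blinfun + s *\<^sub>C E)"
      by eventually_elim (use X in auto)
  qed
  then show ?thesis using lin unfolding meromorphic_inverse_on_def B_def by blast
qed

text \<open>\<open>M + s W\<close> equals \<open>M (1 + s X W)\<close>, and \<open>h\<close> is the
  determinant of the second factor, a rank-one perturbation of the identity. Both products with the
  candidate collapse through \<open>s * \<phi> (X u) = h - 1\<close>.\<close>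

lemma sherman_morrison:
  assumes X: "inverse_ops X M" and lin: "clinear_op M"
    and \<phi>: "bounded_linear \<phi>" "\<And>a x. \<phi> (a *\<^sub>C x) = a * \<phi> x"
    and W: "\<And>x. blinfun_apply W x = \<phi> x *\<^sub>C u"
    and h: "h = 1 + s * \<phi> (blinfun_apply X u)" "h \<noteq> 0"
  shows "inverse_ops (X + (- (s / h)) *\<^sub>C (X o\<^sub>L (W o\<^sub>L X))) (M + s *\<^sub>C W)"
proof -
  have linX: "clinear_op X" using X lin by (rule clinear_op_inverse_ops)
  have XM: "X (M x) = x" "M (X x) = x" for x using X by (auto simp: inverse_ops_iff)
  note lin\<phi> = linear_diff[OF bounded_linear.linear[OF \<phi>(1)]] linear_add[OF bounded_linear.linear[OF \<phi>(1)]]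
  define X' where "X' = X + (- (s / h)) *\<^sub>C (X o\<^sub>L (W o\<^sub>L X))"
  have X': "X' y = X y - ((s / h) * \<phi> (X y)) *\<^sub>C X u" for y
    by (simp add: X'_def blinfun.add_left blinfun.diff_left scaleC_blinfun.rep_eq W clinear_opD[OF linX] cscale_cscale)
  have \<phi>Xu: "s * \<phi> (X u) = h - 1" using h by simp
  have "X' ((M + s *\<^sub>C W) y) = y" for y
  proof -
    have "X ((M + s *\<^sub>C W) y) = y + (s * \<phi> y) *\<^sub>C X u"
      by (simp add: blinfun.add_left blinfun.add_right scaleC_blinfun.rep_eq W XM clinear_opD[OF linX] cscale_cscale)
    then have "X' ((M + s *\<^sub>C W) y) = y + (s * \<phi> y - (s / h) * (\<phi> y + (s * \<phi> y) * \<phi> (X u))) *\<^sub>C X u"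
      by (simp add: X' lin\<phi> \<phi>(2) cscale.scale_left_diff_distrib)
    also have "\<phi> y + (s * \<phi> y) * \<phi> (X u) = \<phi> y + \<phi> y * (s * \<phi> (X u))" by simp
    also have "\<dots> = \<phi> y * h" unfolding \<phi>Xu by (simp add: algebra_simps)
    finally show ?thesis using h(2) by simp
  qed
  moreover have "(M + s *\<^sub>C W) (X' y) = y" for y
  proof -
    have "(M + s *\<^sub>C W) (X' y)
        = y + (s * (\<phi> (X y) - (s / h) * \<phi> (X y) * \<phi> (X u)) - (s / h) * \<phi> (X y)) *\<^sub>C u"
      by (simp add: X' blinfun.add_left blinfun.diff_right scaleC_blinfun.rep_eq W XM
          clinear_opD[OF lin] lin\<phi> \<phi>(2) cscale_cscale cscale.scale_left_diff_distrib
          cscale.scale_right_diff_distrib right_diff_distrib)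
    also have "s * (\<phi> (X y) - (s / h) * \<phi> (X y) * \<phi> (X u)) - (s / h) * \<phi> (X y)
        = s * \<phi> (X y) - (s / h) * \<phi> (X y) * (s * \<phi> (X u) + 1)"
      by (simp add: algebra_simps add_divide_distrib)
    also have "\<dots> = 0" unfolding \<phi>Xu using h(2) by simp
    finally show ?thesis by simp
  qed
  ultimately show ?thesis by (auto simp: inverse_ops_iff X'_def)
qed

text \<open>The Sherman--Morrison denominator \<open>h\<close> tends to \<open>1\<close> at \<open>0\<close>, so the identity theorem excludes that it
  vanishes identically near some point of the disc.\<close>

lemma meromorphic_inverse_on_add_rank_one:
  assumes A: "meromorphic_inverse_on R A" and R: "0 < R"
    and \<phi>: "bounded_linear \<phi>" "\<And>a x. \<phi> (a *\<^sub>C x) = a * \<phi> x"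
    and W: "\<And>x. blinfun_apply W x = \<phi> x *\<^sub>C u"
  shows "meromorphic_inverse_on R (A + W)"
proof -
  obtain X where X: "\<And>p. p \<in> ball 0 R \<Longrightarrow> meromorphic_op_at X p"
    and inv: "\<And>p. p \<in> ball 0 R \<Longrightarrow> \<forall>\<^sub>F s in at p. inverse_ops (X s) (id_blinfun + s *\<^sub>C A)"
    and linA: "clinear_op A"
    using A unfolding meromorphic_inverse_on_def by blast
  have linW: "clinear_op W" by (simp add: clinear_op_def W \<phi>(2) cscale_cscale)
  define h where "h s = 1 + s * \<phi> (X s u)" for s
  have h_mero: "h meromorphic_on ball 0 R"
  proof (subst meromorphic_on_meromorphic_at, rule ballI)
    fix p :: complex assume "p \<in> ball 0 R"
    then show "h meromorphic_on {p}" unfolding h_def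
      by (intro meromorphic_intros meromorphic_op_at_functional X \<phi>)
  qed
  have h0: "\<forall>\<^sub>F s in at 0. h s \<noteq> 0"
  proof -
    obtain K where K: "0 < K" "\<And>x. cmod (\<phi> x) \<le> norm x * K"
      using bounded_linear.pos_bounded[OF \<phi>(1)] by blast
    have "((\<lambda>s. cmod s * norm A) \<longlongrightarrow> cmod 0 * norm A) (at 0)" by (intro tendsto_intros)
    then have 1: "\<forall>\<^sub>F s in at 0. cmod s * norm A < 1/2" by (intro order_tendstoD(2)) auto
    have "((\<lambda>s. cmod s * (2 * norm u * K)) \<longlongrightarrow> cmod 0 * (2 * norm u * K)) (at 0)" by (intro tendsto_intros)
    then have 2: "\<forall>\<^sub>F s in at 0. cmod s * (2 * norm u * K) < 1" by (intro order_tendstoD(2)) auto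
    have 3: "\<forall>\<^sub>F s in at 0. inverse_ops (X s) (id_blinfun + s *\<^sub>C A)" by (rule inv) (use R in simp)
    show ?thesis using 1 2 3
    proof eventually_elim
      case (elim s)
      have "norm (X s) \<le> 1 / (1 - norm (s *\<^sub>C A))"
        using elim by (intro inverse_ops_norm_le) (auto simp: norm_cscale)
      also have "\<dots> \<le> 1 / (1/2)" using elim by (intro divide_left_mono) (auto simp: norm_cscale)
      finally have "norm (X s u) \<le> 2 * norm u"
        using norm_blinfun[of "X s" u] mult_right_mono[of "norm (X s)" 2 "norm u"] by simp
      then have "cmod (\<phi> (X s u)) \<le> 2 * norm u * K"
        using K(2)[of "X s u"] mult_right_mono[of "norm (X s u)" "2 * norm u" K] K(1) by linarith
      then have "cmod (s * \<phi> (X s u)) \<le> cmod s * (2 * norm u * K)"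
        by (simp add: norm_mult mult_left_mono)
      then have "cmod (s * \<phi> (X s u)) < 1" using elim by linarith
      then show "h s \<noteq> 0" unfolding h_def by (metis add_eq_0_iff norm_minus_cancel norm_one less_irrefl)
    qed
  qed
  have h_nz: "\<forall>\<^sub>F s in at p. h s \<noteq> 0" if p: "p \<in> ball 0 R" for p
  proof -
    have "eventually (\<lambda>z. h z = 0) (cosparse (ball 0 R)) \<or> eventually (\<lambda>z. h z \<noteq> 0) (cosparse (ball 0 R))"
      by (rule meromorphic_imp_constant_or_avoid[OF h_mero]) auto
    then consider "\<forall>\<^sub>F s in at 0. h s = 0" | "\<forall>\<^sub>F s in at p. h s \<noteq> 0"
      using R p by (auto simp: eventually_cosparse_open_eq)
    then show ?thesis
    proof cases
      case 1
      then have "\<forall>\<^sub>F s in at (0::complex). False" using h0 by eventually_elim simp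
      then show ?thesis by simp
    qed
  qed
  define X' where "X' s = X s + (- (s / h s)) *\<^sub>C (X s o\<^sub>L (W o\<^sub>L X s))" for s
  have "meromorphic_op_at X' p \<and> (\<forall>\<^sub>F s in at p. inverse_ops (X' s) (id_blinfun + s *\<^sub>C (A + W)))"
    if p: "p \<in> ball 0 R" for p
  proof
    have "h meromorphic_on {p}" using h_mero by (rule meromorphic_on_subset) (use p in auto)
    then show "meromorphic_op_at X' p" unfolding X'_def
      by (intro meromorphic_op_at_add meromorphic_op_at_scaleC meromorphic_op_at_compose
          meromorphic_op_at_const linW X p meromorphic_intros)
    show "\<forall>\<^sub>F s in at p. inverse_ops (X' s) (id_blinfun + s *\<^sub>C (A + W))"
      using inv[OF p] h_nz[OF p]
    proof eventually_elim
      case (elim s)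
      have "inverse_ops (X' s) (id_blinfun + s *\<^sub>C A + s *\<^sub>C W)"
        unfolding X'_def by (rule sherman_morrison[OF elim(1) _ \<phi> W h_def elim(2)])
          (intro clinear_op_intros linA)
      then show ?case by (simp add: cscale_add_right add.assoc)
    qed
  qed
  then show ?thesis
    using clinear_op_add[OF linA linW] unfolding meromorphic_inverse_on_def by blast
qed

lemma meromorphic_inverse_on_add_finite_rank:
  assumes "finite_rank G" "meromorphic_inverse_on R A" "0 < R"
  shows "meromorphic_inverse_on R (A + G)"
  using assms
proof (induction rule: finite_rank.induct)
  case (add G \<phi> W u)
  then have "meromorphic_inverse_on R (A + G + W)"
    using meromorphic_inverse_on_add_rank_one[of R "A + G" \<phi> W u] by blast
  then show ?case by (simp add: add.assoc)
qed simp

lemma meromorphic_inverse_on_approximable: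
  assumes A: "finite_rank_approximable A" "clinear_op A" and R: "0 < R"
  shows "meromorphic_inverse_on R A"
proof -
  \<comment> \<open>The tolerance \<open>1 / R\<close> makes \<open>R * norm (A - G) < 1\<close>,
    the smallness condition on the disc of radius \<open>R\<close>.\<close>
  obtain G where G: "finite_rank G" "norm (A - G) < 1 / R"
    using A(1) R unfolding finite_rank_approximable_def by (meson zero_less_divide_1_iff)
  have "meromorphic_inverse_on R (A - G)"
    using R G(2) by (intro meromorphic_inverse_on_small clinear_op_intros A(2)
        finite_rank_imp_clinear_op[OF G(1)]) (auto simp: field_simps)
  then show ?thesis using meromorphic_inverse_on_add_finite_rank[OF G(1) _ R] by fastforce
qed

text \<open>\<open>X\<close> is chosen pointwise, so one function serves all discs: near
  \<open>p\<close> it agrees, by uniqueness of inverses, with the local inverse on a disc that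
  contains \<open>p\<close>. The last conclusion determines \<open>X\<close> at every single point
  where an inverse exists; this is what gives the correct value at nonresonant real
  parameters.\<close>

theorem analytic_fredholm:
  assumes A: "finite_rank_approximable A" "clinear_op A"
  obtains X where "\<And>p. meromorphic_op_at X p"
    "\<And>p. \<forall>\<^sub>F s in at p. inverse_ops (X s) (id_blinfun + s *\<^sub>C A)"
    "\<And>s Y. inverse_ops Y (id_blinfun + s *\<^sub>C A) \<Longrightarrow> X s = Y"
proof
  define X where "X s = (SOME Y. inverse_ops Y (id_blinfun + s *\<^sub>C A))" for s
  show uniq: "X s = Y" if "inverse_ops Y (id_blinfun + s *\<^sub>C A)" for s Y
    using someI[where P = "\<lambda>Y. inverse_ops Y (id_blinfun + s *\<^sub>C A)", OF that] that
    unfolding X_def by (rule inverse_ops_unique)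
  fix p :: complex
  have "meromorphic_inverse_on (cmod p + 1) A"
    by (rule meromorphic_inverse_on_approximable[OF A]) (simp add: add_nonneg_pos)
  moreover have "p \<in> ball 0 (cmod p + 1)" by simp
  ultimately obtain Z where Z: "meromorphic_op_at Z p"
    and inv: "\<forall>\<^sub>F s in at p. inverse_ops (Z s) (id_blinfun + s *\<^sub>C A)"
    unfolding meromorphic_inverse_on_def by blast
  have eq: "\<forall>\<^sub>F s in at p. X s = Z s" using inv by eventually_elim (rule uniq)
  show "meromorphic_op_at X p" using Z eq by (rule meromorphic_op_at_cong)
  show "\<forall>\<^sub>F s in at p. inverse_ops (X s) (id_blinfun + s *\<^sub>C A)"
    using inv eq by eventually_elim simp
qed

section \<open>The sandwiched resolvent\<close>

lemma blinfun_eq_on_dense: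
  fixes S T :: "'a :: real_normed_vector \<Rightarrow>\<^sub>L 'b :: real_normed_vector"
  assumes "closure M = UNIV" "\<And>x. x \<in> M \<Longrightarrow> blinfun_apply S x = blinfun_apply T x"
  shows "S = T"
proof (rule blinfun_eqI)
  fix x
  have "closed {x. blinfun_apply S x = blinfun_apply T x}"
    by (intro closed_Collect_eq continuous_intros)
  then have "closure M \<subseteq> {x. blinfun_apply S x = blinfun_apply T x}"
    using assms(2) by (intro closure_minimal) auto
  then show "blinfun_apply S x = blinfun_apply T x" using assms(1) by auto
qed

text \<open>Once \<open>T\<close> is moved to the other argument, linearity of the scalar product
  does the work.\<close>

lemma bounded_selfadjoint_imp_clinear_op:
  assumes "bounded_selfadjoint T"
  shows "clinear_op T"
  unfolding clinear_op_def
proof (intro allI cinner_eqI)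
  fix a x w
  have *: "cinner w (T y) = cinner (T w) y" for y
    using assms by (simp add: bounded_selfadjoint_def)
  show "cinner w (T (a *\<^sub>C x)) = cinner w (a *\<^sub>C T x)"
    by (simp only: * cinner_scaleC_right)
qed

section \<open>The sandwiched resolvent off the real axis\<close>

context rigged_affine_space
begin

lemma zero_in_J: "0 \<in> \<J>"
  using J_subspace by (rule subspace_0)

lemma dense_adj_F: "closure (Domain (adj F)) = UNIV"
  using densely_defined_adj[OF F_linear F_closed] by (simp add: densely_defined_def)

lemma F_single_valued: "(x, v) \<in> F \<Longrightarrow> (x, v') \<in> F \<Longrightarrow> v = v'"
  using F_linear by (auto simp: linear_operator_def single_valued_def)

lemma J_clinear: "J \<in> \<J> \<Longrightarrow> clinear_op J"
  by (intro bounded_selfadjoint_imp_clinear_op J_selfadjoint)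

lemma A_linear: "H' \<in> affine_ops F H \<J> \<Longrightarrow> linear_operator H'"
  using A_selfadjoint by (auto simp: self_adjoint_def)

text \<open>Already for \<open>J = 0\<close>, relative compactness says that the resolvent followed
  by \<open>rigged_op F 0\<close> is the graph of an everywhere defined operator; hence the
  resolvent itself is everywhere defined.\<close>

lemma resolvent_surj:
  assumes H': "H' \<in> affine_ops F H \<J>" and z: "Im z \<noteq> 0"
  obtains x y where "(x, y) \<in> H'" "y - z *\<^sub>C x = \<xi>"
proof -
  obtain K where "resolvent H' z O rigged_op F 0 = bounded_graph K"
    using V_relatively_compact[OF zero_in_J H'] z by (auto simp: relatively_compact_def)
  moreover have "(\<xi>, blinfun_apply K \<xi>) \<in> bounded_graph K" by (auto simp: bounded_graph_def)
  ultimately obtain x where "(\<xi>, x) \<in> resolvent H' z" by blast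
  then show thesis using that by (auto simp: resolvent_def)
qed

lemma sandwiched_resolventE:
  assumes "(\<phi>, v) \<in> sandwiched_resolvent_graph F H' z"
  obtains x y where "(\<phi>, y - z *\<^sub>C x) \<in> adj F" "(x, y) \<in> H'" "(x, v) \<in> F"
  using assms by (auto simp: sandwiched_resolvent_graph_def resolvent_def)

lemma sandwiched_resolventI:
  "(\<phi>, y - z *\<^sub>C x) \<in> adj F \<Longrightarrow> (x, y) \<in> H' \<Longrightarrow> (x, v) \<in> F \<Longrightarrow>
    (\<phi>, v) \<in> sandwiched_resolvent_graph F H' z"
  by (auto simp: sandwiched_resolvent_graph_def resolvent_def)

lemma Domain_sandwiched_resolvent:
  assumes H': "H' \<in> affine_ops F H \<J>" and z: "Im z \<noteq> 0" and \<phi>: "\<phi> \<in> Domain (adj F)"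
  obtains v where "(\<phi>, v) \<in> sandwiched_resolvent_graph F H' z"
proof -
  obtain \<xi> where \<xi>: "(\<phi>, \<xi>) \<in> adj F" using \<phi> by blast
  obtain x y where xy: "(x, y) \<in> H'" "y - z *\<^sub>C x = \<xi>" using resolvent_surj[OF H' z] .
  moreover obtain v where "(x, v) \<in> F" using xy A_domain[OF H'] D_F by blast
  ultimately show thesis using that sandwiched_resolventI \<xi> by blast
qed

text \<open>Density of \<open>Domain (adj F)\<close> makes the bounded extension unique, so the
  description in \<open>T_op\<close> denotes the compact extension supplied by the locale.\<close>

lemma T_op_spec:
  assumes H': "H' \<in> affine_ops F H \<J>" and z: "Im z \<noteq> 0"
  shows "compact_op (T_op F H' z)"
    and "\<And>\<phi> v. (\<phi>, v) \<in> sandwiched_resolvent_graph F H' z \<Longrightarrow> blinfun_apply (T_op F H' z) \<phi> = v"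
proof -
  obtain T where T: "compact_op T" "sandwiched_resolvent_graph F H' z \<subseteq> bounded_graph T"
    using T_compact[OF H' z] by blast
  have "T_op F H' z = T"
    unfolding T_op_def
  proof (rule the_equality)
    fix S assume S: "sandwiched_resolvent_graph F H' z \<subseteq> bounded_graph S"
    show "S = T"
    proof (rule blinfun_eq_on_dense[OF dense_adj_F])
      fix \<phi> assume "\<phi> \<in> Domain (adj F)"
      then obtain v where "(\<phi>, v) \<in> sandwiched_resolvent_graph F H' z"
        using Domain_sandwiched_resolvent[OF H' z] by blast
      then have "(\<phi>, v) \<in> bounded_graph S" "(\<phi>, v) \<in> bounded_graph T" using S T by auto
      then show "blinfun_apply S \<phi> = blinfun_apply T \<phi>" by (simp add: bounded_graph_def)
    qed
  qed (rule T(2))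
  then show "compact_op (T_op F H' z)"
    "\<And>\<phi> v. (\<phi>, v) \<in> sandwiched_resolvent_graph F H' z \<Longrightarrow> blinfun_apply (T_op F H' z) \<phi> = v"
    using T by (auto simp: bounded_graph_def)
qed

text \<open>The sandwiched resolvent is complex-linear on the dense domain of the adjoint, and the
  condition is closed in \<open>\<phi>\<close>.\<close>

lemma clinear_T_op:
  assumes H': "H' \<in> affine_ops F H \<J>" and z: "Im z \<noteq> 0"
  shows "clinear_op (T_op F H' z)"
  unfolding clinear_op_def
proof (intro allI)
  fix a \<phi>
  let ?T = "blinfun_apply (T_op F H' z)"
  have "closed {\<phi>. ?T (a *\<^sub>C \<phi>) = a *\<^sub>C ?T \<phi>}"
    by (intro closed_Collect_eq continuous_intros)
  moreover have "?T (a *\<^sub>C \<phi>) = a *\<^sub>C ?T \<phi>" if "\<phi> \<in> Domain (adj F)" for \<phi>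
  proof -
    obtain v where v: "(\<phi>, v) \<in> sandwiched_resolvent_graph F H' z"
      using Domain_sandwiched_resolvent[OF H' z] \<open>\<phi> \<in> Domain (adj F)\<close> by blast
    obtain x y where xy: "(\<phi>, y - z *\<^sub>C x) \<in> adj F" "(x, y) \<in> H'" "(x, v) \<in> F"
      using v by (rule sandwiched_resolventE)
    have "a *\<^sub>C (y - z *\<^sub>C x) = a *\<^sub>C y - z *\<^sub>C (a *\<^sub>C x)"
      by (simp add: cscale.scale_right_diff_distrib cscale_cscale mult.commute)
    then have "(a *\<^sub>C \<phi>, a *\<^sub>C v) \<in> sandwiched_resolvent_graph F H' z"
      using xy A_linear[OF H'] F_linear adj_scaleC[OF xy(1), of a]
      by (intro sandwiched_resolventI[where y = "a *\<^sub>C y" and x = "a *\<^sub>C x"])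
        (auto simp: linear_operator_def)
    then show ?thesis using T_op_spec(2)[OF H' z] v by simp
  qed
  ultimately have "closure (Domain (adj F)) \<subseteq> {\<phi>. ?T (a *\<^sub>C \<phi>) = a *\<^sub>C ?T \<phi>}"
    by (intro closure_minimal) auto
  then show "?T (a *\<^sub>C \<phi>) = a *\<^sub>C ?T \<phi>" using dense_adj_F by auto
qed

lemma T_op_approximable:
  assumes "H' \<in> affine_ops F H \<J>" "Im z \<noteq> 0"
  shows "finite_rank_approximable (T_op F H' z)"
  using assms by (intro compact_op_approximable T_op_spec clinear_T_op)

text \<open>For vectors in the domain of the adjoint, both sides reduce to the form of
  \<open>H' - z\<close> on the vectors \<open>x'\<close> and \<open>x\<close> that solve the two
  resolvent equations; self-adjointness of \<open>H'\<close> makes them equal.\<close>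

lemma T_op_adjoint:
  assumes H': "H' \<in> affine_ops F H \<J>" and z: "Im z \<noteq> 0"
  shows "cinner \<psi> (blinfun_apply (T_op F H' z) \<phi>) = cinner (blinfun_apply (T_op F H' (cnj z)) \<psi>) \<phi>"
proof -
  let ?T = "blinfun_apply (T_op F H' z)" and ?T' = "blinfun_apply (T_op F H' (cnj z))"
  have z': "Im (cnj z) \<noteq> 0" using z by simp
  have core: "cinner \<psi> (?T \<phi>) = cinner (?T' \<psi>) \<phi>"
    if \<phi>: "\<phi> \<in> Domain (adj F)" and \<psi>: "\<psi> \<in> Domain (adj F)" for \<phi> \<psi>
  proof -
    obtain v where v: "(\<phi>, v) \<in> sandwiched_resolvent_graph F H' z"
      using Domain_sandwiched_resolvent[OF H' z \<phi>] .
    obtain v' where v': "(\<psi>, v') \<in> sandwiched_resolvent_graph F H' (cnj z)"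
      using Domain_sandwiched_resolvent[OF H' z' \<psi>] .
    obtain x y where xy: "(\<phi>, y - z *\<^sub>C x) \<in> adj F" "(x, y) \<in> H'" "(x, v) \<in> F"
      using v by (rule sandwiched_resolventE)
    obtain x' y' where xy': "(\<psi>, y' - cnj z *\<^sub>C x') \<in> adj F" "(x', y') \<in> H'" "(x', v') \<in> F"
      using v' by (rule sandwiched_resolventE)
    have "cinner \<psi> v = cinner y' x - z * cinner x' x"
      using adjD[OF xy'(1) xy(3)] by (simp add: cinner_diff_left cinner_scaleC_left)
    moreover have "cinner \<phi> v' = cinner y x' - cnj z * cinner x x'"
      using adjD[OF xy(1) xy'(3)] by (simp add: cinner_diff_left cinner_scaleC_left)
    then have "cinner v' \<phi> = cinner x' y - z * cinner x' x"
      using cinner_commute[of v' \<phi>] cinner_commute[of x' y] cinner_commute[of x' x] by simp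
    moreover have "cinner x' y = cinner y' x"
      using A_selfadjoint[OF H'] xy xy' adjD[of x' y' H' x y] by (simp add: self_adjoint_def)
    ultimately show ?thesis
      using T_op_spec(2)[OF H' z v] T_op_spec(2)[OF H' z' v'] by simp
  qed
  \<comment> \<open>\<open>core\<close> has both vectors in the domain of the adjoint; density is
    applied to one argument at a time.\<close>
  have "cinner \<psi> (?T \<phi>) = cinner (?T' \<psi>) \<phi>" if \<psi>: "\<psi> \<in> Domain (adj F)" for \<phi> \<psi>
  proof -
    have "closed {\<phi>. cinner \<psi> (?T \<phi>) = cinner (?T' \<psi>) \<phi>}"
      by (intro closed_Collect_eq bounded_linear.continuous_on[OF bounded_linear_cinner_right]
          continuous_intros)
    then have "closure (Domain (adj F)) \<subseteq> {\<phi>. cinner \<psi> (?T \<phi>) = cinner (?T' \<psi>) \<phi>}"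
      using core \<psi> by (intro closure_minimal) auto
    then show ?thesis using dense_adj_F by auto
  qed
  moreover have "closed {\<psi>. cinner \<psi> (?T \<phi>) = cinner (?T' \<psi>) \<phi>}"
    by (intro closed_Collect_eq bounded_linear.continuous_on[OF bounded_linear_cinner_left]
        continuous_intros)
  ultimately have "closure (Domain (adj F)) \<subseteq> {\<psi>. cinner \<psi> (?T \<phi>) = cinner (?T' \<psi>) \<phi>}"
    by (intro closure_minimal) auto
  then show ?thesis using dense_adj_F by auto
qed

subsection \<open>Lines of operators and the resolvent identity\<close>

lemma rigged_product_subset: "rigged_product F J \<subseteq> rigged_op F J"
  unfolding rigged_op_def by (rule closure_subset)

lemma rigged_productE:
  assumes "J \<in> \<J>" "x \<in> D"
  obtains v \<eta> where "(x, v) \<in> F" "(blinfun_apply J v, \<eta>) \<in> adj F" "(x, \<eta>) \<in> rigged_op F J"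
proof -
  obtain \<eta> where "(x, \<eta>) \<in> rigged_product F J" using D_V[OF assms(1)] assms(2) by blast
  moreover from this obtain v where "(x, v) \<in> F" "(blinfun_apply J v, \<eta>) \<in> adj F"
    by (auto simp: rigged_product_def bounded_graph_def)
  ultimately show thesis
    using rigged_product_subset by (intro that) auto
qed

lemma rigged_op_single_valued:
  "J \<in> \<J> \<Longrightarrow> (x, v) \<in> rigged_op F J \<Longrightarrow> (x, v') \<in> rigged_op F J \<Longrightarrow> v = v'"
  using V_selfadjoint[of J] by (auto simp: self_adjoint_def linear_operator_def single_valued_def)

text \<open>\<open>rigged_op\<close> is a closure, and closures need not be additive in
  \<open>J\<close>. On \<open>D\<close>, however, its values are those of the unclosed product,
  where additivity is that of the adjoint of \<open>F\<close>.\<close>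

lemma rigged_op_line:
  assumes J0: "J0 \<in> \<J>" and J: "J \<in> \<J>" and x: "x \<in> D"
    and v0: "(x, v0) \<in> rigged_op F J0" and v: "(x, v) \<in> rigged_op F J"
  shows "(x, v0 + s *\<^sub>R v) \<in> rigged_op F (J0 + s *\<^sub>R J)"
proof -
  obtain y0 \<eta>0 where 0: "(x, y0) \<in> F" "(blinfun_apply J0 y0, \<eta>0) \<in> adj F" "(x, \<eta>0) \<in> rigged_op F J0"
    using rigged_productE[OF J0 x] .
  obtain y \<eta> where 1: "(x, y) \<in> F" "(blinfun_apply J y, \<eta>) \<in> adj F" "(x, \<eta>) \<in> rigged_op F J"
    using rigged_productE[OF J x] .
  have eq: "y = y0" "v0 = \<eta>0" "v = \<eta>"
    using F_single_valued[OF 1(1) 0(1)] rigged_op_single_valued[OF J0 v0 0(3)]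
      rigged_op_single_valued[OF J v 1(3)] by auto
  have "(blinfun_apply (J0 + s *\<^sub>R J) y0, v0 + s *\<^sub>R v) \<in> adj F"
    using adj_add[OF 0(2) adj_scaleR[OF 1(2), of s]]
    by (simp add: eq blinfun.add_left blinfun.scaleR_left)
  then have "(x, v0 + s *\<^sub>R v) \<in> rigged_product F (J0 + s *\<^sub>R J)"
    using 0(1) by (auto simp: rigged_product_def bounded_graph_def)
  then show ?thesis using rigged_product_subset by blast
qed

text \<open>\<open>H0\<close> brings its own \<open>J0\<close>, and the line through it runs over
  \<open>J0 + s J\<close>. Every assumption of the locale thereby becomes available for each
  operator on the line.\<close>

lemma line_op_in_affine_ops:
  assumes H0: "H0 \<in> affine_ops F H \<J>" and J: "J \<in> \<J>"
  shows "line_op F H0 J s \<in> affine_ops F H \<J>"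
proof -
  obtain J0 where J0: "J0 \<in> \<J>" and H0_eq: "H0 = op_add H (rigged_op F J0)"
    using H0 by (auto simp: affine_ops_def)
  define J' where "J' = J0 + s *\<^sub>R J"
  have J': "J' \<in> \<J>"
    unfolding J'_def using J_subspace J0 J by (intro subspace_add subspace_scale)
  \<comment> \<open>Both inclusions go through \<open>D\<close>, where the operators
    \<open>rigged_op\<close> add up.\<close>
  have dom: "x \<in> D" if "(x, y) \<in> op_add H (rigged_op F J1)" "J1 \<in> \<J>" for x y J1
    using that A_domain[of "op_add H (rigged_op F J1)"] by (auto simp: affine_ops_def)
  have "line_op F H0 J s = op_add H (rigged_op F J')"
  proof (intro set_eqI iffI; clarify)
    fix x y assume "(x, y) \<in> line_op F H0 J s"
    then obtain h v where *: "(x, h) \<in> H0" "(x, v) \<in> rigged_op F J" "y = h + s *\<^sub>R v"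
      by (auto simp: line_op_def op_add_def op_scaleR_def)
    then obtain h' v0 where **: "(x, h') \<in> H" "(x, v0) \<in> rigged_op F J0" "h = h' + v0"
      by (auto simp: H0_eq op_add_def)
    have "x \<in> D" using dom[OF _ J0] * H0_eq by blast
    then have "(x, v0 + s *\<^sub>R v) \<in> rigged_op F J'"
      unfolding J'_def using rigged_op_line[OF J0 J] * ** by blast
    then show "(x, y) \<in> op_add H (rigged_op F J')"
      using * ** by (auto simp: op_add_def add.assoc)
  next
    fix x y assume xy: "(x, y) \<in> op_add H (rigged_op F J')"
    then obtain h v' where *: "(x, h) \<in> H" "(x, v') \<in> rigged_op F J'" "y = h + v'"
      by (auto simp: op_add_def)
    have x: "x \<in> D" using dom[OF xy J'] .
    obtain v0 where v0: "(x, v0) \<in> rigged_op F J0" using rigged_productE[OF J0 x] by blast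
    obtain v where v: "(x, v) \<in> rigged_op F J" using rigged_productE[OF J x] by blast
    have "v' = v0 + s *\<^sub>R v"
      using rigged_op_single_valued[OF J' *(2)] rigged_op_line[OF J0 J x v0 v] J'_def by blast
    then have y: "y = (h + v0) + s *\<^sub>R v" using *(3) by (simp add: add.assoc)
    have "(x, h + v0) \<in> H0" unfolding H0_eq op_add_def using *(1) v0 by blast
    moreover have "(x, s *\<^sub>R v) \<in> op_scaleR s (rigged_op F J)" unfolding op_scaleR_def using v by blast
    ultimately show "(x, y) \<in> line_op F H0 J s" unfolding y line_op_def op_add_def by blast
  qed
  then show ?thesis using J' by (auto simp: affine_ops_def)
qed

text \<open>One vector \<open>x\<close> solves two resolvent equations: at \<open>s\<close> with
  right-hand side the adjoint of \<open>F\<close> on \<open>\<phi>\<close>, and at \<open>s'\<close>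
  with \<open>\<phi>\<close> replaced by \<open>\<phi> + (s' - s) J F x\<close>, since the operators
  differ by a multiple of \<open>V\<close>. As \<open>F x\<close> is \<open>T s \<phi>\<close>,
  comparing the values of \<open>F x\<close> is the identity.\<close>

lemma resolvent_identity:
  assumes H0: "H0 \<in> affine_ops F H \<J>" and J: "J \<in> \<J>" and z: "Im z \<noteq> 0"
  defines "T \<equiv> \<lambda>s. T_op F (line_op F H0 J s) z"
  shows "T s = T s' + (s' - s) *\<^sub>R (T s' o\<^sub>L J o\<^sub>L T s)"
proof (rule blinfun_eq_on_dense[OF dense_adj_F])
  fix \<phi> assume \<phi>: "\<phi> \<in> Domain (adj F)"
  note line = line_op_in_affine_ops[OF H0 J]
  obtain v where v: "(\<phi>, v) \<in> sandwiched_resolvent_graph F (line_op F H0 J s) z"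
    using Domain_sandwiched_resolvent[OF line z \<phi>] .
  then obtain x y where xy: "(\<phi>, y - z *\<^sub>C x) \<in> adj F" "(x, y) \<in> line_op F H0 J s" "(x, v) \<in> F"
    by (rule sandwiched_resolventE)
  then have x: "x \<in> D" using A_domain[OF line] by blast
  obtain v1 \<eta> where \<eta>: "(x, v1) \<in> F" "(blinfun_apply J v1, \<eta>) \<in> adj F" "(x, \<eta>) \<in> rigged_op F J"
    using rigged_productE[OF J x] .
  have v1: "v1 = v" using F_single_valued \<eta>(1) xy(3) by blast
  obtain h \<eta>' where h: "(x, h) \<in> H0" "(x, \<eta>') \<in> rigged_op F J" "y = h + s *\<^sub>R \<eta>'"
    using xy(2) by (auto simp: line_op_def op_add_def op_scaleR_def)
  have "\<eta>' = \<eta>" using rigged_op_single_valued[OF J h(2) \<eta>(3)] .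
  then have "(x, h + s' *\<^sub>R \<eta>) \<in> line_op F H0 J s'"
    using h by (auto simp: line_op_def op_add_def op_scaleR_def)
  moreover have "(\<phi> + (s' - s) *\<^sub>R blinfun_apply J v, (h + s' *\<^sub>R \<eta>) - z *\<^sub>C x) \<in> adj F"
    using adj_add[OF xy(1) adj_scaleR[OF \<eta>(2), of "s' - s"]] \<open>\<eta>' = \<eta>\<close>
    by (simp add: h v1 algebra_simps)
  ultimately have "(\<phi> + (s' - s) *\<^sub>R blinfun_apply J v, v)
      \<in> sandwiched_resolvent_graph F (line_op F H0 J s') z"
    using xy(3) by (intro sandwiched_resolventI)
  then have "T s' (\<phi> + (s' - s) *\<^sub>R blinfun_apply J v) = v" "T s \<phi> = v"
    using T_op_spec(2)[OF line z] v by (auto simp: T_def)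
  then show "T s \<phi> = (T s' + (s' - s) *\<^sub>R (T s' o\<^sub>L J o\<^sub>L T s)) \<phi>"
    by (simp add: blinfun.add_left blinfun.add_right blinfun.scaleR_left blinfun.scaleR_right)
qed

end

subsection \<open>Boundary values\<close>

lemma T_lim_tendsto:
  assumes "\<mu> \<in> regular_points F G" "\<sigma> \<in> {1, -1}"
  shows "((\<lambda>y. T_op F G (Complex \<mu> (\<sigma> * y))) \<longlongrightarrow> T_lim F G \<mu> \<sigma>) (at_right 0)"
proof -
  obtain L where "((\<lambda>y. T_op F G (Complex \<mu> (\<sigma> * y))) \<longlongrightarrow> L) (at_right 0)"
    using assms unfolding regular_points_def by blast
  then show ?thesis unfolding T_lim_def by (simp add: tendsto_Lim)
qed

lemma eventually_Im_Complex_nonzero: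
  "\<sigma> \<in> {1, -1 :: real} \<Longrightarrow> \<forall>\<^sub>F y in at_right 0. Im (Complex \<mu> (\<sigma> * y)) \<noteq> 0"
  using eventually_at_right_less[of "0::real"] by (auto elim: eventually_mono)

text \<open>For small \<open>h\<close> the limit of the resolvent identity can be solved:
  \<open>L\<close> is the inverse of \<open>1 + h a0 J\<close> applied to \<open>a0\<close>. This
  makes regularity at a point stable under small moves along the line.\<close>

lemma perturbed_limit:
  fixes a X :: "'x \<Rightarrow> ('k :: banach \<Rightarrow>\<^sub>L 'k)"
  assumes a: "(a \<longlongrightarrow> a0) F" and X: "\<forall>\<^sub>F y in F. X y = a y - h *\<^sub>R (a y o\<^sub>L J o\<^sub>L X y)"
    and h: "\<bar>h\<bar> * (norm a0 + 1) * norm J \<le> 1/2"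
  shows "\<exists>L. (X \<longlongrightarrow> L) F"
proof -
  have comp_le: "norm (h *\<^sub>R (b o\<^sub>L J o\<^sub>L Z)) \<le> \<bar>h\<bar> * norm b * norm J * norm Z" for b Z :: "'k \<Rightarrow>\<^sub>L 'k"
    using order_trans[OF norm_blinfun_compose mult_right_mono[OF norm_blinfun_compose norm_ge_zero],
        of b J Z]
    by (simp add: mult.assoc mult_left_mono)
  have "\<bar>h\<bar> * norm a0 * norm J \<le> \<bar>h\<bar> * (norm a0 + 1) * norm J"
    by (intro mult_right_mono mult_left_mono) auto
  moreover have "norm (h *\<^sub>R (a0 o\<^sub>L J)) \<le> \<bar>h\<bar> * norm a0 * norm J"
    using norm_blinfun_compose[of a0 J] by (simp add: mult.assoc mult_left_mono)
  ultimately have "norm (h *\<^sub>R (a0 o\<^sub>L J)) < 1" using h by linarith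
  then obtain Y where Y: "inverse_ops Y (id_blinfun + h *\<^sub>R (a0 o\<^sub>L J))"
    using inverse_ops_exists by blast
  define L where "L = Y o\<^sub>L a0"
  \<comment> \<open>Eventually \<open>K\<close> dominates \<open>norm (a y)\<close>, and the
    smallness of \<open>h\<close> reads \<open>\<bar>h\<bar> * K * norm J \<le> 1/2\<close>; half of
    \<open>norm (X y)\<close> is then absorbed on the left, leaving the bound
    \<open>2 * K\<close>.\<close>
  define K where "K = norm a0 + 1"
  have K: "0 < K" by (simp add: K_def add_nonneg_pos)
  have "((\<lambda>y. norm (a y)) \<longlongrightarrow> norm a0) F" using a by (rule tendsto_norm)
  then have ev: "\<forall>\<^sub>F y in F. norm (a y) < K" by (rule order_tendstoD) (simp add: K_def)
  have "(X \<longlongrightarrow> L) F"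
  proof (rule LIM_zero_cancel[OF Lim_null_comparison])
    show "\<forall>\<^sub>F y in F. norm (X y - L) \<le> norm (a y - a0) * ((1 + \<bar>h\<bar> * norm J * (2 * K)) * norm Y)"
      using X ev
    proof eventually_elim
      case (elim y)
      have "\<bar>h\<bar> * norm (a y) * norm J \<le> \<bar>h\<bar> * K * norm J"
        using elim by (intro mult_right_mono mult_left_mono) auto
      then have "\<bar>h\<bar> * norm (a y) * norm J * norm (X y) \<le> 1/2 * norm (X y)"
        using h by (intro mult_right_mono) (auto simp: K_def)
      then have "norm (h *\<^sub>R (a y o\<^sub>L J o\<^sub>L X y)) \<le> 1/2 * norm (X y)"
        using comp_le[of "a y" "X y"] by linarith
      moreover have "norm (X y) \<le> norm (a y) + norm (h *\<^sub>R (a y o\<^sub>L J o\<^sub>L X y))"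
        by (subst elim(1)) (rule norm_triangle_ineq4)
      ultimately have X_le: "norm (X y) \<le> 2 * K" using elim(2) by linarith
      \<comment> \<open>\<open>R\<close> is the error of \<open>X y\<close> in the limiting
        equation: \<open>(1 + h a0 J) X y = a0 + R\<close>. Both terms carry the factor
        \<open>a y - a0\<close>.\<close>
      define R where "R = (a y - a0) - h *\<^sub>R ((a y - a0) o\<^sub>L J o\<^sub>L X y)"
      have "X y - L = Y o\<^sub>L R"
      proof (rule blinfun_eqI)
        fix x
        have "X y x = a y x - h *\<^sub>R a y (J (X y x))"
          by (subst elim(1)) (simp add: blinfun.diff_left blinfun.scaleR_left)
        then have "(id_blinfun + h *\<^sub>R (a0 o\<^sub>L J)) (X y x) = a0 x + R x"
          by (simp add: R_def blinfun.diff_left blinfun.add_left blinfun.scaleR_left algebra_simps)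
        then have "X y x = Y (a0 x + R x)" using Y unfolding inverse_ops_iff by metis
        then show "(X y - L) x = (Y o\<^sub>L R) x" by (simp add: L_def blinfun.diff_left blinfun.add_right)
      qed
      then have le: "norm (X y - L) \<le> norm Y * norm R" by (simp add: norm_blinfun_compose)
      have "norm R \<le> norm (a y - a0) + \<bar>h\<bar> * norm (a y - a0) * norm J * norm (X y)"
        unfolding R_def by (rule order_trans[OF norm_triangle_ineq4 add_left_mono[OF comp_le]])
      also have "\<dots> \<le> norm (a y - a0) + \<bar>h\<bar> * norm (a y - a0) * norm J * (2 * K)"
        using X_le by (intro add_left_mono mult_left_mono) auto
      finally have "norm Y * norm R
          \<le> norm Y * (norm (a y - a0) + \<bar>h\<bar> * norm (a y - a0) * norm J * (2 * K))"
        by (rule mult_left_mono) simp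
      with le show ?case by (simp add: algebra_simps)
    qed
    have "((\<lambda>y. norm (a y - a0)) \<longlongrightarrow> 0) F" using a by (simp add: LIM_zero tendsto_norm_zero)
    then show "((\<lambda>y. norm (a y - a0) * ((1 + \<bar>h\<bar> * norm J * (2 * K)) * norm Y)) \<longlongrightarrow> 0) F"
      by (rule tendsto_mult_left_zero)
  qed
  then show ?thesis ..
qed

section \<open>Boundary values on the affine space\<close>

context rigged_affine_space
begin

lemma T_lim_clinear:
  assumes "H' \<in> affine_ops F H \<J>" "\<mu> \<in> regular_points F H'" "\<sigma> \<in> {1, -1}"
  shows "clinear_op (T_lim F H' \<mu> \<sigma>)"
  by (rule clinear_op_limit[OF T_lim_tendsto[OF assms(2,3)]])
    (use eventually_Im_Complex_nonzero[OF assms(3)] in \<open>auto elim!: eventually_mono intro: clinear_T_op assms\<close>)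

lemma T_lim_approximable:
  assumes "H' \<in> affine_ops F H \<J>" "\<mu> \<in> regular_points F H'" "\<sigma> \<in> {1, -1}"
  shows "finite_rank_approximable (T_lim F H' \<mu> \<sigma>)"
  by (rule finite_rank_approximable_limit[OF T_lim_tendsto[OF assms(2,3)]])
    (use eventually_Im_Complex_nonzero[OF assms(3)] in \<open>auto elim!: eventually_mono intro: T_op_approximable assms\<close>)

text \<open>Complex conjugation of the spectral parameter reverses the sign of the approach to the
  real axis.\<close>

lemma T_lim_adjoint:
  assumes "H' \<in> affine_ops F H \<J>" "\<mu> \<in> regular_points F H'" "\<sigma> \<in> {1, -1}"
  shows "cinner \<psi> (blinfun_apply (T_lim F H' \<mu> \<sigma>) \<phi>) = cinner (blinfun_apply (T_lim F H' \<mu> (- \<sigma>)) \<psi>) \<phi>"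
proof (rule tendsto_unique)
  show "((\<lambda>y. cinner \<psi> (blinfun_apply (T_op F H' (Complex \<mu> (\<sigma> * y))) \<phi>))
      \<longlongrightarrow> cinner \<psi> (blinfun_apply (T_lim F H' \<mu> \<sigma>) \<phi>)) (at_right 0)"
    by (intro tendsto_cinner_right tendsto_intros T_lim_tendsto assms)
  have "((\<lambda>y. cinner (blinfun_apply (T_op F H' (Complex \<mu> (- \<sigma> * y))) \<psi>) \<phi>)
      \<longlongrightarrow> cinner (blinfun_apply (T_lim F H' \<mu> (- \<sigma>)) \<psi>) \<phi>) (at_right 0)"
    using assms(3) by (intro tendsto_cinner_left tendsto_intros T_lim_tendsto assms) auto
  moreover have "\<forall>\<^sub>F y in at_right 0. cinner (blinfun_apply (T_op F H' (Complex \<mu> (- \<sigma> * y))) \<psi>) \<phi>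
      = cinner \<psi> (blinfun_apply (T_op F H' (Complex \<mu> (\<sigma> * y))) \<phi>)"
    using eventually_Im_Complex_nonzero[OF assms(3), of \<mu>]
  proof eventually_elim
    case (elim y)
    have "cnj (Complex \<mu> (\<sigma> * y)) = Complex \<mu> (- \<sigma> * y)" by (simp add: complex_eq_iff)
    then show ?case using T_op_adjoint[OF assms(1) elim, of \<psi> \<phi>] by simp
  qed
  ultimately show "((\<lambda>y. cinner \<psi> (blinfun_apply (T_op F H' (Complex \<mu> (\<sigma> * y))) \<phi>))
      \<longlongrightarrow> cinner (blinfun_apply (T_lim F H' \<mu> (- \<sigma>)) \<psi>) \<phi>) (at_right 0)"
    by (rule Lim_transform_eventually)
qed simp

lemma bounded_adj_T_lim:
  assumes "H' \<in> affine_ops F H \<J>" "\<mu> \<in> regular_points F H'" "\<sigma> \<in> {1, -1}"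
  shows "bounded_adj (T_lim F H' \<mu> \<sigma>) = T_lim F H' \<mu> (- \<sigma>)"
  unfolding bounded_adj_def
proof (rule the_equality)
  show "\<forall>x y. cinner (T_lim F H' \<mu> (- \<sigma>) x) y = cinner x (T_lim F H' \<mu> \<sigma> y)"
    using T_lim_adjoint[OF assms] by simp
  fix S assume S: "\<forall>x y. cinner (blinfun_apply S x) y = cinner x (T_lim F H' \<mu> \<sigma> y)"
  show "S = T_lim F H' \<mu> (- \<sigma>)"
  proof (intro blinfun_eqI cinner_eqI)
    fix x w
    have "cinner (S x) w = cinner (T_lim F H' \<mu> (- \<sigma>) x) w"
      using S T_lim_adjoint[OF assms, of x w] by simp
    then show "cinner w (S x) = cinner w (T_lim F H' \<mu> (- \<sigma>) x)"
      by (metis cinner_commute)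
  qed
qed

lemma resolvent_identity_T_lim:
  assumes H0: "H0 \<in> affine_ops F H \<J>" and J: "J \<in> \<J>" and \<sigma>: "\<sigma> \<in> {1, -1}"
    and s: "nonresonant F H0 J \<mu> s" and s': "nonresonant F H0 J \<mu> s'"
  defines "T \<equiv> \<lambda>s. T_lim F (line_op F H0 J s) \<mu> \<sigma>"
  shows "T s = T s' + (s' - s) *\<^sub>R (T s' o\<^sub>L J o\<^sub>L T s)"
proof (rule tendsto_unique)
  let ?t = "\<lambda>s y. T_op F (line_op F H0 J s) (Complex \<mu> (\<sigma> * y))"
  have lim: "(?t r \<longlongrightarrow> T r) (at_right 0)" if "nonresonant F H0 J \<mu> r" for r
    using that \<sigma> unfolding T_def nonresonant_def by (intro T_lim_tendsto) auto
  show "(?t s \<longlongrightarrow> T s) (at_right 0)" using lim s .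
  have "((\<lambda>y. ?t s' y + (s' - s) *\<^sub>R (?t s' y o\<^sub>L J o\<^sub>L ?t s y))
      \<longlongrightarrow> T s' + (s' - s) *\<^sub>R (T s' o\<^sub>L J o\<^sub>L T s)) (at_right 0)"
    by (intro tendsto_intros blinfun_compose.tendsto lim s s')
  moreover have "\<forall>\<^sub>F y in at_right 0. ?t s' y + (s' - s) *\<^sub>R (?t s' y o\<^sub>L J o\<^sub>L ?t s y) = ?t s y"
    using eventually_Im_Complex_nonzero[OF \<sigma>, of \<mu>]
    by eventually_elim (use resolvent_identity[OF H0 J, of _ s s'] in simp)
  ultimately show "(?t s \<longlongrightarrow> T s' + (s' - s) *\<^sub>R (T s' o\<^sub>L J o\<^sub>L T s)) (at_right 0)"
    by (rule Lim_transform_eventually)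
qed simp

text \<open>Supplies the real parameters accumulating at \<open>s0\<close> at which any meromorphic
  extension has prescribed values.\<close>

lemma eventually_nonresonant:
  assumes H0: "H0 \<in> affine_ops F H \<J>" and J: "J \<in> \<J>" and s0: "nonresonant F H0 J \<mu> s0"
  shows "\<forall>\<^sub>F s in at s0. nonresonant F H0 J \<mu> s"
proof -
  have "\<forall>\<^sub>F s in at s0. \<exists>L. ((\<lambda>y. T_op F (line_op F H0 J s) (Complex \<mu> (\<sigma> * y))) \<longlongrightarrow> L) (at_right 0)"
    if \<sigma>: "\<sigma> \<in> {1, -1}" for \<sigma>
  proof -
    let ?a0 = "T_lim F (line_op F H0 J s0) \<mu> \<sigma>"
    have "((\<lambda>s. \<bar>s - s0\<bar> * (norm ?a0 + 1) * norm J) \<longlongrightarrow> \<bar>s0 - s0\<bar> * (norm ?a0 + 1) * norm J) (at s0)"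
      by (intro tendsto_intros)
    then have "\<forall>\<^sub>F s in at s0. \<bar>s - s0\<bar> * (norm ?a0 + 1) * norm J < 1/2"
      by (intro order_tendstoD(2)) auto
    then show ?thesis
    proof eventually_elim
      case (elim s)
      show ?case
      proof (rule perturbed_limit)
        show "((\<lambda>y. T_op F (line_op F H0 J s0) (Complex \<mu> (\<sigma> * y))) \<longlongrightarrow> ?a0) (at_right 0)"
          using s0 \<sigma> unfolding nonresonant_def by (intro T_lim_tendsto)
        show "\<bar>s - s0\<bar> * (norm ?a0 + 1) * norm J \<le> 1/2" using elim by simp
        show "\<forall>\<^sub>F y in at_right 0. T_op F (line_op F H0 J s) (Complex \<mu> (\<sigma> * y))
          = T_op F (line_op F H0 J s0) (Complex \<mu> (\<sigma> * y)) - (s - s0) *\<^sub>R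
            (T_op F (line_op F H0 J s0) (Complex \<mu> (\<sigma> * y)) o\<^sub>L J o\<^sub>L
             T_op F (line_op F H0 J s) (Complex \<mu> (\<sigma> * y)))"
          using eventually_Im_Complex_nonzero[OF \<sigma>, of \<mu>]
        proof eventually_elim
          case (elim y)
          show ?case
            using resolvent_identity[OF H0 J elim, of s s0]
            by (metis (no_types, lifting) add_uminus_conv_diff minus_diff_eq scaleR_minus_left)
        qed
      qed
    qed
  qed
  from this[of 1] this[of "-1"] show ?thesis
    unfolding nonresonant_def regular_points_def by (simp add: eventually_conj_iff)
qed

end

section \<open>Identity theorem and residues for operator-valued functions\<close>

text \<open>The Fredholm theorem inverts \<open>1 + s a\<close>, whereas the pencil of the line is
  centred at \<open>s0\<close>; translations carry the one over to the other.\<close>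

lemma op_holomorphic_on_shift:
  assumes "op_holomorphic_on g (ball p \<epsilon>)"
  shows "op_holomorphic_on (\<lambda>s. g (s - c)) (ball (p + c) \<epsilon>)"
  unfolding op_holomorphic_on_def
proof
  fix z assume "z \<in> ball (p + c) \<epsilon>"
  then have z: "z - c \<in> ball p \<epsilon>" by (simp add: dist_norm algebra_simps)
  have at: "at (z - c) within ball p \<epsilon> = at (z - c)" using z by (intro at_within_open) auto
  obtain g' where "((\<lambda>w. (1 / (w - (z - c))) *\<^sub>C (g w - g (z - c))) \<longlongrightarrow> g') (at (z - c))"
    by (rule op_holomorphic_onD[OF assms z, unfolded at], rule that)
  then have "((\<lambda>w. (1 / (w + - c - (z - c))) *\<^sub>C (g (w + - c) - g (z - c))) \<longlongrightarrow> g') (at (z - c - - c))"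
    by (rule LIM_offset)
  then have "((\<lambda>w. (1 / (w - z)) *\<^sub>C (g (w - c) - g (z - c))) \<longlongrightarrow> g') (at z)"
    by simp
  then show "\<exists>d. ((\<lambda>w. (1 / (w - z)) *\<^sub>C (g (w - c) - g (z - c))) \<longlongrightarrow> d) (at z within ball (p + c) \<epsilon>)"
    by (intro exI) (rule tendsto_within_subset[OF _ subset_UNIV])
qed

lemma eventually_at_shift:
  assumes "\<forall>\<^sub>F s in at (p - c). P s"
  shows "\<forall>\<^sub>F s in at (p :: complex). P (s - c)"
proof -
  obtain d where d: "d > 0" "\<And>s. s \<noteq> p - c \<Longrightarrow> dist s (p - c) < d \<Longrightarrow> P s"
    using assms by (auto simp: eventually_at)
  have "P (s - c)" if "s \<noteq> p" "dist s p < d" for s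
    using that by (intro d(2)) (auto simp: dist_norm)
  then show ?thesis using d(1) by (auto simp: eventually_at)
qed

lemma meromorphic_op_at_shift:
  assumes "meromorphic_op_at f (p - c)"
  shows "meromorphic_op_at (\<lambda>s. f (s - c)) p"
proof -
  obtain n g \<epsilon> where g: "0 < \<epsilon>" "op_holomorphic_on g (ball (p - c) \<epsilon>)"
    "\<forall>z\<in>ball (p - c) \<epsilon>. clinear_op (g z)"
    "\<forall>z\<in>ball (p - c) \<epsilon> - {p - c}. f z = (1 / (z - (p - c)) ^ n) *\<^sub>C g z"
    using assms unfolding meromorphic_op_at_def by blast
  have "\<forall>\<^sub>F z in at (p - c). z \<in> ball (p - c) \<epsilon> - {p - c}"
    using g(1) by (intro eventually_at_in_open) auto
  then have "\<forall>\<^sub>F z in at (p - c). f z = (1 / (z - (p - c)) ^ n) *\<^sub>C g z"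
    by eventually_elim (use g in auto)
  from eventually_at_shift[OF this]
  have "\<forall>\<^sub>F z in at p. f (z - c) = (1 / (z - p) ^ n) *\<^sub>C g (z - c)" by simp
  moreover have "clinear_op (g (z - c))" if "z \<in> ball p \<epsilon>" for z
    using g(3) that by (simp add: dist_norm algebra_simps)
  ultimately show ?thesis
    using g(1) op_holomorphic_on_shift[OF g(2), of c]
    by (intro meromorphic_op_atI[where \<epsilon> = \<epsilon> and g = "\<lambda>z. g (z - c)"]) auto
qed

lemma op_meromorphic_eventually_isCont:
  assumes "op_meromorphic f"
  shows "\<forall>\<^sub>F z in at p. isCont f z"
proof -
  obtain n g \<epsilon> where g: "0 < \<epsilon>" "op_holomorphic_on g (ball p \<epsilon>)"
    "\<forall>z\<in>ball p \<epsilon> - {p}. f z = (1 / (z - p) ^ n) *\<^sub>C g z"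
    using assms unfolding op_meromorphic_def by blast
  have "continuous_on (ball p \<epsilon> - {p}) (\<lambda>z. (1 / (z - p) ^ n) *\<^sub>C g z)"
    by (intro continuous_intros continuous_on_subset[OF op_holomorphic_on_imp_continuous_on[OF g(2)]]) auto
  then have "continuous_on (ball p \<epsilon> - {p}) f"
    by (rule continuous_on_eq) (use g(3) in simp)
  then have cont: "isCont f z" if "z \<in> ball p \<epsilon> - {p}" for z
    using that continuous_on_eq_continuous_at[of "ball p \<epsilon> - {p}" f] by (simp add: open_delete)
  have "\<forall>\<^sub>F z in at p. z \<in> ball p \<epsilon> - {p}"
    using g(1) by (intro eventually_at_in_open) auto
  then show ?thesis by eventually_elim (rule cont)
qed

text \<open>The scalar identity theorem applies to all matrix coefficients \<open>\<langle>w, (f - g) x\<rangle>\<close>; continuity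
  then gives a punctured neighbourhood that works for all \<open>w\<close> and \<open>x\<close> at once.\<close>

lemma op_meromorphic_identity:
  fixes f g :: "complex \<Rightarrow> ('a :: chilbert_space \<Rightarrow>\<^sub>L 'a)"
  assumes f: "op_meromorphic f" and g: "op_meromorphic g" and freq: "\<exists>\<^sub>F z in at q. f z = g z"
  shows "\<forall>\<^sub>F z in at p. f z = g z"
proof -
  have zero: "\<forall>\<^sub>F z in at p. cinner w (f z x) - cinner w (g z x) = 0" for p w x
  proof -
    have mero: "(\<lambda>z. cinner w (f z x) - cinner w (g z x)) meromorphic_on UNIV"
      by (intro meromorphic_intros op_meromorphic_functional f g bounded_linear_cinner_right
          cinner_scaleC_right)
    have "\<exists>\<^sub>F z in at q. cinner w (f z x) - cinner w (g z x) = 0"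
      using freq by (rule frequently_elim1) simp
    then have "\<not> (\<forall>\<^sub>F z in at q. cinner w (f z x) - cinner w (g z x) \<noteq> 0)"
      by (simp add: frequently_def)
    then have "eventually (\<lambda>z. cinner w (f z x) - cinner w (g z x) = 0) (cosparse UNIV)"
      using meromorphic_imp_constant_or_avoid[OF mero open_UNIV connected_UNIV, of 0]
      by (auto simp: eventually_cosparse_open_eq)
    then show ?thesis by (auto simp: eventually_cosparse_open_eq)
  qed
  show ?thesis
    using op_meromorphic_eventually_isCont[OF f, of p] op_meromorphic_eventually_isCont[OF g, of p]
  proof eventually_elim
    case (elim z)
    show "f z = g z"
    proof (intro blinfun_eqI cinner_eqI)
      fix x w
      have "((\<lambda>s. cinner w (f s x) - cinner w (g s x)) \<longlongrightarrow> cinner w (f z x) - cinner w (g z x)) (at z)"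
        using elim by (intro tendsto_intros tendsto_cinner_right) (auto simp: isCont_def)
      moreover have "((\<lambda>s. cinner w (f s x) - cinner w (g s x)) \<longlongrightarrow> 0) (at z)"
        by (rule tendsto_eventually) (rule zero)
      ultimately have "cinner w (f z x) - cinner w (g z x) = 0"
        using tendsto_unique[OF trivial_limit_at] by blast
      then show "cinner w (f z x) = cinner w (g z x)" by simp
    qed
  qed
qed

text \<open>The circle integrals exist by continuity, and their independence of the radius is read off
  the matrix coefficients.\<close>

lemma op_residue_exists:
  assumes "meromorphic_op_at f p"
  obtains B where "\<exists>e>0. \<forall>\<epsilon>>0. \<epsilon> < e \<longrightarrow>
      has_op_contour_integral f ((2 * complex_of_real pi * \<i>) *\<^sub>C B) (circlepath p \<epsilon>)"
    "\<And>w x. cinner w (blinfun_apply B x) = residue (\<lambda>s. cinner w (blinfun_apply (f s) x)) p"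
proof -
  obtain n g \<rho> where g: "0 < \<rho>" "op_holomorphic_on g (ball p \<rho>)"
    "\<forall>z\<in>ball p \<rho> - {p}. f z = (1 / (z - p) ^ n) *\<^sub>C g z"
    using assms unfolding meromorphic_op_at_def by blast
  define c where "c = 2 * complex_of_real pi * \<i>"
  have c: "c \<noteq> 0" by (simp add: c_def)
  have integral: "\<exists>I. has_op_contour_integral f I (circlepath p \<epsilon>)" if \<epsilon>: "0 < \<epsilon>" "\<epsilon> < \<rho>" for \<epsilon>
  proof -
    let ?\<gamma> = "circlepath p \<epsilon>"
    have in_ball: "?\<gamma> t \<in> ball p \<rho> - {p}" for t
      using \<epsilon> by (simp add: circlepath dist_norm norm_mult)
    have cont: "continuous_on {0..1} ?\<gamma>" by (rule path_circlepath[unfolded path_def])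
    moreover have "?\<gamma> ` {0..1} \<subseteq> ball p \<rho>" using in_ball by blast
    then have "continuous_on {0..1} (\<lambda>t. g (?\<gamma> t))"
      by (rule continuous_on_compose2[OF op_holomorphic_on_imp_continuous_on[OF g(2)] cont])
    moreover have "?\<gamma> t - p \<noteq> 0" for t using in_ball[of t] by auto
    ultimately have "continuous_on {0..1} (\<lambda>t. (2 * complex_of_real pi * \<i> * complex_of_real \<epsilon> * exp (2 * complex_of_real pi * \<i> * complex_of_real t)) *\<^sub>C
        ((1 / (?\<gamma> t - p) ^ n) *\<^sub>C g (?\<gamma> t)))"
      by (intro continuous_intros) auto
    then have "continuous_on {0..1} (\<lambda>t. vector_derivative ?\<gamma> (at t within {0..1}) *\<^sub>C f (?\<gamma> t))"
      by (rule continuous_on_eq) (use in_ball g(3) in \<open>simp add: vector_derivative_circlepath01\<close>)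
    then show ?thesis
      unfolding has_op_contour_integral_def
      using integrable_continuous_interval integrable_on_def by blast
  qed
  have coeff: "cinner w (I x) = c * residue (\<lambda>s. cinner w (f s x)) p"
    if \<epsilon>: "0 < \<epsilon>" "\<epsilon> < \<rho>" and I: "has_op_contour_integral f I (circlepath p \<epsilon>)" for \<epsilon> I w x
  proof -
    let ?\<gamma> = "circlepath p \<epsilon>" and ?h = "\<lambda>T. cinner w (blinfun_apply T x)"
    have "bounded_linear ?h"
      using bounded_linear_compose[OF bounded_linear_cinner_right blinfun.bounded_linear_left] .
    from has_integral_linear[OF I[unfolded has_op_contour_integral_def] this]
    have "((\<lambda>s. cinner w (f s x)) has_contour_integral ?h I) ?\<gamma>"
      unfolding has_contour_integral_def
      by (simp add: o_def scaleC_blinfun.rep_eq cinner_scaleC_right mult.commute)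
    moreover have "((\<lambda>s. cinner w (f s x)) has_contour_integral
        complex_of_real (2 * pi) * \<i> * residue (\<lambda>s. cinner w (f s x)) p) ?\<gamma>"
    proof (rule base_residue[where s = "ball p \<rho>"])
      have "(\<lambda>s. cinner w (g s x) / (s - p) ^ n) holomorphic_on ball p \<rho> - {p}"
        by (intro holomorphic_intros holomorphic_on_subset[OF op_holomorphic_on_functional[OF g(2)]]
            bounded_linear_cinner_right cinner_scaleC_right) auto
      then show "(\<lambda>s. cinner w (f s x)) holomorphic_on ball p \<rho> - {p}"
        by (rule holomorphic_transform)
          (use g(3) in \<open>simp add: scaleC_blinfun.rep_eq cinner_scaleC_right\<close>)
    qed (use \<epsilon> g(1) in auto)
    ultimately have "?h I = complex_of_real (2 * pi) * \<i> * residue (\<lambda>s. cinner w (f s x)) p"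
      by (rule has_contour_integral_unique)
    then show ?thesis by (simp add: c_def)
  qed
  obtain I where I: "has_op_contour_integral f I (circlepath p (\<rho>/2))"
    using integral[of "\<rho>/2"] g(1) by auto
  have I_eq: "has_op_contour_integral f I (circlepath p \<epsilon>)" if \<epsilon>: "0 < \<epsilon>" "\<epsilon> < \<rho>" for \<epsilon>
  proof -
    obtain I' where I': "has_op_contour_integral f I' (circlepath p \<epsilon>)" using integral[OF \<epsilon>] by blast
    have "I' = I"
      by (intro blinfun_eqI cinner_eqI) (use coeff[OF \<epsilon> I'] coeff[OF _ _ I] g(1) in simp)
    then show ?thesis using I' by simp
  qed
  define B where "B = (1 / c) *\<^sub>C I"
  have "c *\<^sub>C B = I" using c by (simp add: B_def cscale_cscale)
  then have "\<exists>e>0. \<forall>\<epsilon>>0. \<epsilon> < e \<longrightarrow> has_op_contour_integral f (c *\<^sub>C B) (circlepath p \<epsilon>)"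
    using I_eq g(1) by auto
  moreover have "cinner w (B x) = residue (\<lambda>s. cinner w (f s x)) p" for w x
    using coeff[OF _ _ I, of w x] g(1) c
    by (simp add: B_def scaleC_blinfun.rep_eq cinner_scaleC_right)
  ultimately show thesis using that unfolding c_def by blast
qed

lemma residue_principal_part:
  fixes c :: "nat \<Rightarrow> complex"
  assumes ev: "\<forall>\<^sub>F s in at p. f s = (\<Sum>j\<le>k. c j / (s - p) ^ j)" and k: "1 \<le> k"
  shows "residue f p = c 1"
proof -
  have single: "residue (\<lambda>s. b / (s - p) ^ j) p = (if j = 1 then b else 0)" for b :: complex and j
  proof (cases j)
    case 0
    then show ?thesis by (simp add: residue_const)
  next
    case (Suc n)
    \<comment> \<open>The residue is the \<open>n\<close>-th Taylor coefficient of the constant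
      \<open>b\<close>, which is nonzero at most for \<open>n = 0\<close>.\<close>
    have "residue (\<lambda>s. b / (s - p) ^ Suc n) p = (deriv ^^ n) (\<lambda>_. b) p / fact n"
      by (rule residue_holomorphic_over_power[of UNIV]) auto
    then show ?thesis using Suc by (simp add: higher_deriv_const)
  qed
  have "residue (\<lambda>s. \<Sum>j\<le>m. c j / (s - p) ^ j) p = (\<Sum>j\<le>m. if j = 1 then c j else 0)" for m
  proof (induction m)
    case 0
    then show ?case using single[of "c 0" 0] by simp
  next
    case (Suc m)
    have "residue (\<lambda>s. (\<Sum>j\<le>m. c j / (s - p) ^ j) + c (Suc m) / (s - p) ^ Suc m) p
        = residue (\<lambda>s. \<Sum>j\<le>m. c j / (s - p) ^ j) p + residue (\<lambda>s. c (Suc m) / (s - p) ^ Suc m) p"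
      by (rule residue_add[of UNIV]) (auto intro!: holomorphic_intros)
    then show ?case using Suc single[of "c (Suc m)" "Suc m"] by simp
  qed
  moreover have "residue f p = residue (\<lambda>s. \<Sum>j\<le>k. c j / (s - p) ^ j) p"
    using ev by (intro residue_cong) auto
  ultimately show ?thesis using k by (simp add: sum.delta)
qed

section \<open>The resolvent on a root space\<close>

text \<open>With \<open>B = 1 + d a\<close> and \<open>B^k v = 0\<close>, the operator \<open>root_nilpotent\<close> is \<open>d B / (1 - B)\<close> written
  as a finite geometric sum; it coincides there with the residue of \<open>(s - r) A(s)\<close>.\<close>

definition root_nilpotent :: "('a :: real_normed_vector \<Rightarrow>\<^sub>L 'a) \<Rightarrow> real \<Rightarrow> nat \<Rightarrow> 'a \<Rightarrow> 'a" where
  "root_nilpotent a d k v = d *\<^sub>R (\<Sum>i\<in>{1..<k}. (blinfun_apply (id_blinfun + d *\<^sub>R a) ^^ i) v)"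

context
  fixes a :: "'a :: chilbert_space \<Rightarrow>\<^sub>L 'a" and d :: real and k :: nat
  assumes a: "clinear_op a" and d: "d \<noteq> 0" and k: "1 \<le> k"
begin

private abbreviation "B \<equiv> blinfun_apply (id_blinfun + d *\<^sub>R a)"
private abbreviation "Q \<equiv> root_nilpotent a d k"

private lemma linear_B: "linear (B ^^ i)"
proof (induction i)
  case (Suc i)
  show ?case
    using linear_compose[OF Suc.IH bounded_linear.linear[OF blinfun.bounded_linear_right]]
    by (simp add: o_def)
qed (simp add: linear_iff)

private lemma B_mono: "(B ^^ i) v = 0 \<Longrightarrow> i \<le> j \<Longrightarrow> (B ^^ j) v = 0"
proof -
  assume "(B ^^ i) v = 0" "i \<le> j"
  moreover from this have "B ^^ j = (B ^^ (j - i)) \<circ> (B ^^ i)" by (simp flip: funpow_add)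
  ultimately show "(B ^^ j) v = 0" by (simp add: linear_0[OF linear_B])
qed

text \<open>The sum in \<open>Q\<close> starts at \<open>i = 1\<close>, so every summand contains a
  factor \<open>B\<close> and \<open>Q\<close> lowers the order of a root vector.\<close>

private lemma B_root_nilpotent:
  assumes "(B ^^ Suc m) v = 0"
  shows "(B ^^ m) (Q v) = 0"
proof -
  have "(B ^^ m) (Q v) = d *\<^sub>R (\<Sum>i\<in>{1..<k}. (B ^^ (m + i)) v)"
    by (simp add: root_nilpotent_def linear_scale[OF linear_B] linear_sum[OF linear_B] funpow_add)
  also have "(\<Sum>i\<in>{1..<k}. (B ^^ (m + i)) v) = 0"
    by (intro sum.neutral ballI B_mono[OF assms]) auto
  finally show ?thesis by simp
qed

private lemma root_nilpotent_zero: "Q 0 = 0"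
  by (simp add: root_nilpotent_def linear_0[OF linear_B])

private lemma funpow_root_nilpotent:
  assumes "(B ^^ k) v = 0" "j \<le> k"
  shows "(B ^^ (k - j)) ((Q ^^ j) v) = 0"
  using assms(2)
proof (induction j)
  case (Suc j)
  then have "Suc (k - Suc j) = k - j" by simp
  with Suc have "(B ^^ Suc (k - Suc j)) ((Q ^^ j) v) = 0" by (simp del: funpow.simps)
  from B_root_nilpotent[OF this] show ?case by simp
qed (use assms in simp)

lemma root_nilpotent_funpow_in_root_space:
  assumes "(B ^^ k) v = 0"
  shows "(B ^^ k) ((Q ^^ j) v) = 0"
proof (induction j)
  case (Suc j)
  have "(B ^^ Suc k) ((Q ^^ j) v) = 0" by (rule B_mono[OF Suc.IH]) simp
  from B_root_nilpotent[OF this] show ?case by simp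
qed (use assms in simp)

lemma root_nilpotent_funpow_order:
  assumes "(B ^^ k) v = 0" "k \<le> j"
  shows "(Q ^^ j) v = 0"
  using assms(2)
proof (induction j rule: dec_induct)
  case base
  then show ?case using funpow_root_nilpotent[OF assms(1), of k] by simp
qed (simp add: root_nilpotent_zero)

text \<open>The claim is \<open>a Q v = - B v\<close>. The difference \<open>Q v - B (Q v)\<close>
  telescopes to \<open>d B v\<close>, and it also equals \<open>- d a (Q v)\<close> because
  \<open>1 - B = - d a\<close>.\<close>

private lemma a_root_nilpotent:
  assumes v: "(B ^^ k) v = 0"
  shows "a (Q v) = - (v + d *\<^sub>R a v)"
proof -
  have B: "B x = x + d *\<^sub>R a x" for x
    by (simp add: blinfun.add_left blinfun.scaleR_left)
  have "Q v - B (Q v) = d *\<^sub>R (\<Sum>i\<in>{1..<k}. (B ^^ i) v - (B ^^ Suc i) v)"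
    by (simp add: root_nilpotent_def blinfun.scaleR_right blinfun.sum_right sum_subtractf
        scaleR_diff_right del: blinfun_apply_id_blinfun)
  also have "(\<Sum>i\<in>{1..<k}. (B ^^ i) v - (B ^^ Suc i) v) = B v - (B ^^ k) v"
    using k by (induction k rule: dec_induct) (simp_all del: funpow.simps(2) add: funpow_Suc_right)
  also have "\<dots> = B v" using v by simp
  finally have "- (d *\<^sub>R a (Q v)) = d *\<^sub>R B v" unfolding B by simp
  then have "d *\<^sub>R (a (Q v) + B v) = 0" by (simp add: scaleR_add_right neg_eq_iff_add_eq_0)
  then have "a (Q v) + B v = 0" using d by simp
  then show ?thesis unfolding B by (simp add: add_eq_0_iff2)
qed

text \<open>Under the pencil each summand of the candidate becomes a difference, by
  \<open>a Q v = - (v + d a v)\<close>, and the sum telescopes to \<open>a v\<close>. The remainder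
  contains \<open>Q ^^ Suc k\<close>, which vanishes on \<open>v\<close>.\<close>

lemma resolvent_on_root_space:
  fixes w :: complex
  assumes v: "(B ^^ k) v = 0" and w: "w \<noteq> 0"
    and X: "inverse_ops X (id_blinfun + (w + complex_of_real d) *\<^sub>C a)"
  shows "a (X v) = (\<Sum>j\<le>k. (1 / w ^ Suc j) *\<^sub>C (Q ^^ j) v)" (is "_ = ?Y")
proof -
  \<comment> \<open>In the application \<open>w = s - r\<close> and \<open>d = r - s0\<close>, so
    that \<open>w + d = s - s0\<close>.\<close>
  let ?M = "id_blinfun + (w + complex_of_real d) *\<^sub>C a"
  have M: "?M x = x + d *\<^sub>R a x + w *\<^sub>C a x" for x
    by (simp add: blinfun.add_left scaleC_blinfun.rep_eq cscale_add_left scaleR_cscale add_ac)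
  have summand: "?M ((1 / w ^ Suc j) *\<^sub>C (Q ^^ j) v)
      = (1 / w ^ j) *\<^sub>C a ((Q ^^ j) v) - (1 / w ^ Suc j) *\<^sub>C a ((Q ^^ Suc j) v)" for j
  proof -
    have "a ((Q ^^ Suc j) v) = - ((Q ^^ j) v + d *\<^sub>R a ((Q ^^ j) v))"
      using a_root_nilpotent[OF root_nilpotent_funpow_in_root_space[OF v]] by simp
    then have "(Q ^^ j) v + d *\<^sub>R a ((Q ^^ j) v) = - a ((Q ^^ Suc j) v)" by simp
    moreover have "?M ((1 / w ^ Suc j) *\<^sub>C (Q ^^ j) v)
        = (1 / w ^ Suc j) *\<^sub>C ((Q ^^ j) v + d *\<^sub>R a ((Q ^^ j) v)) + (1 / w ^ j) *\<^sub>C a ((Q ^^ j) v)"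
      using w unfolding M
      by (simp add: clinear_opD[OF a] cscale_add_right scaleR_cscale cscale_cscale mult.commute)
    ultimately show ?thesis by (simp del: funpow.simps)
  qed
  have "?M ?Y = (\<Sum>j\<le>k. (1 / w ^ j) *\<^sub>C a ((Q ^^ j) v) - (1 / w ^ Suc j) *\<^sub>C a ((Q ^^ Suc j) v))"
    by (simp only: blinfun.sum_right summand)
  also have "\<dots> = a v - (1 / w ^ Suc k) *\<^sub>C a ((Q ^^ Suc k) v)"
    by (subst sum_telescope) simp
  also have "\<dots> = a v" using root_nilpotent_funpow_order[OF v, of "Suc k"] by (simp del: funpow.simps)
  finally have "?M ?Y = a v" .
  \<comment> \<open>\<open>a\<close> commutes with its own pencil, so \<open>a (X v)\<close> is
    mapped to \<open>a v\<close> as well, and the pencil is injective.\<close>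
  moreover have "?M (a (X v)) = a (?M (X v))"
    unfolding M by (simp add: blinfun.add_right blinfun.scaleR_right clinear_opD[OF a])
  ultimately have "?M (a (X v)) = ?M ?Y" using X by (simp add: inverse_ops_iff)
  then show ?thesis using X unfolding inverse_ops_iff by metis
qed

end

section \<open>Lines regular at a point\<close>

text \<open>The base point \<open>s0\<close> is kept fixed: the single operator \<open>a\<close> at
  \<open>s0\<close> describes the whole line, and the resonance spaces are computed from it.\<close>

locale regular_rigged_line = rigged_affine_space F H \<J> D
  for F :: "('h :: {chilbert_space, second_countable_topology} \<times>
             'k :: {chilbert_space, second_countable_topology}) set"
    and H :: "('h \<times> 'h) set" and \<J> :: "('k \<Rightarrow>\<^sub>L 'k) set" and D :: "'h set" +
  fixes H0 :: "('h \<times> 'h) set" and J :: "'k \<Rightarrow>\<^sub>L 'k" and \<mu> s0 :: real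
  assumes H0: "H0 \<in> affine_ops F H \<J>" and J: "J \<in> \<J>" and s0: "nonresonant F H0 J \<mu> s0"
begin

abbreviation "regular s \<equiv> nonresonant F H0 J \<mu> s"
abbreviation "T \<sigma> s \<equiv> T_lim F (line_op F H0 J s) \<mu> \<sigma>"
abbreviation "A \<sigma> s \<equiv> A_op F H0 J \<mu> \<sigma> s"
abbreviation "a \<sigma> \<equiv> A \<sigma> s0"
abbreviation "A_ext \<sigma> \<equiv> A_mero F H0 J \<mu> \<sigma>"
abbreviation "pencil \<sigma> s \<equiv> id_blinfun + (s - complex_of_real s0) *\<^sub>C a \<sigma>"

lemma J_selfadj: "cinner x (blinfun_apply J y) = cinner (blinfun_apply J x) y"
  using J_selfadjoint[OF J] by (simp add: bounded_selfadjoint_def)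

lemma A_clinear: "regular s \<Longrightarrow> \<sigma> \<in> {1, -1} \<Longrightarrow> clinear_op (A \<sigma> s)"
  unfolding A_op_def nonresonant_def
  by (intro clinear_op_compose T_lim_clinear line_op_in_affine_ops[OF H0 J] J_clinear J)

text \<open>With \<open>A = T J\<close> the left side contains \<open>J T J\<close>, whose adjoint
  is \<open>J T J\<close> at the opposite sign. So \<open>A\<close> at the two signs is adjoint with
  respect to the form \<open>cinner x (J y)\<close>.\<close>

lemma A_adjoint:
  assumes "regular s" "\<sigma> \<in> {1, -1}"
  shows "cinner x (blinfun_apply J (blinfun_apply (A \<sigma> s) y))
    = cinner (blinfun_apply (A (- \<sigma>) s) x) (blinfun_apply J y)"
  using T_lim_adjoint[OF line_op_in_affine_ops[OF H0 J]] assms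
  by (simp add: A_op_def nonresonant_def J_selfadj)

text \<open>The resolvent identity between \<open>s\<close> and \<open>s0\<close>, read in its two
  orders, gives the right and the left inverse. It ties the Fredholm inverse to \<open>A\<close> at
  nonresonant \<open>s\<close>.\<close>

lemma pencil_inverse:
  assumes s: "regular s" and \<sigma>: "\<sigma> \<in> {1, -1}"
  defines "X \<equiv> id_blinfun - (s - s0) *\<^sub>R A \<sigma> s"
  shows "inverse_ops X (pencil \<sigma> (complex_of_real s))" "a \<sigma> o\<^sub>L X = A \<sigma> s"
proof -
  have "T \<sigma> s = T \<sigma> s0 + (s0 - s) *\<^sub>R (T \<sigma> s0 o\<^sub>L J o\<^sub>L T \<sigma> s)"
    by (rule resolvent_identity_T_lim[OF H0 J \<sigma> s s0])
  then have 1: "A \<sigma> s x = a \<sigma> x + (s0 - s) *\<^sub>R a \<sigma> (A \<sigma> s x)" for x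
    unfolding A_op_def
    by (metis (no_types, lifting) blinfun.add_left blinfun.scaleR_left blinfun_apply_blinfun_compose)
  have "T \<sigma> s0 = T \<sigma> s + (s - s0) *\<^sub>R (T \<sigma> s o\<^sub>L J o\<^sub>L T \<sigma> s0)"
    by (rule resolvent_identity_T_lim[OF H0 J \<sigma> s0 s])
  then have 2: "a \<sigma> x = A \<sigma> s x + (s - s0) *\<^sub>R A \<sigma> s (a \<sigma> x)" for x
    unfolding A_op_def
    by (metis (no_types, lifting) blinfun.add_left blinfun.scaleR_left blinfun_apply_blinfun_compose)
  have X: "X x = x - (s - s0) *\<^sub>R A \<sigma> s x" for x
    by (simp add: X_def blinfun.diff_left blinfun.scaleR_left)
  have M: "pencil \<sigma> (complex_of_real s) x = x + (s - s0) *\<^sub>R a \<sigma> x" for x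
    by (simp add: blinfun.add_left scaleC_blinfun.rep_eq scaleR_cscale)
  have aX: "a \<sigma> (X x) = A \<sigma> s x" for x
    unfolding X using 1[of x] by (simp add: blinfun.diff_right blinfun.add_right blinfun.scaleR_right algebra_simps)
  have "X (pencil \<sigma> (complex_of_real s) x) = x" for x
  proof -
    have "X (pencil \<sigma> (complex_of_real s) x)
        = x + (s - s0) *\<^sub>R (a \<sigma> x - (A \<sigma> s x + (s - s0) *\<^sub>R A \<sigma> s (a \<sigma> x)))"
      unfolding X M by (simp add: blinfun.add_right blinfun.diff_right blinfun.scaleR_right algebra_simps)
    then show ?thesis using 2[of x] by simp
  qed
  moreover have "pencil \<sigma> (complex_of_real s) (X x) = x" for x
    unfolding M aX by (simp add: X)
  ultimately show "inverse_ops X (pencil \<sigma> (complex_of_real s))" unfolding inverse_ops_iff by blast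
  show "a \<sigma> o\<^sub>L X = A \<sigma> s" by (rule blinfun_eqI) (simp add: aX)
qed

text \<open>The function \<open>f\<close> built from the Fredholm inverse witnesses that the choice
  in \<open>A_mero\<close> is not void. Whatever extension is chosen, it agrees with
  \<open>f\<close> at the nonresonant reals near \<open>s0\<close>, hence off isolated points
  everywhere.\<close>

lemma A_ext_formula:
  assumes \<sigma>: "\<sigma> \<in> {1, -1}"
  obtains X where "\<And>p. \<forall>\<^sub>F s in at p. inverse_ops (X s) (pencil \<sigma> s)"
    "\<And>p. \<forall>\<^sub>F s in at p. A_ext \<sigma> s = a \<sigma> o\<^sub>L X s" "\<And>p. meromorphic_op_at (A_ext \<sigma>) p"
proof -
  have lin: "clinear_op (a \<sigma>)" using s0 \<sigma> by (rule A_clinear)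
  have approx: "finite_rank_approximable (a \<sigma>)"
    unfolding A_op_def using s0 \<sigma> unfolding nonresonant_def
    by (intro finite_rank_approximable_compose T_lim_approximable line_op_in_affine_ops[OF H0 J]
        J_clinear J)
  obtain Z where Z: "\<And>p. meromorphic_op_at Z p"
    "\<And>p. \<forall>\<^sub>F s in at p. inverse_ops (Z s) (id_blinfun + s *\<^sub>C a \<sigma>)"
    "\<And>s Y. inverse_ops Y (id_blinfun + s *\<^sub>C a \<sigma>) \<Longrightarrow> Z s = Y"
    by (rule analytic_fredholm[OF approx lin], rule that)
  define X where "X s = Z (s - complex_of_real s0)" for s
  define f where "f s = a \<sigma> o\<^sub>L X s" for s
  have inv: "\<forall>\<^sub>F s in at p. inverse_ops (X s) (pencil \<sigma> s)" for p
    unfolding X_def by (rule eventually_at_shift[OF Z(2)])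
  have f_mero: "meromorphic_op_at f p" for p
    unfolding f_def X_def
    by (intro meromorphic_op_at_compose meromorphic_op_at_const lin meromorphic_op_at_shift Z(1))
  have f_real: "f (complex_of_real s) = A \<sigma> s" if s: "regular s" for s
    using Z(3)[OF pencil_inverse(1)[OF s \<sigma>]] pencil_inverse(2)[OF s \<sigma>] by (simp add: f_def X_def)
  have "\<exists>f. op_meromorphic f \<and> (\<forall>s. regular s \<longrightarrow> f (complex_of_real s) = A \<sigma> s)"
    using op_meromorphicI[of f] f_mero f_real by blast
  then have "op_meromorphic (A_ext \<sigma>) \<and> (\<forall>s. regular s \<longrightarrow> A_ext \<sigma> (complex_of_real s) = A \<sigma> s)"
    unfolding A_mero_def by (rule someI_ex)
  then have ext: "op_meromorphic (A_ext \<sigma>)" "\<And>s. regular s \<Longrightarrow> A_ext \<sigma> (complex_of_real s) = A \<sigma> s"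
    by blast+
  have "\<exists>\<^sub>F s in at (complex_of_real s0). A_ext \<sigma> s = f s"
  proof (rule ccontr)
    assume "\<not> ?thesis"
    then have "\<forall>\<^sub>F s in at (complex_of_real s0). A_ext \<sigma> s \<noteq> f s" by (simp add: not_frequently)
    \<comment> \<open>Coincidence is known on the real line only, so the complex punctured
      neighbourhood is pulled back to a real one.\<close>
    moreover have "filterlim complex_of_real (at (complex_of_real s0)) (at s0)"
      by (auto simp: filterlim_at intro!: tendsto_intros) (auto simp: eventually_at_filter)
    ultimately have "\<forall>\<^sub>F s in at s0. A_ext \<sigma> (complex_of_real s) \<noteq> f (complex_of_real s)"
      by (rule eventually_compose_filterlim)
    then have "\<forall>\<^sub>F s in at s0. False"
      using eventually_nonresonant[OF H0 J s0]
      by eventually_elim (simp add: ext f_real)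
    then show False by simp
  qed
  from op_meromorphic_identity[OF ext(1) op_meromorphicI[OF f_mero] this]
  have eq: "\<forall>\<^sub>F s in at p. A_ext \<sigma> s = f s" for p .
  show thesis
  proof (rule that[OF inv])
    show "\<forall>\<^sub>F s in at p. A_ext \<sigma> s = a \<sigma> o\<^sub>L X s" for p using eq by (simp add: f_def)
    show "meromorphic_op_at (A_ext \<sigma>) p" for p using f_mero eq by (rule meromorphic_op_at_cong)
  qed
qed

text \<open>The choice in \<open>A_nilpotent\<close> is unambiguous: two candidates share a
  sufficiently small radius \<open>\<epsilon>\<close>, and the integral over that circle is
  unique.\<close>

lemma A_nilpotent_residue:
  assumes \<sigma>: "\<sigma> \<in> {1, -1}"
  shows "cinner w (blinfun_apply (A_nilpotent F H0 J \<mu> \<sigma> r) x)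
    = residue (\<lambda>s. (s - complex_of_real r) * cinner w (blinfun_apply (A_ext \<sigma> s) x)) (complex_of_real r)"
proof -
  let ?f = "\<lambda>s. (s - complex_of_real r) *\<^sub>C A_ext \<sigma> s"
  let ?P = "\<lambda>B. \<exists>e>0. \<forall>\<epsilon>>0. \<epsilon> < e \<longrightarrow> has_op_contour_integral ?f
      ((2 * complex_of_real pi * \<i>) *\<^sub>C B) (circlepath (complex_of_real r) \<epsilon>)"
  have "meromorphic_op_at (A_ext \<sigma>) (complex_of_real r)"
    by (rule A_ext_formula[OF \<sigma>])
  then have "meromorphic_op_at ?f (complex_of_real r)"
    by (intro meromorphic_op_at_scaleC meromorphic_intros)
  then obtain B where B: "?P B" and res: "\<And>w x. cinner w (B x)
      = residue (\<lambda>s. cinner w (blinfun_apply (?f s) x)) (complex_of_real r)"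
    by (rule op_residue_exists) (rule that)
  define B' where "B' = A_nilpotent F H0 J \<mu> \<sigma> r"
  have B': "?P B'" unfolding B'_def A_nilpotent_def by (rule someI[where P = ?P, OF B])
  obtain e where e: "0 < e" "\<forall>\<epsilon>>0. \<epsilon> < e \<longrightarrow> has_op_contour_integral ?f
      ((2 * complex_of_real pi * \<i>) *\<^sub>C B) (circlepath (complex_of_real r) \<epsilon>)"
    using B by (elim exE conjE) (rule that)
  obtain e' where e': "0 < e'" "\<forall>\<epsilon>>0. \<epsilon> < e' \<longrightarrow> has_op_contour_integral ?f
      ((2 * complex_of_real pi * \<i>) *\<^sub>C B') (circlepath (complex_of_real r) \<epsilon>)"
    using B' by (elim exE conjE) (rule that)
  define \<epsilon> where "\<epsilon> = min e e' / 2"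
  have \<epsilon>: "0 < \<epsilon>" "\<epsilon> < e" "\<epsilon> < e'" using e(1) e'(1) by (auto simp: \<epsilon>_def min_def)
  have "(2 * complex_of_real pi * \<i>) *\<^sub>C B = (2 * complex_of_real pi * \<i>) *\<^sub>C B'"
    using e(2)[rule_format, OF \<epsilon>(1,2)] e'(2)[rule_format, OF \<epsilon>(1,3)]
    unfolding has_op_contour_integral_def by (rule has_integral_unique)
  then have "B = B'" by simp
  then show ?thesis
    using res by (simp add: B'_def scaleC_blinfun.rep_eq cinner_scaleC_right)
qed

end

section \<open>Expansion at the resonance point\<close>

locale real_resonance = regular_rigged_line F H \<J> D H0 J \<mu> s0
  for F :: "('h :: {chilbert_space, second_countable_topology} \<times>
             'k :: {chilbert_space, second_countable_topology}) set"
    and H :: "('h \<times> 'h) set" and \<J> :: "('k \<Rightarrow>\<^sub>L 'k) set" and D :: "'h set"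
    and H0 :: "('h \<times> 'h) set" and J :: "'k \<Rightarrow>\<^sub>L 'k" and \<mu> s0 :: real +
  fixes r \<sigma> :: real and k :: nat
  assumes resonant: "\<not> nonresonant F H0 J \<mu> r" and \<sigma>: "\<sigma> \<in> {1, -1}" and k: "1 \<le> k"
begin

abbreviation "Q \<equiv> root_nilpotent (a \<sigma>) (r - s0) k"
abbreviation "N \<equiv> {v. (blinfun_apply (id_blinfun + (r - s0) *\<^sub>R a \<sigma>) ^^ k) v = 0}"
abbreviation "\<A> \<tau> \<equiv> blinfun_apply (A_nilpotent F H0 J \<mu> \<tau> r)"

lemma d_nonzero: "r - s0 \<noteq> 0"
  using resonant s0 by auto

lemma minus_\<sigma>: "- \<sigma> \<in> {1, -1}"
  using \<sigma> by auto

lemma a_lin: "clinear_op (a \<sigma>)"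
  using s0 \<sigma> by (rule A_clinear)

lemma Q_in_N: "v \<in> N \<Longrightarrow> (Q ^^ j) v \<in> N"
  using root_nilpotent_funpow_in_root_space[OF a_lin d_nonzero k, of v j] by simp

lemma A_on_root_space:
  assumes v: "v \<in> N" and z: "z \<noteq> complex_of_real r" and X: "inverse_ops X (pencil \<sigma> z)"
  shows "blinfun_apply (a \<sigma>) (blinfun_apply X v)
    = (\<Sum>j\<le>k. (1 / (z - complex_of_real r) ^ Suc j) *\<^sub>C (Q ^^ j) v)"
  by (rule resolvent_on_root_space[OF a_lin d_nonzero k])
    (use assms in \<open>simp_all\<close>)

lemma A_nilpotent_on_root_space:
  assumes v: "v \<in> N"
  shows "\<A> \<sigma> v = Q v"
proof (rule cinner_eqI)
  fix w
  obtain X where X: "\<And>p. \<forall>\<^sub>F s in at p. inverse_ops (X s) (pencil \<sigma> s)"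
    "\<And>p. \<forall>\<^sub>F s in at p. A_ext \<sigma> s = a \<sigma> o\<^sub>L X s"
    by (rule A_ext_formula[OF \<sigma>], rule that)
  have "\<forall>\<^sub>F s in at (complex_of_real r). s \<noteq> complex_of_real r"
    by (simp add: eventually_at_filter)
  \<comment> \<open>The factor \<open>s - r\<close> lowers the exponents from \<open>Suc j\<close>
    to \<open>j\<close>, so the residue picks out \<open>j = 1\<close>.\<close>
  then have "\<forall>\<^sub>F s in at (complex_of_real r). (s - complex_of_real r) * cinner w (A_ext \<sigma> s v)
      = (\<Sum>j\<le>k. cinner w ((Q ^^ j) v) / (s - complex_of_real r) ^ j)"
    using X(1) X(2)
  proof eventually_elim
    case (elim s)
    then show ?case
      by (simp add: A_on_root_space[OF v elim(1,2)] cinner_sum_right cinner_scaleC_right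
          sum_distrib_left)
  qed
  then have "residue (\<lambda>s. (s - complex_of_real r) * cinner w (A_ext \<sigma> s v)) (complex_of_real r)
      = cinner w ((Q ^^ 1) v)"
    using k by (rule residue_principal_part)
  then show "cinner w (\<A> \<sigma> v) = cinner w (Q v)"
    by (simp add: A_nilpotent_residue[OF \<sigma>])
qed

lemma A_nilpotent_funpow:
  assumes u: "u \<in> N"
  shows "(\<A> \<sigma> ^^ j) u = (Q ^^ j) u"
proof (induction j)
  case (Suc j)
  then show ?case using A_nilpotent_on_root_space[OF Q_in_N[OF u]] by simp
qed simp

text \<open>Writing \<open>v\<close> and \<open>y\<close> as pencils applied to \<open>v'\<close>
  and \<open>y'\<close> reduces the claim to \<open>A_adjoint\<close> at the real point
  \<open>s0\<close>; the conjugate of \<open>z\<close> appears because the form is antilinear in its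
  first argument.\<close>

lemma pencil_inverse_adjoint:
  assumes X: "inverse_ops X (pencil \<sigma> (cnj z))" and Y: "inverse_ops Y (pencil (- \<sigma>) z)"
  shows "cinner v (blinfun_apply J (blinfun_apply (a (- \<sigma>)) (blinfun_apply Y y)))
    = cinner (blinfun_apply (a \<sigma>) (blinfun_apply X v)) (blinfun_apply J y)"
proof -
  define h where "h = z - complex_of_real s0"
  define v' y' where "v' = X v" and "y' = Y y"
  have v: "v = v' + cnj h *\<^sub>C a \<sigma> v'"
    using X[unfolded inverse_ops_iff, rule_format, of v, THEN conjunct2, symmetric]
    by (simp add: v'_def h_def blinfun.add_left scaleC_blinfun.rep_eq)
  have y: "y = y' + h *\<^sub>C a (- \<sigma>) y'"
    using Y[unfolded inverse_ops_iff, rule_format, of y, THEN conjunct2, symmetric]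
    by (simp add: y'_def h_def blinfun.add_left scaleC_blinfun.rep_eq)
  have adj: "cinner v' (J (a (- \<sigma>) y')) = cinner (a \<sigma> v') (J y')"
    using A_adjoint[OF s0 minus_\<sigma>, of v' y'] by simp
  have "cinner v (J (a (- \<sigma>) y')) = cinner (a \<sigma> v') (J y') + h * cinner (a \<sigma> v') (J (a (- \<sigma>) y'))"
    by (subst v) (simp add: cinner_add_left cinner_scaleC_left adj)
  also have "\<dots> = cinner (a \<sigma> v') (J y)"
    by (subst y) (simp add: blinfun.add_right clinear_opD[OF J_clinear[OF J]] cinner_add_right
        cinner_scaleC_right)
  finally show ?thesis by (simp add: v'_def y'_def)
qed

text \<open>Since \<open>r\<close> is real, conjugation maps punctured neighbourhoods of
  \<open>r\<close> to punctured neighbourhoods of \<open>r\<close>.\<close>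

lemma eventually_at_cnj:
  assumes "\<forall>\<^sub>F s in at (complex_of_real r). P s"
  shows "\<forall>\<^sub>F s in at (complex_of_real r). P (cnj s)"
proof -
  have "filterlim cnj (at (complex_of_real r)) (at (complex_of_real r))"
    unfolding filterlim_at
    using tendsto_cnj[OF tendsto_ident_at, of "complex_of_real r" UNIV]
    by (auto simp: eventually_at_filter complex_eq_iff)
  with assms show ?thesis by (rule eventually_compose_filterlim)
qed

text \<open>The vector \<open>y\<close> is arbitrary, so \<open>A\<close> at
  \<open>- \<sigma>\<close> has no known expansion on it. Instead \<open>A\<close> at
  \<open>\<sigma>\<close> and parameter \<open>cnj s\<close> is expanded on \<open>v\<close>;
  conjugating the coefficients restores powers of \<open>s - r\<close>.\<close>

lemma A_nilpotent_adjoint: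
  assumes v: "v \<in> N"
  shows "cinner v (blinfun_apply J (\<A> (- \<sigma>) y)) = cinner (Q v) (blinfun_apply J y)"
proof -
  obtain X where X: "\<And>p. \<forall>\<^sub>F s in at p. inverse_ops (X s) (pencil \<sigma> s)"
    by (rule A_ext_formula[OF \<sigma>], rule that)
  obtain Y where Y: "\<And>p. \<forall>\<^sub>F s in at p. inverse_ops (Y s) (pencil (- \<sigma>) s)"
    "\<And>p. \<forall>\<^sub>F s in at p. A_ext (- \<sigma>) s = a (- \<sigma>) o\<^sub>L Y s"
    by (rule A_ext_formula[OF minus_\<sigma>], rule that)
  have "\<forall>\<^sub>F s in at (complex_of_real r). s \<noteq> complex_of_real r"
    by (simp add: eventually_at_filter)
  then have "\<forall>\<^sub>F s in at (complex_of_real r).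
      (s - complex_of_real r) * cinner (J v) (A_ext (- \<sigma>) s y)
      = (\<Sum>j\<le>k. cinner ((Q ^^ j) v) (J y) / (s - complex_of_real r) ^ j)"
    using eventually_at_cnj[OF X] Y(1) Y(2)
  proof eventually_elim
    case (elim s)
    have "cnj s \<noteq> complex_of_real r"
      using elim(1) by (metis complex_cnj_cnj complex_cnj_complex_of_real)
    note root = A_on_root_space[OF v this elim(2)]
    have "cinner (J v) (A_ext (- \<sigma>) s y) = cinner (a \<sigma> (X (cnj s) v)) (J y)"
      using pencil_inverse_adjoint[OF elim(2,3), of v y] elim(4) by (simp add: J_selfadj)
    also have "\<dots> = cnj (cinner (J y) (a \<sigma> (X (cnj s) v)))"
      by (rule cinner_commute)
    also have "\<dots> = (\<Sum>j\<le>k. cinner ((Q ^^ j) v) (J y) / (s - complex_of_real r) ^ Suc j)"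
      unfolding root
      by (simp add: cinner_sum_right cinner_scaleC_right cinner_commute[of "J y"])
    finally show ?case using elim(1) by (simp add: sum_distrib_left)
  qed
  then have "residue (\<lambda>s. (s - complex_of_real r) * cinner (J v) (A_ext (- \<sigma>) s y)) (complex_of_real r)
      = cinner ((Q ^^ 1) v) (J y)"
    using k by (rule residue_principal_part)
  then show ?thesis
    by (simp add: A_nilpotent_residue[OF minus_\<sigma>] J_selfadj)
qed

text \<open>Factors cross the form one by one. After each crossing the left vector is
  \<open>Q v\<close>, again in \<open>N\<close>, which is why the induction keeps \<open>v\<close>
  general.\<close>

lemma A_nilpotent_funpow_adjoint:
  "v \<in> N \<Longrightarrow> cinner v (blinfun_apply J ((\<A> (- \<sigma>) ^^ m) y)) = cinner ((Q ^^ m) v) (blinfun_apply J y)"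
proof (induction m arbitrary: v)
  case (Suc m)
  have "cinner v (J ((\<A> (- \<sigma>) ^^ Suc m) y)) = cinner (Q v) (J ((\<A> (- \<sigma>) ^^ m) y))"
    using A_nilpotent_adjoint[OF Suc.prems] by simp
  also have "\<dots> = cinner ((Q ^^ m) (Q v)) (J y)"
    using Q_in_N[OF Suc.prems, of 1] by (intro Suc.IH) simp
  finally show ?case by (simp add: funpow_swap1)
qed simp

lemma cinner_J_Im_zero: "Im (cinner u (blinfun_apply J u)) = 0"
  using cinner_commute[of u "J u"] J_selfadj[of u u] by (simp add: complex_eq_iff)

lemma Im_T_expansion:
  assumes u: "u \<in> N" and s: "regular s"
  shows "cinner (blinfun_apply J u) (blinfun_apply (Im_op (T \<sigma> s)) (blinfun_apply J u))
    = complex_of_real (\<Sum>j=2..k. Im (cinner u (blinfun_apply J ((\<A> \<sigma> ^^ (j - 1)) u))) / (s - r) ^ j)"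
proof -
  have sr: "s \<noteq> r" using s resonant by auto
  let ?c = "\<lambda>j. cinner u (J ((Q ^^ j) u))"
  have reg: "\<mu> \<in> regular_points F (line_op F H0 J s)" using s by (simp add: nonresonant_def)
  note lines = line_op_in_affine_ops[OF H0 J, of s]
  have "cinner (J u) (T (- \<sigma>) s (J u)) = cnj (cinner (J u) (T \<sigma> s (J u)))"
    using T_lim_adjoint[OF lines reg minus_\<sigma>, of "J u" "J u"] cinner_commute[of "J u" "T \<sigma> s (J u)"]
    by simp
  then have "cinner (J u) (Im_op (T \<sigma> s) (J u))
      = (1 / (2 * \<i>)) * (cinner (J u) (T \<sigma> s (J u)) - cnj (cinner (J u) (T \<sigma> s (J u))))"
    unfolding Im_op_def bounded_adj_T_lim[OF lines reg \<sigma>]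
    by (simp add: scaleC_blinfun.rep_eq blinfun.diff_left blinfun.minus_left cinner_scaleC_right
        cinner_diff_right)
  also have "\<dots> = complex_of_real (Im (cinner (J u) (T \<sigma> s (J u))))"
    by (simp add: complex_diff_cnj complex_eq_iff)
  also have "cinner (J u) (T \<sigma> s (J u)) = cinner u (J (A \<sigma> s u))"
    by (simp add: A_op_def J_selfadj)
  also have "A \<sigma> s u = (\<Sum>j\<le>k. (1 / (complex_of_real s - complex_of_real r) ^ Suc j) *\<^sub>C (Q ^^ j) u)"
  proof -
    have "A \<sigma> s u = a \<sigma> ((id_blinfun - (s - s0) *\<^sub>R A \<sigma> s) u)"
      using pencil_inverse(2)[OF s \<sigma>] by (metis blinfun_apply_blinfun_compose)
    then show ?thesis
      using A_on_root_space[OF u _ pencil_inverse(1)[OF s \<sigma>]] sr by simp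
  qed
  also have "cinner u (J \<dots>) = (\<Sum>j\<le>k. complex_of_real (1 / (s - r) ^ Suc j) * ?c j)"
    by (simp add: blinfun.sum_right clinear_opD[OF J_clinear[OF J]] cinner_sum_right
        cinner_scaleC_right)
  also have "Im \<dots> = (\<Sum>j\<le>k. Im (?c j) / (s - r) ^ Suc j)"
    by (simp add: Im_sum del: of_real_divide)
  \<comment> \<open>Index \<open>j\<close> belongs to the power \<open>Suc j\<close>. The term
    \<open>j = 0\<close> drops out because \<open>cinner u (J u)\<close> is real, and
    \<open>j = k\<close> because \<open>Q ^^ k\<close> kills \<open>u\<close>; so the highest power
    is \<open>k\<close>.\<close>
  also have "\<dots> = (\<Sum>j\<in>{1..<k}. Im (?c j) / (s - r) ^ Suc j)"
  proof (rule sum.mono_neutral_right)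
    show "\<forall>j\<in>{..k} - {1..<k}. Im (?c j) / (s - r) ^ Suc j = 0"
    proof
      fix j assume "j \<in> {..k} - {1..<k}"
      then consider "j = 0" | "j = k" by force
      then show "Im (?c j) / (s - r) ^ Suc j = 0"
      proof cases
        case 2
        then show ?thesis
          using root_nilpotent_funpow_order[OF a_lin d_nonzero k, of u k] u by simp
      qed (simp add: cinner_J_Im_zero)
    qed
  qed auto
  also have "\<dots> = (\<Sum>j=2..k. Im (?c (j - 1)) / (s - r) ^ j)"
    by (rule sum.reindex_bij_witness[of _ "\<lambda>j. j - 1" Suc]) auto
  finally show ?thesis by (simp add: A_nilpotent_funpow[OF u])
qed

lemma coefficient_conjugate:
  assumes u: "u \<in> N"
  shows "Im (cinner u (blinfun_apply J ((\<A> \<sigma> ^^ m) u)))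
    = - Im (cinner u (blinfun_apply J ((\<A> (- \<sigma>) ^^ m) u)))"
proof -
  have "cinner u (J ((\<A> (- \<sigma>) ^^ m) u)) = cinner (J ((Q ^^ m) u)) u"
    by (rule trans[OF A_nilpotent_funpow_adjoint[OF u] J_selfadj])
  also have "\<dots> = cnj (cinner u (J ((Q ^^ m) u)))" by (rule cinner_commute)
  finally show ?thesis by (simp add: A_nilpotent_funpow[OF u])
qed

end

theorem proposition1p29:
  fixes F :: "('h :: {chilbert_space, second_countable_topology} \<times>
               'k :: {chilbert_space, second_countable_topology}) set"
    and H H0 :: "('h \<times> 'h) set" and \<J> :: "('k \<Rightarrow>\<^sub>L 'k) set" and D :: "'h set"
    and J :: "'k \<Rightarrow>\<^sub>L 'k" and \<mu> r s0 \<sigma> :: real and u :: 'k and k :: nat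
  assumes setting: "rigged_affine_space F H \<J> D"
    and ess_regular: "\<mu> \<in> essentially_regular_points F H \<J>"
    and H0: "H0 \<in> affine_ops F H \<J>" and J: "J \<in> \<J>"
    and line: "regular_line F H0 J \<mu>"
    and resonance: "real_resonance_point F H0 J \<mu> r"
    and k: "k \<ge> 1"
    and sign: "\<sigma> \<in> {1, -1}"
    and s0: "nonresonant F H0 J \<mu> s0"
    and u_space: "u \<in> resonance_space F H0 J \<mu> \<sigma> r s0"
    and u_order: "resonance_vector_order F H0 J \<mu> \<sigma> r s0 u k"
  shows "(\<exists>c :: nat \<Rightarrow> real.
           (\<forall>s. nonresonant F H0 J \<mu> s \<longrightarrow>
              cinner (J u) (Im_op (T_lim F (line_op F H0 J s) \<mu> \<sigma>) (J u))
                = complex_of_real (\<Sum>j=2..k. c j / (s - r) ^ j)) \<and>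
           (\<forall>j\<in>{2..k}.
              c j = Im (cinner u (J ((blinfun_apply (A_nilpotent F H0 J \<mu> \<sigma> r) ^^ (j - 1)) u))) \<and>
              c j = - Im (cinner u (J ((blinfun_apply (A_nilpotent F H0 J \<mu> (- \<sigma>) r) ^^ (j - 1)) u))))) \<and>
         (k = 1 \<longrightarrow> (\<forall>s. nonresonant F H0 J \<mu> s \<longrightarrow>
            cinner (J u) (Im_op (T_lim F (line_op F H0 J s) \<mu> \<sigma>) (J u)) = 0))"
proof -
  interpret rigged_affine_space F H \<J> D by (rule setting)
  interpret real_resonance F H \<J> D H0 J \<mu> s0 r \<sigma> k
    by unfold_locales (use H0 J s0 resonance sign k in \<open>auto simp: real_resonance_point_def\<close>)
  have u: "u \<in> N"
    using u_order by (simp add: resonance_vector_order_def resonance_space_order_def)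
  show ?thesis
    \<comment> \<open>For \<open>k = 1\<close> the sum over \<open>{2..k}\<close> is empty, which is
      the last claim.\<close>
    using Im_T_expansion[OF u] coefficient_conjugate[OF u]
    by (intro conjI exI[of _ "\<lambda>j. Im (cinner u (J ((\<A> \<sigma> ^^ (j - 1)) u)))"]) auto
qed

end
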